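(* Let $q\in(0,1)$, $\beta\in\mathbb{R}$, $m\in\mathbb{N}$, $1\leqslant s\leqslant\infty$, $s'=\frac{s}{s-1}$ (with $s'=\infty$ for $s=1$ and $s'=1$ for $s=\infty$), and let $C^\psi_{\beta,s}$ and $C^\psi_\beta H_\omega$ be the classes generated by the coefficients $\psi(k)=\psi_m(k)$, $$\psi_m(k)=q^k\bigg(1+\sum_{j=1}^{m-1}\frac{(1-q^2)^j}{j!\,2^j}\prod_{l=0}^{j-1}(k+2l)\bigg),\quad k\in\mathbb{N},$$ of the polyharmonic Poisson kernel $P_{q,\beta}(m,t)=\sum_{k=1}^\infty\psi_m(k)\cos\left(kt-\frac{\beta\pi}{2}\right)$. Let $n,p\in\mathbb{N}$, $p\leqslant n$, and let $\omega(t)$ be a convex (upwards) modulus of continuity satisfying $\lim_{t\to0}\frac{\omega(t)}{t}=\infty$. Then the following asymptotic equalities hold as $n-p\to\infty$: $$\mathcal{E}(C^\psi_{\beta,s};V_{n,p})=\frac{q^{n-p+1}}{p}\bigg(1+\sum_{j=1}^{m-1}\frac{(1-q^2)^j}{j!\,2^j}\prod_{l=0}^{j-1}(n-p+1+2l)\bigg)$$ $$\times\Bigg(\frac{\|\cos t\|_{s'}}{\pi^{1+1/s'}}K_{q,p}(s')+\frac{O(1)}{n-p+1}\bigg(\frac{1}{(1-q)^{\sigma(s',p)}}+\frac{mq}{(1-q)^2}\min\Big\{p,\frac{1}{1-q}\Big\}\bigg)\Bigg),$$ $$\mathcal{E}(C^\psi_{\beta}H_\omega;V_{n,p})=\frac{q^{n-p+1}}{p}\bigg(1+\sum_{j=1}^{m-1}\frac{(1-q^2)^j}{j!\,2^j}\prod_{l=0}^{j-1}(n-p+1+2l)\bigg)$$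 $$\times\Bigg(\frac{4}{\pi^2}\frac{1-q^{2p}}{1-q^2}\mathbf{K}(q^p)\int_0^{\pi/2}\omega\left(\frac{2t}{n-p+1}\right)\sin t\,dt$$ $$+\frac{O(1)}{n-p+1}\bigg(\frac{\omega(\pi)}{(1-q)^{\gamma(p)}}+\frac{mq}{(1-q)^2}\min\Big\{p,\frac{1}{1-q}\Big\}\,\omega\Big(\frac{1}{n-p+1}\Big)\bigg)\Bigg),$$ where $$K_{q,p}(s')=2^{-1/s'}\left\|\frac{\sqrt{1-2q^p\cos pt+q^{2p}}}{1-2q\cos t+q^2}\right\|_{s'},\qquad \sigma(s',p)=\begin{cases}1,& s'=1,\ p=1,\\ 2,& 1<s'\leqslant\infty,\ p=1,\\ 3,& 1\leqslant s'\leqslant\infty,\ p\in\mathbb{N}\setminus\{1\},\end{cases}$$ $\gamma(p)=2$ if $p=1$ and $\gamma(p)=3$ if $p=2,3,\ldots,n$, $\mathbf{K}(\rho)=\int_0^{\pi/2}\frac{dt}{\sqrt{1-\rho^2\sin^2t}}$ is the complete elliptic integral of the first kind, and the quantities $O(1)$ are uniformly bounded in $n$, $p$, $q$, $m$, $s$, $\omega$ and $\beta$.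
   Context: Spaces. $L_s$ ($1\leqslant s<\infty$) is the space of $2\pi$-periodic functions with $\|f\|_s=\left(\int_0^{2\pi}|f(t)|^s\,dt\right)^{1/s}<\infty$; $L_\infty$ is the space of essentially bounded measurable $2\pi$-periodic functions with $\|f\|_\infty=\operatorname{ess\,sup}_t|f(t)|$; $C$ is the space of continuous $2\pi$-periodic functions with $\|f\|_C=\max_t|f(t)|$. By convention $1/s'=0$ when $s'=\infty$, and empty sums equal $0$. $(\psi,\beta)$-derivative. Let $f\in L_1$ have Fourier series $\frac{a_0(f)}{2}+\sum_{k=1}^\infty(a_k(f)\cos kx+b_k(f)\sin kx)$, let $\psi(k)$, $k\in\mathbb{N}$, be a sequence of real numbers and $\beta\in\mathbb{R}$. If there is $\varphi\in L_1$ with Fourier series $\sum_{k=1}^\infty\frac{1}{\psi(k)}\left(a_k(f)\cos(kx+\frac{\beta\pi}{2})+b_k(f)\sin(kx+\frac{\beta\pi}{2})\right)$, then $\varphi$ is called the $(\psi,\beta)$-derivative of $f$, denoted $f^\psi_\beta$. For $\mathfrak{N}\subset L_1$, $L^\psi_\beta\mathfrak{N}$ is the set of $f\in L_1$ for which $f^\psi_\beta$ exists and belongs to $\mathfrak{N}$, and $C^\psi_\beta\mathfrak{N}=C\cap L^\psi_\beta\mathfrak{N}$. Classes. $U_s^0=\{\varphi\in L_s:\|\varphi\|_s\leqslant1,\ \int_0^{2\pi}\varphi(t)\,dt=0\}$ and $C^\psi_{\beta,s}=C^\psi_\beta U_s^0$. For a modulus of continuity $\omega$ (a continuous, nondecreasing,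 subadditive function on $[0,\infty)$ with $\omega(0)=0$), $H_\omega=\{\varphi\in C:\omega(\varphi;t)\leqslant\omega(t),\ t\geqslant0\}$, where $\omega(\varphi;t)=\sup_{|h|\leqslant t}\|\varphi(\cdot+h)-\varphi(\cdot)\|_C$. "Convex (upwards)" means concave in the usual modern terminology. De la Vallée Poussin sums. $V_{n,p}(f;x)=\frac1p\sum_{k=n-p}^{n-1}S_k(f;x)$, where $S_k(f;x)$ is the $k$th partial sum (harmonics of order at most $k$) of the Fourier series of $f$. For a class $\mathfrak{M}\subset C$, $\mathcal{E}(\mathfrak{M};V_{n,p})=\sup_{f\in\mathfrak{M}}\|f(\cdot)-V_{n,p}(f;\cdot)\|_C$. Meaning of the asymptotic notation. The parameter $p=p(n)$ may vary with $n$. "As $n-p\to\infty$, with $O(1)$ uniformly bounded in the listed parameters" means: there is an absolute constant $K$ such that for each $q\in(0,1)$ and $m\in\mathbb{N}$ there is $N=N(q,m)$ such that, for all $n,p$ with $p\leqslant n$ and $n-p\geqslant N$ and all values of the other parameters, the formulas hold with quantities $O(1)$ of absolute value at most $K$. *)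

theory Defs
  imports "HOL-Analysis.Analysis" "HOL-Probability.Essential_Supremum"
begin

definition periodic_2pi :: "(real \<Rightarrow> real) \<Rightarrow> bool" where
  "periodic_2pi f \<longleftrightarrow> (\<forall>t. f (t + 2 * pi) = f t)"

text \<open>The exponent \<open>s\<close> of an \<open>L\<^sub>s\<close> space is an extended real, \<open>1 \<le> s \<le> \<infinity>\<close>. Elements of
  \<open>L\<^sub>s\<close> are represented by genuine functions, not by classes modulo null sets.\<close>

definition Lp_space :: "ereal \<Rightarrow> (real \<Rightarrow> real) set" where
  "Lp_space s = {f. periodic_2pi f \<and> f \<in> borel_measurable lebesgue \<and>
     (if s = \<infinity> then esssup lebesgue (\<lambda>t. ereal \<bar>f t\<bar>) < \<infinity>
      else set_integrable lebesgue {0..2 * pi} (\<lambda>t. \<bar>f t\<bar> powr real_of_ereal s))}"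

definition Lp_norm :: "ereal \<Rightarrow> (real \<Rightarrow> real) \<Rightarrow> real" where
  "Lp_norm s f =
     (if s = \<infinity> then real_of_ereal (esssup lebesgue (\<lambda>t. ereal \<bar>f t\<bar>))
      else (LINT t:{0..2 * pi}|lebesgue. \<bar>f t\<bar> powr real_of_ereal s) powr (1 / real_of_ereal s))"

definition conj_exponent :: "ereal \<Rightarrow> ereal" where
  "conj_exponent s = (if s = 1 then \<infinity> else if s = \<infinity> then 1 else s / (s - 1))"

definition C_space :: "(real \<Rightarrow> real) set" where
  "C_space = {f. periodic_2pi f \<and> continuous_on UNIV f}"

definition C_norm :: "(real \<Rightarrow> real) \<Rightarrow> real" where
  "C_norm f = (SUP t. \<bar>f t\<bar>)"

definition fourier_a :: "nat \<Rightarrow> (real \<Rightarrow> real) \<Rightarrow> real" where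
  "fourier_a k f = (1 / pi) * (LINT t:{0..2 * pi}|lebesgue. f t * cos (real k * t))"

definition fourier_b :: "nat \<Rightarrow> (real \<Rightarrow> real) \<Rightarrow> real" where
  "fourier_b k f = (1 / pi) * (LINT t:{0..2 * pi}|lebesgue. f t * sin (real k * t))"

definition fourier_partial_sum :: "nat \<Rightarrow> (real \<Rightarrow> real) \<Rightarrow> real \<Rightarrow> real" where
  "fourier_partial_sum n f x = fourier_a 0 f / 2 +
     (\<Sum>k = 1..n. fourier_a k f * cos (real k * x) + fourier_b k f * sin (real k * x))"

text \<open>Two trigonometric series are the same when their harmonics agree as functions of \<open>x\<close>; the
  constant term of the Fourier series of \<open>\<phi>\<close> is zero. The function \<open>\<phi>\<close> is determined only up to
  a null set, which is why this is a relation. It is meant for \<open>\<psi> k \<noteq> 0\<close>.\<close>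

definition has_psi_beta_derivative ::
    "(nat \<Rightarrow> real) \<Rightarrow> real \<Rightarrow> (real \<Rightarrow> real) \<Rightarrow> (real \<Rightarrow> real) \<Rightarrow> bool" where
  "has_psi_beta_derivative \<psi> \<beta> f \<phi> \<longleftrightarrow>
     \<phi> \<in> Lp_space 1 \<and> fourier_a 0 \<phi> = 0 \<and>
     (\<forall>k\<ge>1. \<forall>x. fourier_a k \<phi> * cos (real k * x) + fourier_b k \<phi> * sin (real k * x) =
        (1 / \<psi> k) * (fourier_a k f * cos (real k * x + \<beta> * pi / 2)
                    + fourier_b k f * sin (real k * x + \<beta> * pi / 2)))"

definition L_class :: "(nat \<Rightarrow> real) \<Rightarrow> real \<Rightarrow> (real \<Rightarrow> real) set \<Rightarrow> (real \<Rightarrow> real) set" where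
  "L_class \<psi> \<beta> N = {f \<in> Lp_space 1. \<exists>\<phi>\<in>N. has_psi_beta_derivative \<psi> \<beta> f \<phi>}"

definition C_class :: "(nat \<Rightarrow> real) \<Rightarrow> real \<Rightarrow> (real \<Rightarrow> real) set \<Rightarrow> (real \<Rightarrow> real) set" where
  "C_class \<psi> \<beta> N = C_space \<inter> L_class \<psi> \<beta> N"

definition U0 :: "ereal \<Rightarrow> (real \<Rightarrow> real) set" where
  "U0 s = {\<phi> \<in> Lp_space s. Lp_norm s \<phi> \<le> 1 \<and> (LINT t:{0..2 * pi}|lebesgue. \<phi> t) = 0}"

text \<open>Only the values of a modulus of continuity on \<open>[0, \<infinity>)\<close> are relevant.\<close>

definition modulus_of_continuity :: "(real \<Rightarrow> real) \<Rightarrow> bool" where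
  "modulus_of_continuity \<omega> \<longleftrightarrow>
     continuous_on {0..} \<omega> \<and> mono_on {0..} \<omega> \<and>
     (\<forall>s\<ge>0. \<forall>t\<ge>0. \<omega> (s + t) \<le> \<omega> s + \<omega> t) \<and> \<omega> 0 = 0"

definition modulus_of :: "(real \<Rightarrow> real) \<Rightarrow> real \<Rightarrow> real" where
  "modulus_of \<phi> t = (SUP h\<in>{h. \<bar>h\<bar> \<le> t}. C_norm (\<lambda>x. \<phi> (x + h) - \<phi> x))"

definition H_class :: "(real \<Rightarrow> real) \<Rightarrow> (real \<Rightarrow> real) set" where
  "H_class \<omega> = {\<phi> \<in> C_space. \<forall>t\<ge>0. modulus_of \<phi> t \<le> \<omega> t}"

definition vallee_poussin :: "nat \<Rightarrow> nat \<Rightarrow> (real \<Rightarrow> real) \<Rightarrow> real \<Rightarrow> real" where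
  "vallee_poussin n p f x = (1 / real p) * (\<Sum>k = n - p..n - 1. fourier_partial_sum k f x)"

text \<open>The supremum is taken in the extended reals, so that an equation with a real right-hand side
  includes the assertion that it is finite.\<close>

definition approx_error :: "(real \<Rightarrow> real) set \<Rightarrow> nat \<Rightarrow> nat \<Rightarrow> ereal" where
  "approx_error M n p = (SUP f\<in>M. ereal (C_norm (\<lambda>x. f x - vallee_poussin n p f x)))"

definition polyharmonic_factor :: "nat \<Rightarrow> real \<Rightarrow> nat \<Rightarrow> real" where
  "polyharmonic_factor m q k =
     1 + (\<Sum>j = 1..m - 1. (1 - q\<^sup>2) ^ j / (fact j * 2 ^ j) * (\<Prod>l = 0..j - 1. real (k + 2 * l)))"

definition psi_polyharmonic :: "nat \<Rightarrow> real \<Rightarrow> nat \<Rightarrow> real" where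
  "psi_polyharmonic m q k = q ^ k * polyharmonic_factor m q k"

definition K_const :: "real \<Rightarrow> nat \<Rightarrow> ereal \<Rightarrow> real" where
  "K_const q p s' = 2 powr (- real_of_ereal (1 / s')) *
     Lp_norm s' (\<lambda>t. sqrt (1 - 2 * q ^ p * cos (real p * t) + q ^ (2 * p))
                      / (1 - 2 * q * cos t + q\<^sup>2))"

definition sigma_exp :: "ereal \<Rightarrow> nat \<Rightarrow> nat" where
  "sigma_exp s' p = (if p = 1 then (if s' = 1 then 1 else 2) else 3)"

definition gamma_exp :: "nat \<Rightarrow> nat" where
  "gamma_exp p = (if p = 1 then 2 else 3)"

definition elliptic_K :: "real \<Rightarrow> real" where
  "elliptic_K \<rho> = (LINT t:{0..pi / 2}|lebesgue. 1 / sqrt (1 - \<rho>\<^sup>2 * (sin t)\<^sup>2))"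

end

theory Submission
  imports Defs
begin

text \<open>The remainder \<open>f - V\<^sub>n\<^sub>,\<^sub>p f\<close> is a convolution of the derivative \<open>\<phi>\<close> with a kernel whose harmonics start at
  \<open>N = n - p + 1\<close>. Comparing \<open>\<psi>(N + i) / \<psi>(N)\<close> with \<open>q\<^sup>i\<close> reduces everything to \<open>m = 1\<close>, where the kernel is
  \<open>q\<^sup>N / p\<close> times \<open>Re (exp (\<i>(N t + b)) g(t))\<close> with \<open>g(t) = (1 - z\<^sup>p) / (1 - z)\<^sup>2\<close> and \<open>z = q exp (\<i>t)\<close>: a slowly varying
  amplitude times a fast oscillation.

  For the \<open>L\<^sub>s\<close> balls, \<open>g\<close> is replaced by a step function on the \<open>N\<close> periods of the oscillation, with
  values at mean value points, so that the norm of the modulated step function is exactly the product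
  of \<open>\<parallel>g\<parallel>\<close> and the normalised \<open>\<parallel>cos\<parallel>\<close>. Its Hoelder extremal automatically has mean zero, because it
  changes sign under a shift by half a period.

  For \<open>H\<^sub>\<omega>\<close>, the total phase \<open>\<Phi>(t) = N t + b + arg g(t)\<close> is taken as the new variable. Pairing points
  symmetric about the zeros of the cosine gives the upper bound, and \<open>\<omega>(2 \<bar>x\<bar>) / 2\<close> with the sign of \<open>x\<close>, folded
  along \<open>arcsin (cos \<Phi>)\<close>, attains it. The mean of \<open>\<bar>g\<bar>\<close> is a Poisson integral of \<open>\<bar>1 - z\<^sup>p\<bar>\<close>, which Landen's
  substitution turns into the elliptic integral.\<close>

section \<open>Fourier series of periodic functions\<close>

text \<open>The difficulty is uniformity: the bound on O(1) is absolute, and only the threshold for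
  n - p may depend on q and m. Every estimate therefore carries explicit powers of 1/(1-q). The
  threshold has two tasks: to keep q exp(m/N) comparable with q and 1 - q exp(m/N) comparable with 1
  - q, and to ensure N \<ge> 6/(1-q), so that the total phase runs at a speed between N/2 and 3N/2.

  The exponents in the error terms measure the smoothness of g. The power \<gamma>(p) comes from its
  Lipschitz constant. For p = s' = 1 the error of the step function is measured in L_1 by the total
  variation of g = 1/(1-z), and |g'| is a multiple of the Poisson kernel, whose mean is 1; this
  saves one power.

  The zero mean of the derivative is an obstacle only for lower bounds. On H_\<omega> it costs
  nothing, since the kernel is orthogonal to constants; on the L_s balls it is the reason for not
  using the Hoelder extremal of the kernel itself, whose mean need not vanish.\<close>

lemma periodic_shift_int:
  fixes f :: "real \<Rightarrow> 'a" and T :: real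
  assumes "\<And>t. f (t + T) = f t"
  shows "f (t + of_int k * T) = f t"
proof -
  have nat: "f (s + real n * T) = f s" for s n
  proof (induction n)
    case (Suc n)
    have "f (s + real (Suc n) * T) = f ((s + real n * T) + T)" by (simp add: algebra_simps)
    then show ?case using assms Suc by simp
  qed simp
  show ?thesis
  proof (cases "k \<ge> 0")
    case True
    then show ?thesis using nat[of t "nat k"] by simp
  next
    case False
    have "f (t + of_int k * T) = f (t + of_int k * T + real (nat (- k)) * T)" using nat by metis
    also have "t + of_int k * T + real (nat (- k)) * T = t" using False by (simp add: algebra_simps)
    finally show ?thesis .
  qed
qed

lemma periodic_representative:
  fixes t :: real
  obtains k :: int where "t + of_int k * (2 * pi) \<in> {0..<2 * pi}"
proof -
  define k where "k = \<lfloor>t / (2 * pi)\<rfloor>"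
  have "of_int k \<le> t / (2 * pi)" "t / (2 * pi) < of_int k + 1" unfolding k_def by linarith+
  then have "t + of_int (- k) * (2 * pi) \<in> {0..<2 * pi}" by (auto simp: field_simps)
  then show ?thesis by (rule that)
qed

lemma integral_periodic_shift:
  fixes f :: "real \<Rightarrow> 'a :: euclidean_space" and T :: real
  assumes per: "\<And>t. f (t + T) = f t" and cont: "continuous_on UNIV f" and T: "T \<ge> 0"
  shows "integral {a..a + T} f = integral {0..T} f"
proof -
  have int: "f integrable_on {x..y}" for x y
    by (intro integrable_continuous_real continuous_on_subset[OF cont]) auto
  have shift: "integral {x + c..y + c} f = integral {x..y} (\<lambda>t. f (t + c))" for x y c
    using integral_shift[of x c y f] continuous_on_subset[OF cont] by (simp add: o_def)
  have pos: "integral {a..a + T} f = integral {0..T} f" if "a \<ge> 0" for a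
  proof -
    have "integral {0..a} f + integral {a..a + T} f = integral {0..a + T} f"
      using that T by (intro Henstock_Kurzweil_Integration.integral_combine int) auto
    moreover have "integral {0..T} f + integral {T..a + T} f = integral {0..a + T} f"
      using that T by (intro Henstock_Kurzweil_Integration.integral_combine int) auto
    moreover have "integral {T..a + T} f = integral {0..a} f"
      using shift[of 0 T a] per by simp
    ultimately show ?thesis by (metis add.commute add_left_cancel)
  qed
  show ?thesis
  proof (cases "T = 0")
    case False
    with T have T: "T > 0" by simp
    obtain n :: nat where n: "-a / T < real n" using reals_Archimedean2 by blast
    then have "a + real n * T \<ge> 0" using T by (simp add: field_simps)
    from pos[OF this] have "integral {a + real n * T..(a + T) + real n * T} f = integral {0..T} f"
      by (simp add: algebra_simps)
    moreover have "f (t + real n * T) = f t" for t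
      using periodic_shift_int[of f T t "int n", OF per] by simp
    ultimately show ?thesis using shift[of a "real n * T" "a + T"] by simp
  qed simp
qed

section \<open>Uniqueness of the Fourier coefficients of continuous functions\<close>

text \<open>Each factor \<open>cos t\<close> splits a cosine into two neighbouring frequencies, so
  orthogonality to all cosines passes to all polynomials in \<open>cos t\<close>.\<close>

lemma integral_cos_powers_eq_0:
  fixes h :: "real \<Rightarrow> real"
  assumes cont: "continuous_on UNIV h"
    and zero: "\<And>k. integral {0..2 * pi} (\<lambda>t. h t * cos (real k * t)) = 0"
  shows "integral {0..2 * pi} (\<lambda>t. h t * (cos t) ^ k * cos (real j * t)) = 0"
proof (induction k arbitrary: j)
  case 0
  then show ?case using zero by simp
next
  case (Suc k)
  have h[continuous_intros]: "continuous_on {0..2 * pi} h"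
    using cont continuous_on_subset by blast
  \<comment> \<open>For \<open>j = 0\<close> the lower frequency is -1, which evenness of the cosine
    turns into 1.\<close>
  have eq: "h t * (cos t) ^ Suc k * cos (real j * t) =
      (h t * (cos t) ^ k * cos (real (Suc j) * t)) / 2 +
      (h t * (cos t) ^ k * cos (real (if j = 0 then 1 else j - 1) * t)) / 2" for t
  proof -
    have "cos t * cos (real j * t) = (cos (real (Suc j) * t) + cos (real j * t - t)) / 2"
      by (simp add: cos_add cos_diff algebra_simps)
    moreover have "cos (real j * t - t) = cos (real (if j = 0 then 1 else j - 1) * t)"
      by (auto simp: of_nat_diff algebra_simps)
    ultimately have "cos t * cos (real j * t) =
       (cos (real (Suc j) * t) + cos (real (if j = 0 then 1 else j - 1) * t)) / 2" by simp
    then have "h t * (cos t) ^ k * (cos t * cos (real j * t)) =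
      h t * (cos t) ^ k * ((cos (real (Suc j) * t) + cos (real (if j = 0 then 1 else j - 1) * t)) / 2)"
      by simp
    then show ?thesis by (simp add: field_simps)
  qed
  show ?case unfolding eq
    by (subst integral_add) (auto intro!: integrable_continuous_real continuous_intros simp: Suc.IH simp del: of_nat_Suc)
qed

text \<open>Even and periodic means a continuous function of \<open>cos t\<close>, namely
  \<open>h (arccos x)\<close> at \<open>x = cos t\<close>. Weierstrass approximates it uniformly by
  polynomials in \<open>cos t\<close>, all orthogonal to \<open>h\<close>; hence the integral of
  \<open>h\<close>^2 is at most \<open>e\<close> times that of \<bar>\<open>h\<close>\<bar>.\<close>

lemma even_periodic_eq_0:
  fixes h :: "real \<Rightarrow> real"
  assumes cont: "continuous_on UNIV h" and per: "\<And>t. h (t + 2 * pi) = h t" and even: "\<And>t. h (- t) = h t"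
    and zero: "\<And>k. integral {0..2 * pi} (\<lambda>t. h t * cos (real k * t)) = 0"
    and t: "t \<in> {0..2 * pi}"
  shows "h t = 0"
proof -
  have h[continuous_intros]: "continuous_on S h" for S
    using cont continuous_on_subset by blast
  define g where "g = (\<lambda>x. h (arccos x))"
  have g: "continuous_on {-1..1} g"
    unfolding g_def by (rule continuous_on_compose2[OF cont]) (auto intro: continuous_intros)
  have gh: "g (cos t) = h t" if "t \<in> {0..2 * pi}" for t
  proof (cases "t \<le> pi")
    case True
    then show ?thesis using that by (simp add: g_def arccos_cos)
  next
    case False
    have "cos t = cos (2 * pi - t)" by simp
    then have "arccos (cos t) = 2 * pi - t"
      using False that by (simp del: cos_2pi_minus add: arccos_cos)
    then show ?thesis using even[of "t"] per[of "-t"] by (simp add: g_def)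
  qed
  define I where "I = integral {0..2 * pi} (\<lambda>t. \<bar>h t\<bar>)"
  have int2: "(\<lambda>t. h t * h t) integrable_on {0..2 * pi}" and int1: "(\<lambda>t. \<bar>h t\<bar>) integrable_on {0..2 * pi}"
    by (auto intro!: integrable_continuous_real continuous_intros)
  have I0: "I \<ge> 0" unfolding I_def by (rule integral_nonneg[OF int1]) auto
  have "integral {0..2 * pi} (\<lambda>t. h t * h t) \<le> e * I" if e: "e > 0" for e
  proof -
    obtain P where P: "real_polynomial_function P" "\<And>x. x \<in> {-1..1} \<Longrightarrow> \<bar>g x - P x\<bar> < e"
      using Stone_Weierstrass_real_polynomial_function[OF compact_Icc g e] by metis
    obtain a n where Pa: "P = (\<lambda>x. \<Sum>i\<le>n. a i * x ^ i)"
      using P(1) unfolding real_polynomial_function_iff_sum by auto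
    have Pc: "continuous_on S (\<lambda>t. P (cos t))" for S
      unfolding Pa by (intro continuous_intros)
    have "integral {0..2 * pi} (\<lambda>t. h t * P (cos t)) =
        integral {0..2 * pi} (\<lambda>t. \<Sum>i\<le>n. a i * (h t * (cos t) ^ i * cos (real 0 * t)))"
      unfolding Pa by (simp add: sum_distrib_left algebra_simps)
    also have "\<dots> = (\<Sum>i\<le>n. integral {0..2 * pi} (\<lambda>t. a i * (h t * (cos t) ^ i * cos (real 0 * t))))"
      by (intro integral_sum) (auto intro!: integrable_continuous_real continuous_intros)
    also have "\<dots> = 0"
      using integral_cos_powers_eq_0[OF cont zero, of _ 0] by simp
    finally have 0: "integral {0..2 * pi} (\<lambda>t. h t * P (cos t)) = 0" .
    have "integral {0..2 * pi} (\<lambda>t. h t * h t) =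
        integral {0..2 * pi} (\<lambda>t. h t * h t) - integral {0..2 * pi} (\<lambda>t. h t * P (cos t))" using 0 by simp
    also have "\<dots> = integral {0..2 * pi} (\<lambda>t. h t * (h t - P (cos t)))"
      by (subst integral_diff[symmetric])
        (auto intro!: integrable_continuous_real continuous_intros Pc simp: algebra_simps)
    also have "\<dots> \<le> integral {0..2 * pi} (\<lambda>t. e * \<bar>h t\<bar>)"
    proof (rule integral_le)
      fix t :: real assume t: "t \<in> {0..2 * pi}"
      have "\<bar>h t - P (cos t)\<bar> < e" using P(2)[of "cos t"] gh[OF t] by simp
      then have "\<bar>h t\<bar> * \<bar>h t - P (cos t)\<bar> \<le> \<bar>h t\<bar> * e" by (intro mult_left_mono) auto
      then show "h t * (h t - P (cos t)) \<le> e * \<bar>h t\<bar>"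
        using abs_ge_self[of "h t * (h t - P (cos t))"] by (simp add: abs_mult mult.commute)
    qed (auto intro!: integrable_continuous_real continuous_intros Pc)
    also have "\<dots> = e * I" by (simp add: I_def)
    finally show ?thesis .
  qed
  then have le: "integral {0..2 * pi} (\<lambda>t. h t * h t) \<le> 0 + e" if "e > 0" for e
  proof -
    have "integral {0..2 * pi} (\<lambda>t. h t * h t) \<le> (e / (I + 1)) * I"
      using \<open>e > 0\<close> I0 by (intro \<open>\<And>e. e > 0 \<Longrightarrow> _ \<le> e * I\<close>) auto
    also have "\<dots> \<le> e" using that I0 by (simp add: field_simps)
    finally show ?thesis by simp
  qed
  have "integral {0..2 * pi} (\<lambda>t. h t * h t) \<le> 0" by (rule field_le_epsilon) (use le in auto)
  moreover have "integral {0..2 * pi} (\<lambda>t. h t * h t) \<ge> 0" by (rule integral_nonneg[OF int2]) auto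
  ultimately have "integral {0..2 * pi} (\<lambda>t. h t * h t) = 0" by simp
  then have "\<forall>t\<in>{0..2*pi}. h t * h t = 0"
    by (subst (asm) integral_eq_0_iff) (auto intro!: continuous_intros)
  then show ?thesis using t by auto
qed

lemma integral_periodic_reflect:
  fixes f :: "real \<Rightarrow> real"
  assumes per: "\<And>t. f (t + 2 * pi) = f t" and cont: "continuous_on UNIV f"
  shows "integral {0..2 * pi} (\<lambda>t. f (x + t)) = integral {0..2 * pi} f"
    and "integral {0..2 * pi} (\<lambda>t. f (x - t)) = integral {0..2 * pi} f"
proof -
  have shift: "integral {a..b} (\<lambda>t. f (x + t)) = integral {a + x..b + x} f" for a b
    using integral_shift[of a x b f] continuous_on_subset[OF cont] by (simp add: o_def add.commute)
  show 1: "integral {0..2 * pi} (\<lambda>t. f (x + t)) = integral {0..2 * pi} f"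
    using shift[of 0 "2 * pi"] integral_periodic_shift[OF per cont, of x] by (simp add: add.commute)
  have "integral {0..2 * pi} (\<lambda>t. f (x - t)) = integral {- (2 * pi)..- 0} (\<lambda>t. f (x + t))"
    using Henstock_Kurzweil_Integration.integral_reflect_real[of "2 * pi" 0 "\<lambda>t. f (x - t)"] by simp
  also have "\<dots> = integral {(x - 2 * pi)..(x - 2 * pi) + 2 * pi} f" by (subst shift) (simp add: algebra_simps)
  also have "\<dots> = integral {0..2 * pi} f" by (rule integral_periodic_shift[OF per cont]) simp
  finally show "integral {0..2 * pi} (\<lambda>t. f (x - t)) = integral {0..2 * pi} f" .
qed

lemma cos_nat_periodic: "cos (real k * (t + 2 * pi)) = cos (real k * t)"
  and sin_nat_periodic: "sin (real k * (t + 2 * pi)) = sin (real k * t)"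
proof -
  have "real k * (t + 2 * pi) = real k * t + of_int (int k) * (2 * pi)" by (simp add: algebra_simps)
  then show "cos (real k * (t + 2 * pi)) = cos (real k * t)" "sin (real k * (t + 2 * pi)) = sin (real k * t)"
    using periodic_shift_int[of cos "2 * pi" "real k * t" "int k"] periodic_shift_int[of sin "2 * pi" "real k * t" "int k"]
    by auto
qed

text \<open>Symmetrising about \<open>x\<close> gives the even function f(x+t) + f(x-t), whose
  cosine coefficients vanish together with those of \<open>f\<close> and whose value at 0 is 2
  f(x).\<close>

theorem fourier_uniqueness_continuous:
  fixes f :: "real \<Rightarrow> real"
  assumes cont: "continuous_on UNIV f" and per: "\<And>t. f (t + 2 * pi) = f t"
    and zc: "\<And>k. integral {0..2 * pi} (\<lambda>t. f t * cos (real k * t)) = 0"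
    and zs: "\<And>k. integral {0..2 * pi} (\<lambda>t. f t * sin (real k * t)) = 0"
  shows "f x = 0"
proof -
  define h where "h = (\<lambda>t. f (x + t) + f (x - t))"
  have fc[continuous_intros]: "continuous_on S (\<lambda>t. f (g t))" if "continuous_on S g" for S and g :: "real \<Rightarrow> real"
    by (rule continuous_on_compose2[OF cont that]) auto
  have "h 0 = 0"
  proof (rule even_periodic_eq_0[of h])
    show "continuous_on UNIV h" unfolding h_def by (intro continuous_intros)
    show "h (t + 2 * pi) = h t" for t
      using per[of "x + t"] per[of "x - t - 2 * pi"] by (simp add: h_def algebra_simps)
    show "integral {0..2 * pi} (\<lambda>t. h t * cos (real k * t)) = 0" for k
    proof -
      let ?F = "\<lambda>u. f u * cos (real k * (u - x))"
      let ?G = "\<lambda>u. f u * cos (real k * (x - u))"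
      have e: "cos (real k * (x - u)) = cos (real k * (u - x))" for u
        using cos_minus[of "real k * (x - u)"] by (simp add: algebra_simps)
      have F: "integral {0..2 * pi} ?F = 0"
      proof -
        have "?F = (\<lambda>u. cos (real k * x) * (f u * cos (real k * u)) + sin (real k * x) * (f u * sin (real k * u)))"
          by (auto simp: right_diff_distrib cos_diff algebra_simps)
        then show ?thesis
          by (simp only:) (subst integral_add, auto intro!: integrable_continuous_real continuous_intros simp: zc zs)
      qed
      have Fper: "?F (u + 2 * pi) = ?F u" for u
        using cos_nat_periodic[of k "u - x"] per by (simp add: algebra_simps)
      have Fc: "continuous_on UNIV ?F" by (intro continuous_intros)
      have "integral {0..2 * pi} (\<lambda>t. h t * cos (real k * t)) =
          integral {0..2 * pi} (\<lambda>t. ?F (x + t)) + integral {0..2 * pi} (\<lambda>t. ?F (x - t))"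
        by (subst integral_add[symmetric])
           (auto intro!: integrable_continuous_real continuous_intros simp: h_def distrib_right)
      then show ?thesis using integral_periodic_reflect[OF Fper Fc, of x] F by simp
    qed
  qed (auto simp: h_def)
  then show ?thesis by (simp add: h_def)
qed

section \<open>Termwise integration and absolutely convergent trigonometric series\<close>

lemma set_integrable_continuous_Icc:
  fixes f :: "real \<Rightarrow> 'a :: euclidean_space"
  assumes "continuous_on {a..b} f"
  shows "set_integrable lebesgue {a..b} f"
    and "(LINT t:{a..b}|lebesgue. f t) = integral {a..b} f"
proof -
  show *: "set_integrable lebesgue {a..b} f" by (rule absolutely_integrable_continuous_real[OF assms])
  show "(LINT t:{a..b}|lebesgue. f t) = integral {a..b} f" by (rule set_lebesgue_integral_eq_integral(2)[OF *])
qed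

lemma set_integrable_mult_bounded:
  fixes f u :: "real \<Rightarrow> real"
  assumes f: "set_integrable lebesgue S f" and u: "u \<in> borel_measurable lebesgue"
    and bd: "\<And>t. t \<in> S \<Longrightarrow> \<bar>u t\<bar> \<le> M" 
  shows "set_integrable lebesgue S (\<lambda>t. f t * u t)"
  unfolding set_integrable_def
proof (rule Bochner_Integration.integrable_bound)
  show "integrable lebesgue (\<lambda>t. M * (indicator S t *\<^sub>R f t))"
    using f by (auto simp: set_integrable_def)
  have "(\<lambda>t. (indicator S t *\<^sub>R f t) * u t) \<in> borel_measurable lebesgue"
    using f u by (intro borel_measurable_times) (auto simp: set_integrable_def)
  then show "(\<lambda>t. indicator S t *\<^sub>R (f t * u t)) \<in> borel_measurable lebesgue" by (simp add: mult.assoc)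
  show "AE t in lebesgue. norm (indicator S t *\<^sub>R (f t * u t)) \<le> norm (M * (indicator S t *\<^sub>R f t))"
  proof (rule AE_I2)
    fix t
    show "norm (indicator S t *\<^sub>R (f t * u t)) \<le> norm (M * (indicator S t *\<^sub>R f t))"
    proof (cases "t \<in> S")
      case True
      then have "\<bar>u t\<bar> \<le> \<bar>M\<bar>" using bd by fastforce
      then show ?thesis using mult_left_mono[of "\<bar>u t\<bar>" "\<bar>M\<bar>" "\<bar>f t\<bar>"] True by (simp add: abs_mult mult.commute)
    qed simp
  qed
qed

lemma set_integral_sums_bounded:
  fixes f :: "real \<Rightarrow> real" and u :: "nat \<Rightarrow> real \<Rightarrow> real"
  assumes f: "set_integrable lebesgue S f" and u: "\<And>k. u k \<in> borel_measurable lebesgue"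
    and bd: "\<And>k t. \<bar>u k t\<bar> \<le> M k" and M: "summable M"
  shows "(\<lambda>k. LINT t:S|lebesgue. f t * u k t) sums (LINT t:S|lebesgue. f t * (\<Sum>k. u k t))"
proof -
  have su: "summable (\<lambda>k. \<bar>u k t\<bar>)" for t
    by (rule summable_comparison_test'[OF M]) (use bd in auto)
  have int: "integrable lebesgue (\<lambda>t. indicator S t *\<^sub>R (f t * u k t))" for k
    using set_integrable_mult_bounded[OF f u bd] by (simp add: set_integrable_def)
  have "(\<lambda>k. integral\<^sup>L lebesgue (\<lambda>t. indicator S t *\<^sub>R (f t * u k t))) sums
     integral\<^sup>L lebesgue (\<lambda>t. \<Sum>k. indicator S t *\<^sub>R (f t * u k t))"
  proof (rule sums_integral[OF int])
    show "AE t in lebesgue. summable (\<lambda>k. norm (indicator S t *\<^sub>R (f t * u k t)))"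
      using su by (auto simp: abs_mult intro!: AE_I2 summable_mult)
    let ?I = "integral\<^sup>L lebesgue (\<lambda>t. \<bar>indicator S t *\<^sub>R f t\<bar>)"
    have "norm (integral\<^sup>L lebesgue (\<lambda>t. norm (indicator S t *\<^sub>R (f t * u k t)))) \<le> M k * ?I" for k
    proof -
      have "integral\<^sup>L lebesgue (\<lambda>t. norm (indicator S t *\<^sub>R (f t * u k t))) \<le>
          integral\<^sup>L lebesgue (\<lambda>t. M k * \<bar>indicator S t *\<^sub>R f t\<bar>)"
      proof (rule integral_mono)
        show "integrable lebesgue (\<lambda>t. M k * \<bar>indicator S t *\<^sub>R f t\<bar>)"
          using f by (auto simp: set_integrable_def)
        show "norm (indicator S t *\<^sub>R (f t * u k t)) \<le> M k * \<bar>indicator S t *\<^sub>R f t\<bar>" for t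
          using mult_right_mono[OF bd[of k t], of "\<bar>indicator S t * f t\<bar>"] by (simp add: abs_mult mult_ac)
      qed (use int in auto)
      then show ?thesis by simp
    qed
    then show "summable (\<lambda>k. integral\<^sup>L lebesgue (\<lambda>t. norm (indicator S t *\<^sub>R (f t * u k t))))"
      by (intro summable_comparison_test'[OF summable_mult2[OF M, of ?I]]) auto
  qed
  moreover have "(\<Sum>k. indicator S t *\<^sub>R (f t * u k t)) = indicator S t *\<^sub>R (f t * (\<Sum>k. u k t))" for t
  proof -
    have s: "summable (\<lambda>k. u k t)" by (rule summable_rabs_cancel[OF su])
    show ?thesis using suminf_mult[OF s, of "indicator S t * f t"] by (simp add: mult_ac)
  qed
  ultimately show ?thesis unfolding set_lebesgue_integral_def by simp
qed

lemma borel_measurable_lebesgue_continuous: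
  "continuous_on UNIV (f :: real \<Rightarrow> real) \<Longrightarrow> f \<in> borel_measurable lebesgue"
  by (rule measurable_completion) (simp add: borel_measurable_continuous_onI)

lemma integral_cos_frequency:
  fixes n :: int
  assumes "n \<noteq> 0"
  shows "integral {0..2 * pi} (\<lambda>t. cos (of_int n * t + c)) = 0"
proof -
  have "((\<lambda>t. cos (of_int n * t + c)) has_integral
     (sin (of_int n * (2 * pi) + c) / of_int n - sin (of_int n * 0 + c) / of_int n)) {0..2 * pi}"
    using assms by (intro fundamental_theorem_of_calculus)
      (auto intro!: derivative_eq_intros simp flip: has_real_derivative_iff_has_vector_derivative)
  moreover have "sin (of_int n * (2 * pi) + c) = sin c"
    using periodic_shift_int[of sin "2 * pi" c n] by (simp add: add.commute)
  ultimately show ?thesis by (simp add: integral_unique)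
qed

text \<open>The free phases let one formula cover all products of sines and cosines.\<close>

lemma integral_cos_cos:
  "integral {0..2 * pi} (\<lambda>t. cos (real k * t + c) * cos (real j * t + d)) =
    (if k = j then (if k = 0 then 2 * pi * cos c * cos d else pi * cos (c - d)) else 0)"
proof (cases "k = 0 \<and> j = 0")
  case False
  define K J where "K = (int k + int j)" and "J = (int k - int j)"
  have K: "K \<noteq> 0" using False by (auto simp: K_def)
  have "cos (real k * t + c) * cos (real j * t + d) =
      (1/2) * cos (of_int K * t + (c + d)) + (1/2) * cos (of_int J * t + (c - d))" for t
    by (simp add: cos_times_cos K_def J_def algebra_simps)
  then have "integral {0..2 * pi} (\<lambda>t. cos (real k * t + c) * cos (real j * t + d)) =
      (1/2) * integral {0..2 * pi} (\<lambda>t. cos (of_int K * t + (c + d))) +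
      (1/2) * integral {0..2 * pi} (\<lambda>t. cos (of_int J * t + (c - d)))"
    by (simp only:) (subst integral_add, auto intro!: integrable_continuous_real continuous_intros)
  also have "\<dots> = (1/2) * integral {0..2 * pi} (\<lambda>t. cos (of_int J * t + (c - d)))"
    using integral_cos_frequency[OF K] by simp
  finally show ?thesis
    using False integral_cos_frequency[of J] by (cases "k = j") (auto simp: J_def)
qed simp

lemma summable_trig_harmonics:
  fixes A B :: "nat \<Rightarrow> real"
  assumes "summable (\<lambda>k. \<bar>A k\<bar>)" "summable (\<lambda>k. \<bar>B k\<bar>)"
  shows "\<And>k t. \<bar>A k * cos (real k * t) + B k * sin (real k * t)\<bar> \<le> \<bar>A k\<bar> + \<bar>B k\<bar>"
    and "summable (\<lambda>k. \<bar>A k\<bar> + \<bar>B k\<bar>)"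
    and "\<And>t. summable (\<lambda>k. A k * cos (real k * t) + B k * sin (real k * t))"
proof -
  show 1: "\<bar>A k * cos (real k * t) + B k * sin (real k * t)\<bar> \<le> \<bar>A k\<bar> + \<bar>B k\<bar>" for k t
  proof -
    have "\<bar>A k * cos (real k * t)\<bar> \<le> \<bar>A k\<bar> * 1" unfolding abs_mult by (intro mult_left_mono) auto
    moreover have "\<bar>B k * sin (real k * t)\<bar> \<le> \<bar>B k\<bar> * 1" unfolding abs_mult by (intro mult_left_mono) auto
    ultimately show ?thesis by linarith
  qed
  show 2: "summable (\<lambda>k. \<bar>A k\<bar> + \<bar>B k\<bar>)" using assms by (rule summable_add)
  show "summable (\<lambda>k. A k * cos (real k * t) + B k * sin (real k * t))" for t
    by (rule summable_comparison_test'[OF 2]) (use 1 in auto)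
qed

text \<open>Used twice: to recognise a continuous function as the sum of its Fourier series, and to
  construct a function with a prescribed derivative.\<close>

lemma trig_series:
  fixes A B :: "nat \<Rightarrow> real"
  assumes A: "summable (\<lambda>k. \<bar>A k\<bar>)" and B: "summable (\<lambda>k. \<bar>B k\<bar>)"
  defines "F \<equiv> \<lambda>t. \<Sum>k. A k * cos (real k * t) + B k * sin (real k * t)"
  shows "continuous_on UNIV F" and "F (t + 2 * pi) = F t"
    and "fourier_a j F = (if j = 0 then 2 * A 0 else A j)"
    and "j \<ge> 1 \<Longrightarrow> fourier_b j F = B j"
proof -
  note S = summable_trig_harmonics[OF A B]
  have "uniform_limit UNIV (\<lambda>n t. \<Sum>k<n. A k * cos (real k * t) + B k * sin (real k * t)) F sequentially"
    unfolding F_def by (rule Weierstrass_m_test[OF _ S(2)]) (use S(1) in auto)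
  then show "continuous_on UNIV F"
    by (rule uniform_limit_theorem[rotated]) (auto intro!: always_eventually continuous_intros)
  show "F (t + 2 * pi) = F t" unfolding F_def by (simp only: cos_nat_periodic sin_nat_periodic)
  \<comment> \<open>The phase \<open>d = 0\<close> yields the cosine coefficients and
    \<open>d = - pi / 2\<close> the sine coefficients.\<close>
  have gen: "(LINT t:{0..2 * pi}|lebesgue. F t * cos (real j * t + d)) =
      (if j = 0 then 2 * pi * A 0 * cos d else pi * (A j * cos d + B j * cos (d + pi / 2)))" for j d
  proof -
    have I: "(LINT t:{0..2 * pi}|lebesgue. cos (real j * t + d) * (A k * cos (real k * t) + B k * sin (real k * t))) =
      (if k = j then (if j = 0 then 2 * pi * A 0 * cos d else pi * (A j * cos d + B j * cos (d + pi / 2))) else 0)" for k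
    proof -
      have s: "sin x = cos (x - pi / 2)" for x :: real by (simp add: cos_diff)
      have "(LINT t:{0..2 * pi}|lebesgue. cos (real j * t + d) * (A k * cos (real k * t) + B k * sin (real k * t))) =
         integral {0..2 * pi} (\<lambda>t. cos (real j * t + d) * (A k * cos (real k * t) + B k * sin (real k * t)))"
        by (rule set_integrable_continuous_Icc) (intro continuous_intros)
      also have "\<dots> = A k * integral {0..2 * pi} (\<lambda>t. cos (real j * t + d) * cos (real k * t + 0)) +
         B k * integral {0..2 * pi} (\<lambda>t. cos (real j * t + d) * cos (real k * t + (- pi / 2)))"
        unfolding s
        by (subst integral_mult_right[symmetric] integral_add[symmetric])+
          (auto intro!: integrable_continuous_real continuous_intros simp: algebra_simps)
      also have "\<dots> = (if k = j then (if j = 0 then 2 * pi * A 0 * cos d else pi * (A j * cos d + B j * cos (d + pi / 2))) else 0)"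
        unfolding integral_cos_cos by (auto simp: algebra_simps)
      finally show ?thesis .
    qed
    have "(\<lambda>k. LINT t:{0..2 * pi}|lebesgue. cos (real j * t + d) * (A k * cos (real k * t) + B k * sin (real k * t)))
      sums (LINT t:{0..2 * pi}|lebesgue. cos (real j * t + d) * (\<Sum>k. A k * cos (real k * t) + B k * sin (real k * t)))"
    proof (rule set_integral_sums_bounded[OF _ _ S(1) S(2)])
      show "set_integrable lebesgue {0..2 * pi} (\<lambda>t. cos (real j * t + d))"
        by (rule set_integrable_continuous_Icc) (intro continuous_intros)
      show "(\<lambda>t. A k * cos (real k * t) + B k * sin (real k * t)) \<in> borel_measurable lebesgue" for k
        by (intro borel_measurable_lebesgue_continuous continuous_intros)
    qed
    then have "(\<lambda>k. if k = j then (if j = 0 then 2 * pi * A 0 * cos d else pi * (A j * cos d + B j * cos (d + pi / 2))) else 0)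
       sums (LINT t:{0..2 * pi}|lebesgue. cos (real j * t + d) * F t)"
      unfolding I F_def .
    from sums_unique2[OF this sums_single[of j]] show ?thesis
      by (simp add: mult.commute)
  qed
  show "fourier_a j F = (if j = 0 then 2 * A 0 else A j)"
    unfolding fourier_a_def using gen[of j 0] by auto
  show "fourier_b j F = B j" if "j \<ge> 1"
  proof -
    have s: "sin (real j * t) = cos (real j * t + (- pi / 2))" for t by (simp add: cos_diff)
    show ?thesis unfolding fourier_b_def s using gen[of j "-pi/2"] that by auto
  qed
qed

lemma Lp_space_1D:
  assumes "\<phi> \<in> Lp_space 1"
  shows "periodic_2pi \<phi>" "\<phi> \<in> borel_measurable lebesgue" "set_integrable lebesgue {0..2 * pi} \<phi>"
proof -
  show "periodic_2pi \<phi>" and m: "\<phi> \<in> borel_measurable lebesgue" using assms by (auto simp: Lp_space_def)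
  have "set_integrable lebesgue {0..2 * pi} (\<lambda>t. \<bar>\<phi> t\<bar>)" using assms by (simp add: Lp_space_def)
  then show "set_integrable lebesgue {0..2 * pi} \<phi>"
    by (rule set_integrable_bound) (auto simp: set_borel_measurable_def intro!: borel_measurable_times borel_measurable_indicator m)
qed

lemma Lp_space_1I:
  assumes "periodic_2pi \<phi>" "\<phi> \<in> borel_measurable lebesgue" "set_integrable lebesgue {0..2 * pi} \<phi>"
  shows "\<phi> \<in> Lp_space 1"
  using assms set_integrable_abs[OF assms(3)] by (auto simp: Lp_space_def)

lemma C_spaceD:
  assumes "f \<in> C_space"
  shows "continuous_on S f" "f (t + 2 * pi) = f t" "f \<in> borel_measurable lebesgue"
    "set_integrable lebesgue {0..2 * pi} f"
proof -
  show c: "continuous_on S f" for S using assms continuous_on_subset by (auto simp: C_space_def)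
  show "f (t + 2 * pi) = f t" using assms by (auto simp: C_space_def periodic_2pi_def)
  show "f \<in> borel_measurable lebesgue"
    using c by (rule borel_measurable_lebesgue_continuous)
  show "set_integrable lebesgue {0..2 * pi} f" by (intro set_integrable_continuous_Icc c)
qed

lemma C_space_subset_Lp_1: "f \<in> C_space \<Longrightarrow> f \<in> Lp_space 1"
  using C_spaceD[of f] by (intro Lp_space_1I) (auto simp: C_space_def)

section \<open>Harmonics of a function and of its derivative\<close>

definition harmonic :: "nat \<Rightarrow> (real \<Rightarrow> real) \<Rightarrow> real \<Rightarrow> real" where
  "harmonic k f x = fourier_a k f * cos (real k * x) + fourier_b k f * sin (real k * x)"

text \<open>The \<open>k\<close>-th harmonic of \<phi> with its angle \<open>k x\<close> delayed by
  \<open>b\<close>. The integral form is chosen because a series of such terms sums to a single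
  convolution.\<close>

definition phase_coeff :: "nat \<Rightarrow> real \<Rightarrow> (real \<Rightarrow> real) \<Rightarrow> real \<Rightarrow> real" where
  "phase_coeff k b \<phi> x = (1 / pi) * (LINT t:{0..2 * pi}|lebesgue. \<phi> t * cos (real k * (t - x) + b))"

lemma set_integrable_mult_cos:
  assumes "set_integrable lebesgue S \<phi>"
  shows "set_integrable lebesgue S (\<lambda>t. \<phi> t * cos (real k * (t - x) + b))"
    "set_integrable lebesgue S (\<lambda>t. \<phi> t * cos (real k * t))"
    "set_integrable lebesgue S (\<lambda>t. \<phi> t * sin (real k * t))"
  by (rule set_integrable_mult_bounded[OF assms, of _ 1];
      (intro borel_measurable_lebesgue_continuous continuous_intros)?; simp)+

lemma phase_coeff_eq:
  assumes "set_integrable lebesgue {0..2 * pi} \<phi>"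
  shows "phase_coeff k b \<phi> x =
    fourier_a k \<phi> * cos (real k * x - b) + fourier_b k \<phi> * sin (real k * x - b)"
proof -
  note i = set_integrable_mult_cos[OF assms, of k]
  have "\<phi> t * cos (real k * (t - x) + b) =
     \<phi> t * cos (real k * t) * cos (real k * x - b) + \<phi> t * sin (real k * t) * sin (real k * x - b)" for t
  proof -
    have "real k * (t - x) + b = real k * t - (real k * x - b)" by (simp add: algebra_simps)
    then show ?thesis by (simp only: cos_diff) (simp add: algebra_simps)
  qed
  then have "phase_coeff k b \<phi> x = (1 / pi) * ((LINT t:{0..2 * pi}|lebesgue. \<phi> t * cos (real k * t) * cos (real k * x - b)) +
      (LINT t:{0..2 * pi}|lebesgue. \<phi> t * sin (real k * t) * sin (real k * x - b)))"
    unfolding phase_coeff_def using i by (simp add: set_integral_add)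
  then show ?thesis by (simp add: fourier_a_def fourier_b_def distrib_left)
qed

lemma abs_phase_coeff_le:
  assumes "set_integrable lebesgue {0..2 * pi} \<phi>"
  shows "\<bar>phase_coeff k b \<phi> x\<bar> \<le> (1 / pi) * (LINT t:{0..2 * pi}|lebesgue. \<bar>\<phi> t\<bar>)"
proof -
  have "\<bar>LINT t:{0..2 * pi}|lebesgue. \<phi> t * cos (real k * (t - x) + b)\<bar> \<le>
     (LINT t:{0..2 * pi}|lebesgue. \<bar>\<phi> t * cos (real k * (t - x) + b)\<bar>)"
    using set_integral_norm_bound[OF set_integrable_mult_cos(1)[OF assms]] by simp
  also have "\<dots> \<le> (LINT t:{0..2 * pi}|lebesgue. \<bar>\<phi> t\<bar>)"
    by (intro set_integral_mono set_integrable_abs set_integrable_mult_cos assms)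
      (simp add: abs_mult mult_left_le)
  finally show ?thesis unfolding phase_coeff_def abs_mult by (simp add: divide_right_mono)
qed

text \<open>Within one harmonic a phase shift is a translation of \<open>x\<close> by (\<beta> pi /
  2) / \<open>k\<close>, so the shift can be moved from \<open>f\<close> to \<phi>. The original
  \<open>f\<close> is then expressed through \<phi>, as the remainder requires.\<close>

lemma has_psi_beta_derivative_iff:
  assumes "\<And>k. k \<ge> 1 \<Longrightarrow> \<psi> k > 0"
  shows "has_psi_beta_derivative \<psi> \<beta> f \<phi> \<longleftrightarrow>
    \<phi> \<in> Lp_space 1 \<and> fourier_a 0 \<phi> = 0 \<and>
    (\<forall>k\<ge>1. \<forall>x. harmonic k f x = \<psi> k * phase_coeff k (\<beta> * pi / 2) \<phi> x)"
proof -
  have "(\<forall>x. fourier_a k \<phi> * cos (real k * x) + fourier_b k \<phi> * sin (real k * x) =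
        (1 / \<psi> k) * (fourier_a k f * cos (real k * x + \<beta> * pi / 2)
                    + fourier_b k f * sin (real k * x + \<beta> * pi / 2))) \<longleftrightarrow>
     (\<forall>x. harmonic k f x = \<psi> k * phase_coeff k (\<beta> * pi / 2) \<phi> x)" (is "(\<forall>x. ?P x) \<longleftrightarrow> (\<forall>x. ?Q x)")
    if k: "k \<ge> 1" and \<phi>: "\<phi> \<in> Lp_space 1" for k
  proof -
    note ph = phase_coeff_eq[OF Lp_space_1D(3)[OF \<phi>]]
    have e1: "?P (x - (\<beta> * pi / 2) / real k) \<longleftrightarrow> ?Q x" for x
    proof -
      have "real k * (x - (\<beta> * pi / 2) / real k) = real k * x - \<beta> * pi / 2"
        using k by (simp add: field_simps)
      then show ?thesis unfolding harmonic_def ph using assms[OF k] by (auto simp: field_simps)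
    qed
    have "?P x" if "\<forall>x. ?Q x" for x
      using that e1[of "x + (\<beta> * pi / 2) / real k"] by simp
    then show ?thesis using e1 by blast
  qed
  then show ?thesis unfolding has_psi_beta_derivative_def by blast
qed

text \<open>The phase coefficients of \<phi> are bounded by its L_1 norm, so the harmonics of
  \<open>f\<close> are dominated by \<psi>. The Fourier series thus converges absolutely to a
  continuous function with the coefficients of \<open>f\<close>, which is \<open>f\<close> by
  uniqueness.\<close>

lemma C_space_sums_harmonics:
  assumes f: "f \<in> C_space" and \<phi>: "set_integrable lebesgue {0..2 * pi} \<phi>"
    and h: "\<And>k x. k \<ge> 1 \<Longrightarrow> harmonic k f x = \<psi> k * phase_coeff k b \<phi> x"
    and \<psi>: "summable (\<lambda>k. \<bar>\<psi> k\<bar>)"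
  shows "(\<lambda>k. harmonic (Suc k) f x) sums (f x - fourier_a 0 f / 2)"
    and "summable (\<lambda>k. \<bar>harmonic (Suc k) f x\<bar>)"
proof -
  define C where "C = (1 / pi) * (LINT t:{0..2 * pi}|lebesgue. \<bar>\<phi> t\<bar>)"
  have C: "\<bar>phase_coeff k b \<phi> x\<bar> \<le> C" for k x unfolding C_def by (rule abs_phase_coeff_le[OF \<phi>])
  have hb: "\<bar>harmonic k f x\<bar> \<le> \<bar>\<psi> k\<bar> * C" if "k \<ge> 1" for k x
    unfolding h[OF that] abs_mult by (intro mult_left_mono C) auto
  have sC: "summable (\<lambda>k. \<bar>\<psi> k\<bar> * C)" by (intro summable_mult2 \<psi>)
  show sh: "summable (\<lambda>k. \<bar>harmonic (Suc k) f x\<bar>)" for x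
    by (rule summable_comparison_test'[OF sC[THEN summable_Suc_iff[THEN iffD2]]]) (use hb in auto)
  define A where "A = (\<lambda>k. if k = 0 then fourier_a 0 f / 2 else fourier_a k f)"
  define B where "B = (\<lambda>k. if k = 0 then 0 else fourier_b k f)"
  \<comment> \<open>The harmonic equals its cosine coefficient at 0 and its sine coefficient at
    \<open>pi / 2 / k\<close>, so a bound on the harmonic bounds both.\<close>
  have "\<bar>A k\<bar> \<le> \<bar>\<psi> k\<bar> * C" if "k \<ge> 1" for k using hb[OF that, of 0] that by (simp add: harmonic_def A_def)
  then have A: "summable (\<lambda>k. \<bar>A k\<bar>)" by (intro summable_comparison_test'[OF sC, of 1]) auto
  have "\<bar>B k\<bar> \<le> \<bar>\<psi> k\<bar> * C" if "k \<ge> 1" for k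
    using hb[OF that, of "pi / 2 / real k"] that by (simp add: harmonic_def B_def)
  then have B: "summable (\<lambda>k. \<bar>B k\<bar>)" by (intro summable_comparison_test'[OF sC, of 1]) auto
  let ?F = "\<lambda>t. \<Sum>k. A k * cos (real k * t) + B k * sin (real k * t)"
  note T = trig_series[OF A B]
  note fc = C_spaceD[OF f]
  have eqa: "fourier_a k ?F = fourier_a k f" for k using T(3)[of k] by (simp add: A_def)
  have eqb: "fourier_b k ?F = fourier_b k f" for k
    using T(4)[of k] by (cases "k = 0") (auto simp: B_def fourier_b_def)
  have Fs: "continuous_on S ?F" for S using T(1) continuous_on_subset by blast
  have "f x - ?F x = 0"
  proof (rule fourier_uniqueness_continuous[of "\<lambda>x. f x - ?F x"])
    show "continuous_on UNIV (\<lambda>x. f x - ?F x)" by (intro continuous_on_diff fc(1) T(1))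
    show "f (t + 2 * pi) - ?F (t + 2 * pi) = f t - ?F t" for t using T(2)[of t] fc(2) by simp
    have *: "integral {0..2 * pi} (\<lambda>t. (f t - ?F t) * u t) =
       (LINT t:{0..2 * pi}|lebesgue. f t * u t) - (LINT t:{0..2 * pi}|lebesgue. ?F t * u t)"
      if u: "continuous_on UNIV u" for u
    proof -
      have us: "continuous_on S u" for S using u continuous_on_subset by blast
      have "integral {0..2 * pi} (\<lambda>t. (f t - ?F t) * u t) = integral {0..2 * pi} (\<lambda>t. f t * u t - ?F t * u t)"
        by (simp add: left_diff_distrib)
      also have "\<dots> = integral {0..2 * pi} (\<lambda>t. f t * u t) - integral {0..2 * pi} (\<lambda>t. ?F t * u t)"
        by (intro integral_diff integrable_continuous_real continuous_on_mult fc us Fs)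
      also have "integral {0..2 * pi} (\<lambda>t. f t * u t) = (LINT t:{0..2 * pi}|lebesgue. f t * u t)"
        by (intro set_integrable_continuous_Icc(2)[symmetric] continuous_on_mult fc us)
      also have "integral {0..2 * pi} (\<lambda>t. ?F t * u t) = (LINT t:{0..2 * pi}|lebesgue. ?F t * u t)"
        by (intro set_integrable_continuous_Icc(2)[symmetric] continuous_on_mult Fs us)
      finally show ?thesis .
    qed
    show "integral {0..2 * pi} (\<lambda>t. (f t - ?F t) * cos (real k * t)) = 0" for k
      using eqa[of k] by (subst *) (auto intro!: continuous_intros simp: fourier_a_def)
    show "integral {0..2 * pi} (\<lambda>t. (f t - ?F t) * sin (real k * t)) = 0" for k
      using eqb[of k] by (subst *) (auto intro!: continuous_intros simp: fourier_b_def)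
  qed
  then have "(\<lambda>k. A k * cos (real k * x) + B k * sin (real k * x)) sums f x"
    using summable_sums[OF summable_trig_harmonics(3)[OF A B, of x]] by simp
  then have "(\<lambda>k. A (Suc k) * cos (real (Suc k) * x) + B (Suc k) * sin (real (Suc k) * x)) sums
     (f x - (A 0 * cos (real 0 * x) + B 0 * sin (real 0 * x)))"
    by (subst sums_Suc_iff) simp
  then show "(\<lambda>k. harmonic (Suc k) f x) sums (f x - fourier_a 0 f / 2)"
    by (simp add: harmonic_def A_def B_def)
qed

text \<open>Needed for lower bounds: extremal functions are built on the level of derivatives and
  must be integrated back into the class.\<close>

lemma C_class_surjective:
  assumes \<phi>: "\<phi> \<in> Lp_space 1" "fourier_a 0 \<phi> = 0" "\<phi> \<in> M"
    and pos: "\<And>k. k \<ge> 1 \<Longrightarrow> \<psi> k > 0" and \<psi>: "summable (\<lambda>k. \<bar>\<psi> k\<bar>)"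
  obtains f where "f \<in> C_class \<psi> \<beta> M"
    "\<And>k x. k \<ge> 1 \<Longrightarrow> harmonic k f x = \<psi> k * phase_coeff k (\<beta> * pi / 2) \<phi> x"
proof -
  define b where "b = \<beta> * pi / 2"
  have i: "set_integrable lebesgue {0..2 * pi} \<phi>" using Lp_space_1D[OF \<phi>(1)] by simp
  define C where "C = (1 / pi) * (LINT t:{0..2 * pi}|lebesgue. \<bar>\<phi> t\<bar>)"
  have C: "\<bar>phase_coeff k b' \<phi> x\<bar> \<le> C" for k x b' unfolding C_def by (rule abs_phase_coeff_le[OF i])
  \<comment> \<open>Expanding the delayed harmonic in cos kx and sin kx, its coefficients are its
    values at 0 with delays \<open>b\<close> and \<open>b - pi / 2\<close>.\<close>
  define A where "A = (\<lambda>k. \<psi> k * phase_coeff k b \<phi> 0)"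
  define B where "B = (\<lambda>k. \<psi> k * phase_coeff k (b - pi / 2) \<phi> 0)"
  have A: "summable (\<lambda>k. \<bar>A k\<bar>)" unfolding A_def
    by (rule summable_comparison_test'[OF summable_mult2[OF \<psi>, of C]])
      (use C in \<open>auto simp: abs_mult intro!: mult_left_mono\<close>)
  have B: "summable (\<lambda>k. \<bar>B k\<bar>)" unfolding B_def
    by (rule summable_comparison_test'[OF summable_mult2[OF \<psi>, of C]])
      (use C in \<open>auto simp: abs_mult intro!: mult_left_mono\<close>)
  let ?F = "\<lambda>t. \<Sum>k. A k * cos (real k * t) + B k * sin (real k * t)"
  note T = trig_series[OF A B]
  have h: "harmonic k ?F x = \<psi> k * phase_coeff k b \<phi> x" if "k \<ge> 1" for k x
  proof -
    have "harmonic k ?F x = A k * cos (real k * x) + B k * sin (real k * x)"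
      using that unfolding harmonic_def T(3)[of k] T(4)[OF that] by simp
    also have "\<dots> = \<psi> k * phase_coeff k b \<phi> x"
      unfolding A_def B_def phase_coeff_eq[OF i]
      by (simp add: cos_diff sin_diff cos_add sin_add algebra_simps)
    finally show ?thesis .
  qed
  have FC: "?F \<in> C_space" using T(1,2) by (auto simp: C_space_def periodic_2pi_def)
  have "has_psi_beta_derivative \<psi> \<beta> ?F \<phi>"
    using h \<phi> by (subst has_psi_beta_derivative_iff[OF pos]) (auto simp: b_def)
  then have "?F \<in> C_class \<psi> \<beta> M"
    using FC C_space_subset_Lp_1[OF FC] \<phi> by (auto simp: C_class_def L_class_def)
  then show ?thesis using h that unfolding b_def by blast
qed

section \<open>The remainder as a weighted series of harmonics\<close>

text \<open>The term \<open>H i\<close> occurs in the tails starting at r = 0, ..., i, and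
  \<open>min (Suc i) p\<close> of these satisfy r < p. The type is generic because the lemma serves
  real harmonics and complex geometric series.\<close>

lemma sums_min_weights:
  fixes H :: "nat \<Rightarrow> 'a :: {real_normed_field, banach}"
  assumes "summable H"
  shows "(\<lambda>i. of_nat (min (Suc i) p) * H i) sums (\<Sum>r<p. \<Sum>i. H (i + r))"
proof (induction p)
  case (Suc p)
  have "(\<lambda>i. H (i + p)) sums (\<Sum>i. H (i + p))"
    using assms summable_iff_shift[of H p] by (simp add: summable_sums)
  then have "(\<lambda>i. if i < p then 0 else H (i - p + p)) sums (\<Sum>i. H (i + p))"
    using sums_iff_shift'[of "\<lambda>i. if i < p then 0 else H (i - p + p)" p "\<Sum>i. H (i + p)"] by simp
  from sums_add[OF Suc this] have "(\<lambda>i. of_nat (min (Suc i) p) * H i + (if i < p then 0 else H (i - p + p))) sums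
    (\<Sum>r<Suc p. \<Sum>i. H (i + r))" by simp
  moreover have "of_nat (min (Suc i) p) * H i + (if i < p then 0 else H (i - p + p)) = of_nat (min (Suc i) (Suc p)) * H i" for i
    by (auto simp: min_def algebra_simps)
  ultimately show ?case by simp
qed simp

text \<open>The remainder is the mean of the \<open>p\<close> tails left by the partial sums; the
  first tail starts at the harmonic \<open>n - p + 1\<close>, the first one not reproduced
  exactly.\<close>

lemma vallee_poussin_remainder_sums:
  assumes s: "(\<lambda>k. harmonic (Suc k) f x) sums (f x - fourier_a 0 f / 2)"
    and p: "1 \<le> p" "p \<le> n"
  shows "(\<lambda>i. real (min (Suc i) p) / real p * harmonic (n - p + 1 + i) f x) sums (f x - vallee_poussin n p f x)"
proof -
  define N where "N = n - p + 1"
  define H where "H = (\<lambda>i. harmonic (N + i) f x)"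
  have sm: "summable (\<lambda>k. harmonic (Suc k) f x)" using s sums_summable by blast
  have SN: "summable (\<lambda>i. harmonic (N + i) f x)"
    using sm summable_iff_shift[of "\<lambda>k. harmonic (Suc k) f x" "n - p"] by (simp add: N_def add.commute)
  have tail: "f x - fourier_partial_sum (n - p + r) f x = (\<Sum>i. H (i + r))" for r
  proof -
    have "(\<lambda>k. harmonic (Suc (k + (n - p + r))) f x) sums
       (f x - fourier_a 0 f / 2 - (\<Sum>k<n - p + r. harmonic (Suc k) f x))"
      using s by (subst sums_iff_shift) simp
    moreover have "(\<Sum>k<n - p + r. harmonic (Suc k) f x) = (\<Sum>k=1..n - p + r. harmonic k f x)"
      by (rule sum.reindex_bij_witness[of _ "\<lambda>k. k - 1" Suc]) auto
    moreover have "harmonic (Suc (k + (n - p + r))) f x = H (k + r)" for k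
      by (simp add: H_def N_def algebra_simps)
    ultimately show ?thesis
      by (simp add: sums_iff fourier_partial_sum_def harmonic_def)
  qed
  have "{n - p..n - 1} = {n - p..<n}" using p by auto
  then have "(\<Sum>k = n - p..n - 1. fourier_partial_sum k f x) = (\<Sum>r<p. fourier_partial_sum (n - p + r) f x)"
    using p by (simp only:) (rule sum.reindex_bij_witness[of _ "\<lambda>r. n - p + r" "\<lambda>k. k - (n - p)"]; auto)
  then have "f x - vallee_poussin n p f x = (1 / real p) * (\<Sum>r<p. f x - fourier_partial_sum (n - p + r) f x)"
    using p by (simp add: vallee_poussin_def sum_subtractf field_simps)
  also have "\<dots> = (1 / real p) * (\<Sum>r<p. \<Sum>i. H (i + r))" unfolding tail ..
  finally have eq: "f x - vallee_poussin n p f x = (1 / real p) * (\<Sum>r<p. \<Sum>i. H (i + r))" .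
  show ?thesis unfolding eq
    using sums_mult[OF sums_min_weights[of H p], of "1 / real p"] SN by (simp add: H_def N_def)
qed

section \<open>The kernel and the reduction to the Poisson kernel\<close>

lemma sum_Suc_upto: "(\<Sum>j\<le>i. real (Suc j)) = real (Suc i) * real (i + 2) / 2"
  by (induction i) (auto simp: field_simps)

text \<open>Cauchy product of the series for 1/(1-r)^2 and 1/(1-r), multiplied by 2r.\<close>

lemma sums_second_order:
  fixes r :: real
  assumes r: "0 \<le> r" "r < 1"
  shows "(\<lambda>i. real (i + 1) * real i * r ^ i) sums (2 * r / (1 - r) ^ 3)"
proof -
  have nr: "norm r < 1" using r by simp
  have d: "(\<lambda>n. real (Suc n) * r ^ n) sums (1 / (1 - r)\<^sup>2)" using geometric_deriv_sums[OF nr] by simp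
  have g: "(\<lambda>n. r ^ n) sums (1 / (1 - r))" using geometric_sums[OF nr] .
  have coeff: "(\<Sum>i\<le>k. (real (Suc i) * r ^ i) * r ^ (k - i)) = real (Suc k) * real (k + 2) / 2 * r ^ k" for k
  proof -
    have "(\<Sum>i\<le>k. (real (Suc i) * r ^ i) * r ^ (k - i)) = (\<Sum>i\<le>k. real (Suc i) * r ^ k)"
      by (intro sum.cong refl) (simp add: mult.assoc flip: power_add)
    then show ?thesis by (simp only: sum_Suc_upto flip: sum_distrib_right)
  qed
  have "(\<lambda>k. \<Sum>i\<le>k. (real (Suc i) * r ^ i) * r ^ (k - i)) sums ((\<Sum>n. real (Suc n) * r ^ n) * (\<Sum>n. r ^ n))"
    using d g r by (intro Cauchy_product_sums) (auto simp: sums_iff)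
  then have "(\<lambda>k. real (Suc k) * real (k + 2) / 2 * r ^ k) sums (1 / (1 - r)\<^sup>2 * (1 / (1 - r)))"
    unfolding coeff sums_unique[OF d, symmetric] sums_unique[OF g, symmetric] .
  from sums_mult[OF this, of "2 * r"]
  have "(\<lambda>k. 2 * r * (real (Suc k) * real (k + 2) / 2 * r ^ k)) sums (2 * r * (1 / (1 - r)\<^sup>2 * (1 / (1 - r))))" .
  moreover have "2 * r * (real (Suc k) * real (k + 2) / 2 * r ^ k) = real (Suc k + 1) * real (Suc k) * r ^ Suc k" for k
    by simp
  moreover have "2 * r * (1 / (1 - r)\<^sup>2 * (1 / (1 - r))) = 2 * r / (1 - r) ^ 3"
    by (simp add: power2_eq_square power3_eq_cube)
  ultimately have "(\<lambda>k. real (Suc k + 1) * real (Suc k) * r ^ Suc k) sums (2 * r / (1 - r) ^ 3)"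
    by (simp only:)
  then show ?thesis by (subst (asm) sums_Suc_iff) simp
qed

text \<open>Origin of the factor q/(1-q)^2 min(p, 1/(1-q)) in the error terms: the weight is bounded
  once by \<open>i + 1\<close> and once by \<open>p\<close>, and the better of the two results is
  kept.\<close>

lemma weighted_series:
  fixes r :: real
  assumes r: "0 \<le> r" "r < 1"
  shows "summable (\<lambda>i. real (min (Suc i) p) * real i * r ^ i)"
    and "(\<Sum>i. real (min (Suc i) p) * real i * r ^ i) \<le> 2 * r / (1 - r)\<^sup>2 * min (real p) (1 / (1 - r))"
proof -
  note s2 = sums_second_order[OF r]
  show s: "summable (\<lambda>i. real (min (Suc i) p) * real i * r ^ i)"
    by (rule summable_comparison_test'[OF sums_summable[OF s2]])
      (use r in \<open>auto intro!: mult_right_mono simp: abs_mult\<close>)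
  have "(\<Sum>i. real (min (Suc i) p) * real i * r ^ i) \<le> (\<Sum>i. real (i + 1) * real i * r ^ i)"
    using r by (intro suminf_le s sums_summable[OF s2]) (auto intro!: mult_right_mono)
  then have 1: "(\<Sum>i. real (min (Suc i) p) * real i * r ^ i) \<le> 2 * r / (1 - r)\<^sup>2 * (1 / (1 - r))"
    using s2 by (simp add: sums_iff power2_eq_square power3_eq_cube)
  have "(\<lambda>n. real (Suc n) * r ^ n) sums (1 / (1 - r)\<^sup>2)" using geometric_deriv_sums[of r] r by simp
  from sums_mult[OF this, of r] have "(\<lambda>n. real (Suc n) * r ^ Suc n) sums (r / (1 - r)\<^sup>2)"
    by (simp add: algebra_simps)
  then have s1: "(\<lambda>n. real n * r ^ n) sums (r / (1 - r)\<^sup>2)" by (subst (asm) sums_Suc_iff) simp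
  from sums_mult[OF s1, of "real p"] have s1p: "(\<lambda>n. real p * real n * r ^ n) sums (r / (1 - r)\<^sup>2 * real p)"
    by (simp add: algebra_simps)
  have "(\<Sum>i. real (min (Suc i) p) * real i * r ^ i) \<le> (\<Sum>i. real p * real i * r ^ i)"
    using r by (intro suminf_le s sums_summable[OF s1p]) (auto intro!: mult_right_mono)
  also have "\<dots> = r / (1 - r)\<^sup>2 * real p" using s1p by (simp add: sums_iff)
  also have "\<dots> \<le> 2 * r / (1 - r)\<^sup>2 * real p" using r by (intro mult_right_mono divide_right_mono) auto
  finally have 2: "(\<Sum>i. real (min (Suc i) p) * real i * r ^ i) \<le> 2 * r / (1 - r)\<^sup>2 * real p" .
  show "(\<Sum>i. real (min (Suc i) p) * real i * r ^ i) \<le> 2 * r / (1 - r)\<^sup>2 * min (real p) (1 / (1 - r))"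
  proof (cases "real p \<le> 1 / (1 - r)")
    case True
    then have "min (real p) (1 / (1 - r)) = real p" by simp
    then show ?thesis using 2 by (simp only:)
  next
    case False
    then have "min (real p) (1 / (1 - r)) = 1 / (1 - r)" by simp
    then show ?thesis using 1 by (simp only:)
  qed
qed

section \<open>The slowly varying amplitude\<close>

lemma cis_scaled_power: "(of_real q * cis t) ^ i = of_real (q ^ i) * cis (real i * t)"
  by (simp add: power_mult_distrib Complex.DeMoivre)

text \<open>Closed form of the sum of \<open>min (Suc i) p\<close> z^i, in which the weight counts
  the partial sums that omit the harmonic N + i.\<close>

definition kern :: "real \<Rightarrow> nat \<Rightarrow> real \<Rightarrow> complex" where
  "kern q p t = (1 - (of_real q * cis t) ^ p) / (1 - of_real q * cis t)\<^sup>2"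

lemma kern_sums:
  assumes q: "0 < q" "q < 1"
  shows "(\<lambda>i. of_nat (min (Suc i) p) * (of_real q * cis t) ^ i) sums kern q p t"
proof -
  define z where "z = of_real q * cis t"
  have z: "norm z < 1" using q by (simp add: z_def norm_mult)
  then have z1: "z \<noteq> 1" by auto
  have "(\<Sum>i. z ^ (i + r)) = z ^ r / (1 - z)" for r
    using sums_mult[OF geometric_sums[OF z], of "z ^ r"] by (simp add: sums_iff power_add mult.commute)
  then have "(\<Sum>r<p. \<Sum>i. z ^ (i + r)) = (\<Sum>r<p. z ^ r) / (1 - z)" by (simp add: sum_divide_distrib)
  also have "\<dots> = (1 - z ^ p) / (1 - z)\<^sup>2"
    using z1 by (simp add: sum_gp_strict power2_eq_square)
  finally show ?thesis
    using sums_min_weights[of "\<lambda>i. z ^ i" p] summable_geometric[OF z] by (simp add: kern_def z_def)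
qed

lemma kern_modulated_sums:
  assumes q: "0 < q" "q < 1"
  shows "(\<lambda>i. real (min (Suc i) p) * q ^ i * cos (real (N + i) * u + c)) sums Re (cis (real N * u + c) * kern q p u)"
proof -
  have "(\<lambda>i. Re (cis (real N * u + c) * (of_nat (min (Suc i) p) * (of_real q * cis u) ^ i))) sums
     Re (cis (real N * u + c) * kern q p u)"
    by (intro sums_Re sums_mult kern_sums q)
  moreover have "Re (cis (real N * u + c) * (of_nat (min (Suc i) p) * (of_real q * cis u) ^ i)) =
     real (min (Suc i) p) * q ^ i * cos (real (N + i) * u + c)" for i
  proof -
    have "cis (real N * u + c) * (of_nat (min (Suc i) p) * (of_real q * cis u) ^ i) =
      of_real (real (min (Suc i) p) * q ^ i) * (cis (real N * u + c) * cis (real i * u))"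
      unfolding cis_scaled_power by simp
    also have "cis (real N * u + c) * cis (real i * u) = cis (real (N + i) * u + c)"
      by (simp add: cis_mult algebra_simps)
    finally have eq: "cis (real N * u + c) * (of_nat (min (Suc i) p) * (of_real q * cis u) ^ i) =
      of_real (real (min (Suc i) p) * q ^ i) * cis (real (N + i) * u + c)" .
    show ?thesis unfolding eq by simp
  qed
  ultimately show ?thesis by (simp only:)
qed

lemma norm_cis_diff_le: "norm (cis a - cis b) \<le> \<bar>a - b\<bar>"
proof -
  have "exp (\<i> * of_real (a - b)) = cis (a - b)" by (simp add: cis_conv_exp)
  then have "cis a - cis b = cis b * (exp (\<i> * of_real (a - b)) - 1)"
    by (simp only: right_diff_distrib cis_mult) simp
  then have "norm (cis a - cis b) = norm (exp (\<i> * of_real (a - b)) - 1)" by (simp add: norm_mult)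
  also have "\<dots> = 2 * \<bar>sin ((a - b) / 2)\<bar>" using dist_exp_i_1[of "a - b"] by simp
  also have "\<dots> \<le> \<bar>a - b\<bar>" using abs_sin_x_le_abs_x[of "(a - b) / 2"] by simp
  finally show ?thesis .
qed

text \<open>Each term z^i has Lipschitz constant \<open>i * q ^ i\<close> in \<open>t\<close>;
  summing with the weights gives exactly the series bounded in
  \<open>weighted_series\<close>.\<close>

lemma kern_Lipschitz:
  assumes q: "0 < q" "q < 1"
  shows "norm (kern q p t - kern q p s) \<le> 2 * q / (1 - q)\<^sup>2 * min (real p) (1 / (1 - q)) * \<bar>t - s\<bar>"
proof -
  let ?d = "\<lambda>i. of_nat (min (Suc i) p) * (of_real q * cis t) ^ i - of_nat (min (Suc i) p) * (of_real q * cis s) ^ i"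
  have s: "?d sums (kern q p t - kern q p s)" by (intro sums_diff kern_sums q)
  note W = weighted_series[of q p]
  have "norm (?d i) \<le> real (min (Suc i) p) * real i * q ^ i * \<bar>t - s\<bar>" for i
  proof -
    have "?d i = of_real (real (min (Suc i) p) * q ^ i) * (cis (real i * t) - cis (real i * s))"
      unfolding cis_scaled_power by (simp add: algebra_simps)
    then have "norm (?d i) = real (min (Suc i) p) * q ^ i * norm (cis (real i * t) - cis (real i * s))"
      using q by (simp add: norm_mult norm_power)
    also have "\<dots> \<le> real (min (Suc i) p) * q ^ i * \<bar>real i * t - real i * s\<bar>"
      using q by (intro mult_left_mono norm_cis_diff_le) auto
    also have "\<bar>real i * t - real i * s\<bar> = real i * \<bar>t - s\<bar>"
      by (simp add: abs_mult flip: right_diff_distrib)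
    finally show ?thesis by (simp add: mult_ac)
  qed
  then have "norm (suminf ?d) \<le> (\<Sum>i. real (min (Suc i) p) * real i * q ^ i * \<bar>t - s\<bar>)"
    using q by (intro norm_suminf_le summable_mult2 W) auto
  also have "\<dots> = (\<Sum>i. real (min (Suc i) p) * real i * q ^ i) * \<bar>t - s\<bar>"
    using q by (intro suminf_mult2[symmetric] W) auto
  also have "\<dots> \<le> 2 * q / (1 - q)\<^sup>2 * min (real p) (1 / (1 - q)) * \<bar>t - s\<bar>"
    using q by (intro mult_right_mono W) auto
  finally show ?thesis using s by (simp add: sums_iff)
qed

lemma kern_periodic: "kern q p (t + 2 * pi) = kern q p t"
proof -
  have "cis (t + 2 * pi) = cis t" by (simp flip: cis_mult)
  then show ?thesis by (simp add: kern_def)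
qed

lemma one_minus_cis_nonzero:
  assumes "0 < q" "q < 1" shows "1 - of_real q * cis t \<noteq> 0"
proof
  assume "1 - of_real q * cis t = 0"
  then have "norm (of_real q * cis t) = norm (1 :: complex)" by simp
  then show False using assms by (simp add: norm_mult)
qed

lemma kern_continuous:
  assumes "0 < q" "q < 1" shows "continuous_on S (kern q p)"
  unfolding kern_def using one_minus_cis_nonzero[OF assms] by (intro continuous_intros) auto

section \<open>Comparison of the coefficients with a geometric progression\<close>

lemma polyharmonic_factor_ge_1:
  assumes "0 < q" "q < 1" shows "polyharmonic_factor m q k \<ge> 1"
proof -
  have "q\<^sup>2 \<le> 1" using assms by (simp add: power_le_one)
  then show ?thesis unfolding polyharmonic_factor_def
    by (auto intro!: sum_nonneg mult_nonneg_nonneg divide_nonneg_pos prod_nonneg zero_le_power)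
qed

text \<open>Passing from N to N + i multiplies each factor N + 2l by at most 1 + i/N. Every product
  has fewer than \<open>m\<close> factors, so the whole grows by at most (1 + i/N)^m \<le> exp(i m /
  N).\<close>

lemma polyharmonic_factor_growth:
  assumes q: "0 < q" "q < 1" and N: "N \<ge> 1" and m: "m \<ge> 1"
  shows "polyharmonic_factor m q N \<le> polyharmonic_factor m q (N + i)"
    and "polyharmonic_factor m q (N + i) \<le> exp (real i * real m / real N) * polyharmonic_factor m q N"
proof -
  have q2: "q\<^sup>2 \<le> 1" using q by (simp add: power_le_one)
  define c where "c = (\<lambda>j::nat. (1 - q\<^sup>2) ^ j / (fact j * 2 ^ j))"
  have c: "c j \<ge> 0" for j using q2 by (auto simp: c_def)
  have P: "polyharmonic_factor m q k = 1 + (\<Sum>j = 1..m - 1. c j * (\<Prod>l = 0..j - 1. real (k + 2 * l)))" for k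
    by (simp add: polyharmonic_factor_def c_def)
  show "polyharmonic_factor m q N \<le> polyharmonic_factor m q (N + i)"
    unfolding P by (intro add_left_mono sum_mono mult_left_mono prod_mono c) auto
  define E where "E = exp (real i * real m / real N)"
  have E1: "1 \<le> E" unfolding E_def by simp
  have pw: "(1 + real i / real N) ^ j \<le> E" if "j \<le> m" for j
  proof -
    have "(1 + real i / real N) ^ j \<le> (exp (real i / real N)) ^ j"
      by (intro power_mono exp_ge_add_one_self) auto
    also have "\<dots> = exp (real j * (real i / real N))" by (simp only: exp_of_nat_mult)
    also have "\<dots> \<le> E" unfolding E_def using mult_right_mono[of "real j" "real m" "real i / real N"] that by (simp add: mult.commute)
    finally show ?thesis .
  qed
  have "(\<Prod>l = 0..j - 1. real (N + i + 2 * l)) \<le> E * (\<Prod>l = 0..j - 1. real (N + 2 * l))" if j: "1 \<le> j" "j \<le> m" for j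
  proof -
    have "(\<Prod>l = 0..j - 1. real (N + i + 2 * l)) \<le> (\<Prod>l = 0..j - 1. (1 + real i / real N) * real (N + 2 * l))"
    proof (intro prod_mono conjI)
      fix l
      have "real i / real N * real N \<le> real i / real N * real (N + 2 * l)"
        by (intro mult_left_mono) auto
      then have "real i \<le> real i / real N * real (N + 2 * l)" using N by simp
      then show "real (N + i + 2 * l) \<le> (1 + real i / real N) * real (N + 2 * l)" by (simp add: distrib_right)
    qed auto
    also have "\<dots> = (1 + real i / real N) ^ j * (\<Prod>l = 0..j - 1. real (N + 2 * l))"
      using j by (simp add: prod.distrib)
    also have "\<dots> \<le> E * (\<Prod>l = 0..j - 1. real (N + 2 * l))"
      using j by (intro mult_right_mono pw prod_nonneg) auto
    finally show ?thesis .
  qed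
  then have "(\<Sum>j = 1..m - 1. c j * (\<Prod>l = 0..j - 1. real (N + i + 2 * l))) \<le>
     (\<Sum>j = 1..m - 1. c j * (E * (\<Prod>l = 0..j - 1. real (N + 2 * l))))"
    by (intro sum_mono mult_left_mono c) auto
  also have "\<dots> = E * (\<Sum>j = 1..m - 1. c j * (\<Prod>l = 0..j - 1. real (N + 2 * l)))"
    by (simp add: sum_distrib_left mult_ac)
  finally show "polyharmonic_factor m q (N + i) \<le> exp (real i * real m / real N) * polyharmonic_factor m q N"
    unfolding P E_def[symmetric] using E1 by (simp add: distrib_left)
qed

lemma psi_polyharmonic_pos: "0 < q \<Longrightarrow> q < 1 \<Longrightarrow> psi_polyharmonic m q k > 0"
  using polyharmonic_factor_ge_1[of q m k] by (simp add: psi_polyharmonic_def)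

text \<open>For r = q exp(m/N) this says r \<le> 2q and 1 - r \<ge> (1-q)/2, so replacing
  \<open>q\<close> by r in an estimate costs only an absolute constant. The first bound preserves
  the factor \<open>q\<close> of the error term, the second its powers of 1/(1-q).\<close>

definition large_index :: "real \<Rightarrow> nat \<Rightarrow> nat \<Rightarrow> bool" where
  "large_index q m N \<longleftrightarrow> 1 \<le> N \<and> exp (real m / real N) \<le> 2 \<and> q * exp (real m / real N) \<le> (1 + q) / 2"

lemma ex_large_index:
  assumes q: "0 < q" "q < 1"
  shows "\<exists>N0. \<forall>N\<ge>N0. large_index q m N"
proof -
  have "(\<lambda>N. real m / real N) \<longlonglongrightarrow> 0" by real_asymp
  then have l: "(\<lambda>N. exp (real m / real N)) \<longlonglongrightarrow> 1" using tendsto_exp by fastforce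
  have "eventually (\<lambda>N. exp (real m / real N) < 2) sequentially"
    using order_tendstoD(2)[OF l, of 2] by simp
  moreover have "(\<lambda>N. q * exp (real m / real N)) \<longlonglongrightarrow> q * 1" by (intro tendsto_intros l)
  then have "eventually (\<lambda>N. q * exp (real m / real N) < (1 + q) / 2) sequentially"
    using order_tendstoD(2)[of _ "q * 1" sequentially "(1 + q) / 2"] q by simp
  moreover have "eventually (\<lambda>N::nat. 1 \<le> N) sequentially" by (rule eventually_ge_at_top)
  ultimately have "eventually (\<lambda>N. large_index q m N) sequentially"
    by eventually_elim (auto simp: large_index_def)
  then show ?thesis by (simp add: eventually_sequentially)
qed

text \<open>From a large index on, the growth bound gives a geometric majorant of ratio q exp(m/N) <
  1.\<close>

lemma summable_psi_polyharmonic: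
  assumes q: "0 < q" "q < 1" and m: "m \<ge> 1"
  shows "summable (\<lambda>k. \<bar>psi_polyharmonic m q k\<bar>)"
proof -
  obtain N where N: "large_index q m N" using ex_large_index[OF q] by blast
  define r where "r = q * exp (real m / real N)"
  have r: "0 \<le> r" "r < 1" using N q by (auto simp: r_def large_index_def)
  have "\<bar>psi_polyharmonic m q (i + N)\<bar> \<le> q ^ N * polyharmonic_factor m q N * r ^ i" for i
  proof -
    have "polyharmonic_factor m q (N + i) \<le> exp (real i * real m / real N) * polyharmonic_factor m q N"
      using N q m by (intro polyharmonic_factor_growth) (auto simp: large_index_def)
    also have "exp (real i * real m / real N) = exp (real m / real N) ^ i"
      by (simp flip: exp_of_nat_mult)
    finally have "q ^ (N + i) * polyharmonic_factor m q (N + i) \<le> q ^ (N + i) * (exp (real m / real N) ^ i * polyharmonic_factor m q N)"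
      using q by (intro mult_left_mono) auto
    then show ?thesis using psi_polyharmonic_pos[OF q, of m "N + i"]
      by (simp add: psi_polyharmonic_def r_def power_add power_mult_distrib mult_ac add.commute)
  qed
  then have "summable (\<lambda>i. \<bar>psi_polyharmonic m q (i + N)\<bar>)"
    using r by (intro summable_comparison_test'[OF summable_mult[OF summable_geometric[of r]]]) auto
  then show ?thesis using summable_iff_shift[of "\<lambda>k. \<bar>psi_polyharmonic m q k\<bar>"] by blast
qed

text \<open>With x = i m / N the relative deviation lies between 0 and exp(x) - 1 \<le> x exp(x).
  The factor x supplies m/N and one power of i, and exp(x) turns q^i into r^i, which leaves the
  series of \<open>weighted_series\<close>.\<close>

lemma polyharmonic_remainder_bound:
  fixes h :: "nat \<Rightarrow> real"
  assumes q: "0 < q" "q < 1" and m: "m \<ge> 1" and N: "large_index q m N" and h: "\<And>i. \<bar>h i\<bar> \<le> D"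
  shows "summable (\<lambda>i. real (min (Suc i) p) * q ^ i * (polyharmonic_factor m q (N + i) / polyharmonic_factor m q N - 1) * h i)"
   and "\<bar>\<Sum>i. real (min (Suc i) p) * q ^ i * (polyharmonic_factor m q (N + i) / polyharmonic_factor m q N - 1) * h i\<bar>
     \<le> 32 * D * (real m * q / (1 - q)\<^sup>2 * min (real p) (1 / (1 - q))) / real N"
proof -
  have N1: "N \<ge> 1" and e2: "exp (real m / real N) \<le> 2" and qe: "q * exp (real m / real N) \<le> (1 + q) / 2"
    using N by (auto simp: large_index_def)
  have D: "D \<ge> 0" using h[of 0] by linarith
  define r where "r = q * exp (real m / real N)"
  have r: "0 \<le> r" "r < 1" "r \<le> 2 * q" "(1 - q) / 2 \<le> 1 - r" using e2 qe q by (auto simp: r_def)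
  let ?E = "\<lambda>i. real (min (Suc i) p) * q ^ i * (polyharmonic_factor m q (N + i) / polyharmonic_factor m q N - 1) * h i"
  let ?c = "real m / real N * D"
  have bd: "norm (?E i) \<le> ?c * (real (min (Suc i) p) * real i * r ^ i)" for i
  proof -
    define x where "x = real i * real m / real N"
    have x: "x \<ge> 0" by (simp add: x_def)
    have P1: "polyharmonic_factor m q N \<ge> 1" by (rule polyharmonic_factor_ge_1[OF q])
    note gr = polyharmonic_factor_growth[OF q N1 m, of i]
    have lo: "0 \<le> polyharmonic_factor m q (N + i) / polyharmonic_factor m q N - 1"
      using gr(1) P1 by (simp add: field_simps)
    have "polyharmonic_factor m q (N + i) / polyharmonic_factor m q N - 1 \<le> exp x - 1"
      using gr(2) P1 by (simp add: field_simps x_def)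
    also have "\<dots> \<le> x * exp x"
    proof -
      have "1 - x \<le> exp (- x)" using exp_ge_add_one_self[of "-x"] by simp
      then have "(1 - x) * exp x \<le> exp (- x) * exp x" by (intro mult_right_mono) auto
      then show ?thesis by (simp add: exp_minus algebra_simps)
    qed
    finally have up: "polyharmonic_factor m q (N + i) / polyharmonic_factor m q N - 1 \<le> x * exp x" .
    have "\<bar>polyharmonic_factor m q (N + i) / polyharmonic_factor m q N - 1\<bar> * \<bar>h i\<bar> \<le> (x * exp x) * D"
      using lo up h x by (intro mult_mono) auto
    then have "real (min (Suc i) p) * q ^ i * (\<bar>polyharmonic_factor m q (N + i) / polyharmonic_factor m q N - 1\<bar> * \<bar>h i\<bar>)
       \<le> real (min (Suc i) p) * q ^ i * ((x * exp x) * D)"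
      using q by (intro mult_left_mono) auto
    moreover have "exp x = exp (real m / real N) ^ i" by (simp add: x_def flip: exp_of_nat_mult)
    ultimately show ?thesis
      using q by (simp add: abs_mult r_def power_mult_distrib x_def mult_ac)
  qed
  note W = weighted_series[OF r(1,2), of p]
  show "summable ?E" by (rule summable_comparison_test'[OF summable_mult[OF W(1), of ?c]]) (use bd in auto)
  have "norm (suminf ?E) \<le> (\<Sum>i. ?c * (real (min (Suc i) p) * real i * r ^ i))"
    by (intro norm_suminf_le bd summable_mult W)
  also have "\<dots> = ?c * (\<Sum>i. real (min (Suc i) p) * real i * r ^ i)" by (rule suminf_mult[OF W(1)])
  also have "\<dots> \<le> ?c * (2 * r / (1 - r)\<^sup>2 * min (real p) (1 / (1 - r)))"
    using D by (intro mult_left_mono W) auto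
  \<comment> \<open>Returning from r to q costs 2 in the numerator, 4 in the squared denominator and
    2 in the minimum; with the 2 already present this makes 32.\<close>
  also have "\<dots> \<le> ?c * ((2 * (2 * q)) / ((1 - q) / 2)\<^sup>2 * (2 * min (real p) (1 / (1 - q))))"
  proof (intro mult_left_mono mult_mono frac_le)
    show "((1 - q) / 2)\<^sup>2 \<le> (1 - r)\<^sup>2" using r q by (intro power_mono) auto
    have "1 / (1 - r) \<le> 1 / ((1 - q) / 2)" using r q by (intro frac_le) auto
    then have "min (real p) (1 / (1 - r)) \<le> min (2 * real p) (1 / ((1 - q) / 2))" by auto
    then show "min (real p) (1 / (1 - r)) \<le> 2 * min (real p) (1 / (1 - q))" by (auto simp: min_def split: if_splits)
  qed (use r q D in auto)
  also have "\<dots> = 32 * D * (real m * q / (1 - q)\<^sup>2 * min (real p) (1 / (1 - q))) / real N"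
    by (simp add: power_divide mult_ac)
  finally show "\<bar>suminf ?E\<bar> \<le> 32 * D * (real m * q / (1 - q)\<^sup>2 * min (real p) (1 / (1 - q))) / real N" by simp
qed

section \<open>Integral form of the remainder\<close>

text \<open>The part of the remainder with coefficients q^i collapses to one convolution;
  \<open>p * q ^ i\<close> is the summable majorant that permits termwise integration.\<close>

lemma phase_coeff_kern_sums:
  assumes q: "0 < q" "q < 1" and \<phi>: "set_integrable lebesgue {0..2 * pi} \<phi>"
  shows "(\<lambda>i. real (min (Suc i) p) * q ^ i * phase_coeff (N + i) b \<phi> x) sums
    ((1 / pi) * (LINT t:{0..2 * pi}|lebesgue. \<phi> t * Re (cis (real N * (t - x) + b) * kern q p (t - x))))"
proof -
  let ?u = "\<lambda>i t. real (min (Suc i) p) * q ^ i * cos (real (N + i) * (t - x) + b)"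
  have s: "summable (\<lambda>i. real p * q ^ i)" using q by (intro summable_mult summable_geometric) auto
  have "(\<lambda>i. LINT t:{0..2 * pi}|lebesgue. \<phi> t * ?u i t) sums (LINT t:{0..2 * pi}|lebesgue. \<phi> t * (\<Sum>i. ?u i t))"
  proof (rule set_integral_sums_bounded[OF \<phi> _ _ s])
    show "?u i \<in> borel_measurable lebesgue" for i
      by (intro borel_measurable_lebesgue_continuous continuous_intros)
    show "\<bar>?u i t\<bar> \<le> real p * q ^ i" for i t
    proof -
      have "\<bar>?u i t\<bar> \<le> (real p * q ^ i) * 1"
        unfolding abs_mult using q by (intro mult_mono) auto
      then show ?thesis by simp
    qed
  qed
  moreover have "(\<Sum>i. ?u i t) = Re (cis (real N * (t - x) + b) * kern q p (t - x))" for t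
    using kern_modulated_sums[OF q, of p N "t - x" b] by (simp add: sums_iff)
  moreover have "(LINT t:{0..2 * pi}|lebesgue. \<phi> t * ?u i t) =
     pi * (real (min (Suc i) p) * q ^ i * phase_coeff (N + i) b \<phi> x)" for i
  proof -
    have "(LINT t:{0..2 * pi}|lebesgue. \<phi> t * ?u i t) =
       (LINT t:{0..2 * pi}|lebesgue. (real (min (Suc i) p) * q ^ i) * (\<phi> t * cos (real (N + i) * (t - x) + b)))"
      by (simp only: mult_ac)
    also have "\<dots> = (real (min (Suc i) p) * q ^ i) * (LINT t:{0..2 * pi}|lebesgue. \<phi> t * cos (real (N + i) * (t - x) + b))"
      by (rule set_integral_mult_right)
    finally show ?thesis by (simp add: phase_coeff_def del: of_nat_add)
  qed
  ultimately have "(\<lambda>i. pi * (real (min (Suc i) p) * q ^ i * phase_coeff (N + i) b \<phi> x)) sums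
    (LINT t:{0..2 * pi}|lebesgue. \<phi> t * Re (cis (real N * (t - x) + b) * kern q p (t - x)))" by simp
  from sums_mult[OF this, of "1 / pi"] show ?thesis by simp
qed

text \<open>Writes the polyharmonic factor at N + i as its value at N times 1 + (ratio - 1): the 1
  gives the Poisson case, the rest is \<open>E\<close>. The bound \<open>D\<close> on phase
  coefficients is left open because it depends on the class: a constant for the L_s balls, a
  multiple of \<omega>(1/N) for H_\<omega>.\<close>

lemma remainder_formula:
  assumes q: "0 < q" "q < 1" and m: "m \<ge> 1" and p: "1 \<le> p" "p \<le> n" and N: "N = n - p + 1" "large_index q m N"
    and f: "f \<in> C_space" and \<phi>: "set_integrable lebesgue {0..2 * pi} \<phi>"
    and h: "\<And>k x. k \<ge> 1 \<Longrightarrow> harmonic k f x = psi_polyharmonic m q k * phase_coeff k b \<phi> x"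
    and D: "\<And>k. k \<ge> N \<Longrightarrow> \<bar>phase_coeff k b \<phi> x\<bar> \<le> D"
  obtains E where
    "f x - vallee_poussin n p f x = q ^ N / real p * polyharmonic_factor m q N *
       ((1 / pi) * (LINT t:{0..2 * pi}|lebesgue. \<phi> t * Re (cis (real N * (t - x) + b) * kern q p (t - x))) + E)"
    "\<bar>E\<bar> \<le> 32 * D * (real m * q / (1 - q)\<^sup>2 * min (real p) (1 / (1 - q))) / real N"
proof -
  define P where "P = polyharmonic_factor m q"
  have P: "P N \<ge> 1" using polyharmonic_factor_ge_1[OF q] by (simp add: P_def)
  let ?h = "\<lambda>i. phase_coeff (N + i) b \<phi> x"
  let ?J = "(1 / pi) * (LINT t:{0..2 * pi}|lebesgue. \<phi> t * Re (cis (real N * (t - x) + b) * kern q p (t - x)))"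
  let ?e = "\<lambda>i. real (min (Suc i) p) * q ^ i * (P (N + i) / P N - 1) * ?h i"
  note B = polyharmonic_remainder_bound[OF q m N(2), where h = ?h and D = D and p = p, folded P_def]
  have S1: "(\<lambda>i. real (min (Suc i) p) / real p * harmonic (N + i) f x) sums (f x - vallee_poussin n p f x)"
    unfolding N(1)
    by (rule vallee_poussin_remainder_sums[OF C_space_sums_harmonics(1)[OF f \<phi> h summable_psi_polyharmonic[OF q m]] p]) auto
  have S2: "(\<lambda>i. q ^ N / real p * P N * (real (min (Suc i) p) * q ^ i * ?h i + ?e i)) sums
     (q ^ N / real p * P N * (?J + suminf ?e))"
    by (intro sums_mult sums_add phase_coeff_kern_sums[OF q \<phi>] summable_sums B(1)) (use D in auto)
  have eq: "real (min (Suc i) p) / real p * harmonic (N + i) f x =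
     q ^ N / real p * P N * (real (min (Suc i) p) * q ^ i * ?h i + ?e i)" for i
  proof -
    have "harmonic (N + i) f x = q ^ N * q ^ i * P (N + i) * ?h i"
      using h[of "N + i" x] N(1) by (simp add: psi_polyharmonic_def P_def power_add)
    moreover have "P N * (real (min (Suc i) p) * q ^ i * ?h i + ?e i) = real (min (Suc i) p) * q ^ i * P (N + i) * ?h i"
      using P by (simp add: field_simps)
    ultimately show ?thesis by (simp add: mult_ac)
  qed
  from S2[folded eq] S1 have "f x - vallee_poussin n p f x = q ^ N / real p * P N * (?J + suminf ?e)"
    by (rule sums_unique2[rotated])
  then show ?thesis using that[of "suminf ?e"] B(2) D unfolding P_def by auto
qed

section \<open>Step functions and the extremal problem in Lebesgue spaces\<close>

lemma conj_exponent_cases: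
  assumes "1 \<le> s"
  obtains (one) "s = 1" "conj_exponent s = \<infinity>"
    | (infinite) "s = \<infinity>" "conj_exponent s = 1"
    | (finite) r r' where "s = ereal r" "1 < r" "conj_exponent s = ereal r'" "1 < r'" "1 / r + 1 / r' = 1"
        "r' = r / (r - 1)" "(r' - 1) * r = r'"
proof -
  consider "s = 1" | "s = \<infinity>" | r where "s = ereal r" "1 < r"
    using assms by (cases s) (auto simp: one_ereal_def order.strict_iff_order)
  then show ?thesis
  proof cases
    case 3
    have s1: "s \<noteq> 1" "s \<noteq> \<infinity>" using 3 by auto
    have "conj_exponent s = ereal (r / (r - 1))"
      unfolding conj_exponent_def using 3 by (simp add: one_ereal_def)
    then show ?thesis using finite[of r "r / (r - 1)"] 3 by (simp add: field_simps)
  qed (auto intro: one infinite simp: conj_exponent_def)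
qed

lemma set_integrable_bounded_Icc:
  fixes u :: "real \<Rightarrow> real"
  assumes "u \<in> borel_measurable lebesgue" "\<And>t. \<bar>u t\<bar> \<le> B"
  shows "set_integrable lebesgue {a..b} u"
  using set_integrable_mult_bounded[of "{a..b}" "\<lambda>_. 1" u B] assms set_integrable_continuous_Icc(1)[of a b "\<lambda>_. 1 :: real"]
  by auto

lemma LINT_nonneg: "(\<And>t. 0 \<le> (f t :: real)) \<Longrightarrow> 0 \<le> (LINT t:S|M. f t)"
  unfolding set_lebesgue_integral_def by (intro Bochner_Integration.integral_nonneg) auto

lemma LINT_const_2pi: "(LINT t:{0..2 * pi}|lebesgue. (c :: real)) = 2 * pi * c"
  by (subst set_integrable_continuous_Icc(2)) auto

lemma esssup_abs_le:
  fixes f :: "real \<Rightarrow> real"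
  assumes "f \<in> borel_measurable lebesgue" "esssup lebesgue (\<lambda>t. ereal \<bar>f t\<bar>) < \<infinity>"
  shows "AE t in lebesgue. \<bar>f t\<bar> \<le> real_of_ereal (esssup lebesgue (\<lambda>t. ereal \<bar>f t\<bar>))"
proof -
  define e where "e = esssup lebesgue (\<lambda>t. ereal \<bar>f t\<bar>)"
  have ae: "AE t in lebesgue. ereal \<bar>f t\<bar> \<le> e" unfolding e_def by (rule esssup_AE)
  have ne: "ae_filter (lebesgue :: real measure) \<noteq> bot"
    by (simp add: ae_filter_eq_bot_iff)
  \<comment> \<open>\<open>real_of_ereal\<close> sends -\<infinity> to 0, so this value has to be
    excluded before passing to reals; it would force a trivial almost-everywhere filter.\<close>
  have "e \<noteq> - \<infinity>"
  proof
    assume "e = - \<infinity>"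
    then have "AE t in (lebesgue :: real measure). False" using ae by simp
    then show False using ne by (simp add: trivial_limit_def)
  qed
  then obtain r where r: "e = ereal r" using assms(2) unfolding e_def[symmetric] by (cases e) auto
  show ?thesis using ae unfolding e_def[symmetric] r by simp
qed

lemma Lp_norm_finite: "Lp_norm (ereal r) f = (LINT t:{0..2 * pi}|lebesgue. \<bar>f t\<bar> powr r) powr (1 / r)"
  by (simp add: Lp_norm_def)

lemma Lp_norm_1: "Lp_norm 1 f = (LINT t:{0..2 * pi}|lebesgue. \<bar>f t\<bar>)"
  by (simp add: Lp_norm_def one_ereal_def set_lebesgue_integral_def)

lemma Lp_norm_infinity_le:
  fixes f :: "real \<Rightarrow> real"
  assumes "f \<in> borel_measurable lebesgue" "\<And>t. \<bar>f t\<bar> \<le> c"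
  shows "Lp_norm \<infinity> f \<le> c" "esssup lebesgue (\<lambda>t. ereal \<bar>f t\<bar>) < \<infinity>"
proof -
  have "esssup lebesgue (\<lambda>t. ereal \<bar>f t\<bar>) \<le> ereal c"
    using assms by (intro esssup_I) auto
  then show 1: "esssup lebesgue (\<lambda>t. ereal \<bar>f t\<bar>) < \<infinity>" by (auto intro: le_less_trans)
  have c: "0 \<le> c" using assms(2)[of 0] by linarith
  show "Lp_norm \<infinity> f \<le> c"
    using \<open>esssup lebesgue (\<lambda>t. ereal \<bar>f t\<bar>) \<le> ereal c\<close> c
    by (cases "esssup lebesgue (\<lambda>t. ereal \<bar>f t\<bar>)") (auto simp: Lp_norm_def)
qed

lemma U0_cases:
  assumes \<phi>: "\<phi> \<in> U0 s" and s: "1 \<le> s"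
  shows "\<phi> \<in> Lp_space 1" "fourier_a 0 \<phi> = 0"
    "s = \<infinity> \<Longrightarrow> AE t in lebesgue. \<bar>\<phi> t\<bar> \<le> 1"
    "s = ereal r \<Longrightarrow> set_integrable lebesgue {0..2 * pi} (\<lambda>t. \<bar>\<phi> t\<bar> powr r) \<and> (LINT t:{0..2 * pi}|lebesgue. \<bar>\<phi> t\<bar> powr r) \<le> 1"
proof -
  have per: "periodic_2pi \<phi>" and m: "\<phi> \<in> borel_measurable lebesgue" and n: "Lp_norm s \<phi> \<le> 1"
    and mean: "(LINT t:{0..2 * pi}|lebesgue. \<phi> t) = 0"
    using \<phi> by (auto simp: U0_def Lp_space_def)
  show "fourier_a 0 \<phi> = 0" using mean by (simp add: fourier_a_def)
  have sinf: "AE t in lebesgue. \<bar>\<phi> t\<bar> \<le> 1" if "s = \<infinity>"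
  proof -
    have "esssup lebesgue (\<lambda>t. ereal \<bar>\<phi> t\<bar>) < \<infinity>" using \<phi> that by (auto simp: U0_def Lp_space_def)
    from esssup_abs_le[OF m this] show ?thesis
      using n that by (auto simp: Lp_norm_def elim!: eventually_mono)
  qed
  have sfin: "set_integrable lebesgue {0..2 * pi} (\<lambda>t. \<bar>\<phi> t\<bar> powr r) \<and> (LINT t:{0..2 * pi}|lebesgue. \<bar>\<phi> t\<bar> powr r) \<le> 1" if sr: "s = ereal r" for r
  proof
    show "set_integrable lebesgue {0..2 * pi} (\<lambda>t. \<bar>\<phi> t\<bar> powr r)" using \<phi> sr by (auto simp: U0_def Lp_space_def)
    have r: "1 \<le> r" using s sr by simp
    define I where "I = (LINT t:{0..2 * pi}|lebesgue. \<bar>\<phi> t\<bar> powr r)"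
    have I0: "I \<ge> 0" unfolding I_def by (intro LINT_nonneg) auto
    have "I powr (1 / r) \<le> 1" using n sr by (simp add: Lp_norm_finite I_def)
    then have "(I powr (1 / r)) powr r \<le> 1 powr r" using r by (intro powr_mono2) auto
    then show "I \<le> 1" using r I0 by (simp add: powr_powr)
  qed
  show "s = \<infinity> \<Longrightarrow> AE t in lebesgue. \<bar>\<phi> t\<bar> \<le> 1"
    "s = ereal r \<Longrightarrow> set_integrable lebesgue {0..2 * pi} (\<lambda>t. \<bar>\<phi> t\<bar> powr r) \<and> (LINT t:{0..2 * pi}|lebesgue. \<bar>\<phi> t\<bar> powr r) \<le> 1"
    using sinf sfin by auto
  have one: "set_integrable lebesgue {0..2 * pi} (\<lambda>t. 1 :: real)"
    by (rule set_integrable_continuous_Icc) auto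
  have mb: "set_borel_measurable lebesgue {0..2 * pi} \<phi>"
    by (auto simp: set_borel_measurable_def intro!: borel_measurable_times borel_measurable_indicator m)
  have "set_integrable lebesgue {0..2 * pi} \<phi>"
  proof (cases "s = \<infinity>")
    case True
    show ?thesis
      by (rule set_integrable_bound[OF one mb]) (use sinf[OF True] in \<open>auto elim!: eventually_mono\<close>)
  next
    case False
    then obtain r where sr: "s = ereal r" using s by (cases s) auto
    have r: "1 \<le> r" using s sr by simp
    have "set_integrable lebesgue {0..2 * pi} (\<lambda>t. 1 + \<bar>\<phi> t\<bar> powr r)"
      using sfin[OF sr] one by (intro set_integral_add) auto
    then show ?thesis
    proof (rule set_integrable_bound[OF _ mb])
      \<comment> \<open>This domination embeds L_r in L_1 over one period.\<close>
      have "\<bar>x\<bar> \<le> 1 + \<bar>x\<bar> powr r" for x :: real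
      proof (cases "\<bar>x\<bar> \<le> 1")
        case True
        then show ?thesis using powr_ge_zero[of "\<bar>x\<bar>" r] by linarith
      next
        case False
        then have "\<bar>x\<bar> powr 1 \<le> \<bar>x\<bar> powr r" using r by (intro powr_mono) auto
        then show ?thesis by simp
      qed
      then show "AE t in lebesgue. t \<in> {0..2 * pi} \<longrightarrow> norm (\<phi> t) \<le> norm (1 + \<bar>\<phi> t\<bar> powr r)"
        by (intro AE_I2) (auto simp: add_nonneg_nonneg)
    qed
  qed
  then show "\<phi> \<in> Lp_space 1" using per m by (intro Lp_space_1I)
qed

text \<open>Duality against the unit ball, for bounded measurable \<open>w\<close>. All three ranges
  of the exponent are treated together, since the final constants must not depend on it.\<close>

lemma Holder_U0:
  assumes \<phi>: "\<phi> \<in> U0 s" and s: "1 \<le> s"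
    and w: "w \<in> borel_measurable lebesgue" "\<And>t. \<bar>w t\<bar> \<le> B"
  shows "set_integrable lebesgue {0..2 * pi} (\<lambda>t. \<phi> t * w t)"
    and "\<bar>LINT t:{0..2 * pi}|lebesgue. \<phi> t * w t\<bar> \<le> Lp_norm (conj_exponent s) w"
proof -
  note U = U0_cases[OF \<phi> s]
  note i\<phi> = Lp_space_1D(3)[OF U(1)]
  show int: "set_integrable lebesgue {0..2 * pi} (\<lambda>t. \<phi> t * w t)"
    by (rule set_integrable_mult_bounded[OF i\<phi> w])
  have le: "\<bar>LINT t:{0..2 * pi}|lebesgue. \<phi> t * w t\<bar> \<le> (LINT t:{0..2 * pi}|lebesgue. \<bar>\<phi> t * w t\<bar>)"
    using set_integral_norm_bound[OF int] by simp
  show "\<bar>LINT t:{0..2 * pi}|lebesgue. \<phi> t * w t\<bar> \<le> Lp_norm (conj_exponent s) w"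
    using s
  proof (cases rule: conj_exponent_cases)
    case one
    have ae: "AE t in lebesgue. \<bar>w t\<bar> \<le> Lp_norm \<infinity> w"
      using esssup_abs_le[OF w(1) Lp_norm_infinity_le(2)[OF w]] by (simp add: Lp_norm_def)
    have L0: "Lp_norm \<infinity> w \<ge> 0"
    proof (rule ccontr)
      assume "\<not> Lp_norm \<infinity> w \<ge> 0"
      then have "AE t in (lebesgue :: real measure). False"
        using ae by (auto elim!: eventually_mono)
      moreover have "ae_filter (lebesgue :: real measure) \<noteq> bot" by (simp add: ae_filter_eq_bot_iff)
      ultimately show False by (simp add: trivial_limit_def)
    qed
    have "(LINT t:{0..2 * pi}|lebesgue. \<bar>\<phi> t * w t\<bar>) \<le> (LINT t:{0..2 * pi}|lebesgue. \<bar>\<phi> t\<bar> * Lp_norm \<infinity> w)"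
    proof (rule set_integral_mono_AE)
      show "AE t in lebesgue. t \<in> {0..2 * pi} \<longrightarrow> \<bar>\<phi> t * w t\<bar> \<le> \<bar>\<phi> t\<bar> * Lp_norm \<infinity> w"
        using ae by (auto simp: abs_mult intro!: mult_left_mono elim!: eventually_mono)
      show "set_integrable lebesgue {0..2 * pi} (\<lambda>t. \<bar>\<phi> t\<bar> * Lp_norm \<infinity> w)"
        using set_integrable_abs[OF i\<phi>] by simp
    qed (intro set_integrable_abs int)
    also have "\<dots> = (LINT t:{0..2 * pi}|lebesgue. \<bar>\<phi> t\<bar>) * Lp_norm \<infinity> w" by simp
    also have "\<dots> \<le> 1 * Lp_norm \<infinity> w"
      using U(4)[of 1] one L0 by (intro mult_right_mono) (auto simp: one_ereal_def set_lebesgue_integral_def)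
    finally show ?thesis using le one by simp
  next
    case infinite
    have "(LINT t:{0..2 * pi}|lebesgue. \<bar>\<phi> t * w t\<bar>) \<le> (LINT t:{0..2 * pi}|lebesgue. \<bar>w t\<bar>)"
    proof (rule set_integral_mono_AE)
      show "AE t in lebesgue. t \<in> {0..2 * pi} \<longrightarrow> \<bar>\<phi> t * w t\<bar> \<le> \<bar>w t\<bar>"
        using U(3)[OF infinite(1)] by (auto simp: abs_mult intro!: mult_left_le_one_le elim!: eventually_mono)
    qed (intro set_integrable_abs int set_integrable_bounded_Icc[OF w])+
    then show ?thesis using le infinite by (simp add: Lp_norm_1)
  next
    case (finite r r')
    define I where "I = (LINT t:{0..2 * pi}|lebesgue. \<bar>w t\<bar> powr r')"
    have B0: "B \<ge> 0" using w(2)[of 0] by linarith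
    have iw: "set_integrable lebesgue {0..2 * pi} (\<lambda>t. \<bar>w t\<bar> powr r')"
      by (rule set_integrable_bounded_Icc[where B = "B powr r'"])
        (use w finite in \<open>auto intro!: powr_mono2 measurable_abs_powr\<close>)
    have I0: "I \<ge> 0" unfolding I_def by (intro LINT_nonneg) auto
    note i\<phi>r = U(4)[OF finite(1)]
    \<comment> \<open>Young's inequality for \<bar>\<phi>\<bar> and
      \<bar>\<open>w\<close>\<bar>/\<open>c\<close>. Taking \<open>c\<close> slightly above the norm
      of \<open>w\<close> avoids dividing by a norm that may be zero.\<close>
    have bd: "\<bar>LINT t:{0..2 * pi}|lebesgue. \<phi> t * w t\<bar> \<le> c" if c: "c > 0" "I \<le> c powr r'" for c
    proof -
      have cr: "c powr r' > 0" using c by simp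
      have pt: "\<bar>\<phi> t * w t\<bar> \<le> (c / r) * \<bar>\<phi> t\<bar> powr r + (c / r' / c powr r') * \<bar>w t\<bar> powr r'" for t
      proof -
        have "\<bar>\<phi> t\<bar> * (\<bar>w t\<bar> / c) \<le> \<bar>\<phi> t\<bar> powr r / r + (\<bar>w t\<bar> / c) powr r' / r'"
          using finite c by (intro Youngs_inequality) auto
        then have "c * (\<bar>\<phi> t\<bar> * (\<bar>w t\<bar> / c)) \<le> c * (\<bar>\<phi> t\<bar> powr r / r + (\<bar>w t\<bar> / c) powr r' / r')"
          using c by (intro mult_left_mono) auto
        then show ?thesis using c by (simp add: abs_mult powr_divide distrib_left mult_ac)
      qed
      have "(LINT t:{0..2 * pi}|lebesgue. \<bar>\<phi> t * w t\<bar>) \<le>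
        (LINT t:{0..2 * pi}|lebesgue. (c / r) * \<bar>\<phi> t\<bar> powr r + (c / r' / c powr r') * \<bar>w t\<bar> powr r')"
        using i\<phi>r iw by (intro set_integral_mono pt set_integrable_abs int set_integral_add set_integrable_mult_right) auto
      also have "\<dots> = (LINT t:{0..2 * pi}|lebesgue. (c / r) * \<bar>\<phi> t\<bar> powr r) + (LINT t:{0..2 * pi}|lebesgue. (c / r' / c powr r') * \<bar>w t\<bar> powr r')"
        using i\<phi>r iw by (intro set_integral_add set_integrable_mult_right) auto
      also have "\<dots> = (c / r) * (LINT t:{0..2 * pi}|lebesgue. \<bar>\<phi> t\<bar> powr r) + (c / r' / c powr r') * I"
        by (simp only: set_integral_mult_right I_def)
      also have "\<dots> \<le> (c / r) * 1 + (c / r' / c powr r') * c powr r'"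
        using i\<phi>r c finite by (intro add_mono mult_left_mono) auto
      also have "\<dots> = c * (1 / r + 1 / r')" using cr by (simp add: distrib_left)
      also have "\<dots> = c" using finite by simp
      finally show ?thesis using le by simp
    qed
    have "\<bar>LINT t:{0..2 * pi}|lebesgue. \<phi> t * w t\<bar> \<le> I powr (1 / r') + e" if e: "e > 0" for e
    proof (rule bd)
      show "0 < I powr (1 / r') + e" using e by (intro add_nonneg_pos) auto
      have "I = (I powr (1 / r')) powr r'" using I0 finite by (simp add: powr_powr)
      also have "\<dots> \<le> (I powr (1 / r') + e) powr r'" using e finite by (intro powr_mono2) auto
      finally show "I \<le> (I powr (1 / r') + e) powr r'" .
    qed
    then have "\<bar>LINT t:{0..2 * pi}|lebesgue. \<phi> t * w t\<bar> \<le> I powr (1 / r')" by (rule field_le_epsilon)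
    then show ?thesis using finite by (simp add: Lp_norm_finite I_def)
  qed
qed

text \<open>The bound is uniform in the exponent because (2 pi)^(1/r) \<le> 2 pi for r \<ge>
  1.\<close>

lemma Lp_norm_bounded:
  assumes w: "w \<in> borel_measurable lebesgue" "\<And>t. \<bar>w t\<bar> \<le> c" and s: "1 \<le> s"
  shows "Lp_norm s w \<le> 2 * pi * c"
proof -
  have c: "0 \<le> c" using w(2)[of 0] by linarith
  have pi1: "1 \<le> 2 * pi" using pi_gt3 by simp
  show ?thesis
  proof (cases "s = \<infinity>")
    case True
    have "1 * c \<le> 2 * pi * c" using c pi1 by (intro mult_right_mono) auto
    then show ?thesis using Lp_norm_infinity_le(1)[OF w] True by simp
  next
    case False
    then obtain r where sr: "s = ereal r" using s by (cases s) auto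
    have r: "1 \<le> r" using s sr by simp
    have "(LINT t:{0..2 * pi}|lebesgue. \<bar>w t\<bar> powr r) \<le> (LINT t:{0..2 * pi}|lebesgue. c powr r)"
    proof (rule set_integral_mono)
      show "set_integrable lebesgue {0..2 * pi} (\<lambda>t. \<bar>w t\<bar> powr r)"
        by (rule set_integrable_bounded_Icc[where B = "c powr r"])
          (use w r in \<open>auto intro!: powr_mono2 measurable_abs_powr\<close>)
      show "set_integrable lebesgue {0..2 * pi} (\<lambda>t. c powr r)" by (intro set_integrable_continuous_Icc) auto
      show "\<bar>w t\<bar> powr r \<le> c powr r" for t using w r by (intro powr_mono2) auto
    qed
    then have "(LINT t:{0..2 * pi}|lebesgue. \<bar>w t\<bar> powr r) \<le> 2 * pi * c powr r" by (simp only: LINT_const_2pi)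
    then have "(LINT t:{0..2 * pi}|lebesgue. \<bar>w t\<bar> powr r) powr (1 / r) \<le> (2 * pi * c powr r) powr (1 / r)"
      using r by (intro powr_mono2 LINT_nonneg) auto
    also have "\<dots> = (2 * pi) powr (1 / r) * c" using c r by (simp add: powr_mult powr_powr)
    also have "\<dots> \<le> (2 * pi) powr 1 * c" using c r pi1 by (intro mult_right_mono powr_mono) auto
    finally show ?thesis using sr by (simp add: Lp_norm_finite)
  qed
qed

section \<open>Step functions with a fast variable\<close>

lemma integral_mean_value:
  fixes f :: "real \<Rightarrow> real"
  assumes ab: "a < b" and f: "continuous_on {a..b} f"
  obtains c where "c \<in> {a..b}" "integral {a..b} f = (b - a) * f c"
proof -
  have "((\<lambda>x. integral {a..x} f) has_real_derivative f x) (at x within {a..b})" if "x \<in> {a..b}" for x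
    using integral_has_real_derivative[OF f that] .
  then have "\<exists>x\<in>{a<..<b}. integral {a..b} f - integral {a..a} f = (b - a) * f x"
    using ab mvt_simple[of a b "\<lambda>x. integral {a..x} f" "\<lambda>x y. y * f x"]
    by (auto simp: has_field_derivative_def mult.commute[of _ "f _"])
  then obtain c where "c \<in> {a<..<b}" "integral {a..b} f = (b - a) * f c" by auto
  then show ?thesis using that[of c] by auto
qed

text \<open>Number of the period of cos(N t) that contains \<open>t\<close>. The reduction modulo
  \<open>N\<close> makes it 2 pi-periodic; in particular it wraps to 0 at
  \<open>t = 2 * pi\<close>.\<close>

definition step_index :: "nat \<Rightarrow> real \<Rightarrow> nat" where
  "step_index N t = nat (\<lfloor>real N * t / (2 * pi)\<rfloor> mod int N)"

lemma step_index_less: "N \<ge> 1 \<Longrightarrow> step_index N t < N"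
  by (simp add: step_index_def nat_less_iff)

lemma step_index_eq:
  assumes "k < N" "2 * pi * real k / real N \<le> t" "t < 2 * pi * real (Suc k) / real N"
  shows "step_index N t = k"
proof -
  have "\<lfloor>real N * t / (2 * pi)\<rfloor> = int k"
    using assms by (intro floor_unique) (auto simp: field_simps)
  then show ?thesis using assms by (simp add: step_index_def)
qed

lemma step_index_interval:
  assumes "N \<ge> 1" "t \<in> {0..<2 * pi}"
  shows "t \<in> {2 * pi * real (step_index N t) / real N..2 * pi * real (Suc (step_index N t)) / real N}"
proof -
  define k where "k = nat \<lfloor>real N * t / (2 * pi)\<rfloor>"
  have pos: "0 \<le> real N * t / (2 * pi)" using assms by auto
  then have fl: "int k = \<lfloor>real N * t / (2 * pi)\<rfloor>" unfolding k_def by simp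
  then have k: "real k \<le> real N * t / (2 * pi)" "real N * t / (2 * pi) < real k + 1"
    using floor_correct[of "real N * t / (2 * pi)"] by linarith+
  have "real N * t / (2 * pi) < real N" using assms by (simp add: field_simps)
  then have "real k < real N" using k(1) by linarith
  then have kN: "k < N" by simp
  have 1: "2 * pi * real k / real N \<le> t" "t < 2 * pi * real (Suc k) / real N"
    using k assms by (auto simp: field_simps)
  then have "step_index N t = k" by (rule step_index_eq[OF kN])
  then show ?thesis using 1 by auto
qed

lemma step_index_periodic: 
  assumes "N \<ge> 1" shows "step_index N (t + 2 * pi) = step_index N t"
proof -
  have "real N * (t + 2 * pi) / (2 * pi) = real N * t / (2 * pi) + of_int (int N)" by (simp add: field_simps)
  then have "\<lfloor>real N * (t + 2 * pi) / (2 * pi)\<rfloor> = \<lfloor>real N * t / (2 * pi)\<rfloor> + int N"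
    by (simp only: floor_add_int)
  then show ?thesis by (simp add: step_index_def)
qed

lemma step_function_measurable:
  fixes h :: "nat \<Rightarrow> real \<Rightarrow> real"
  assumes "\<And>k. continuous_on UNIV (h k)"
  shows "(\<lambda>t. h (step_index N t) (real N * t)) \<in> borel_measurable lebesgue"
proof (rule measurable_completion)
  have "(\<lambda>t. h (nat (i mod int N)) (real N * t)) \<in> borel_measurable borel" for i
    by (intro borel_measurable_continuous_onI continuous_on_compose2[OF assms] continuous_intros) auto
  moreover have "(\<lambda>t. \<lfloor>real N * t / (2 * pi)\<rfloor>) \<in> measurable borel (count_space UNIV)"
    by measurable
  ultimately have "(\<lambda>t. h (nat (\<lfloor>real N * t / (2 * pi)\<rfloor> mod int N)) (real N * t)) \<in> borel_measurable borel"
    by (rule measurable_compose_countable)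
  then show "(\<lambda>t. h (step_index N t) (real N * t)) \<in> borel_measurable lborel"
    unfolding step_index_def by simp
qed

text \<open>The integrand depends on a slow index and on the fast variable u = N t. The map t to N t
  stretches each step onto a full period, so the integral is the average over the steps of
  full-period integrals.\<close>

lemma step_function_has_integral:
  fixes h :: "nat \<Rightarrow> real \<Rightarrow> real"
  assumes N: "N \<ge> 1" and cont: "\<And>k. continuous_on UNIV (h k)" and per: "\<And>k u. h k (u + 2 * pi) = h k u"
  shows "((\<lambda>t. h (step_index N t) (real N * t)) has_integral ((\<Sum>k<N. integral {0..2 * pi} (h k)) / real N)) {0..2 * pi}"
proof -
  let ?f = "\<lambda>t. h (step_index N t) (real N * t)"
  have "K \<le> N \<Longrightarrow> (?f has_integral ((\<Sum>k<K. integral {0..2 * pi} (h k)) / real N)) {0..2 * pi * real K / real N}" for K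
  proof (induction K)
    case (Suc K)
    let ?a = "2 * pi * real K / real N" and ?b = "2 * pi * real (Suc K) / real N"
    have ab: "0 \<le> ?a" "?a \<le> ?b" by (auto simp: divide_right_mono)
    have Na: "real N * ?a = 2 * pi * real K" and Nb: "real N * ?b = 2 * pi * real K + 2 * pi"
      using N by (auto simp: field_simps)
    have "((\<lambda>t. real N *\<^sub>R h K (real N * t)) has_integral integral {real N * ?a..real N * ?b} (h K)) {?a..?b}"
      by (rule has_integral_substitution[where c = "real N * ?a" and d = "real N * ?b"])
        (use ab N in \<open>auto intro!: derivative_eq_intros mult_left_mono continuous_on_subset[OF cont] simp del: of_nat_Suc\<close>)
    moreover have "integral {real N * ?a..real N * ?b} (h K) = integral {0..2 * pi} (h K)"
      unfolding Na Nb by (rule integral_periodic_shift[OF per cont]) simp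
    ultimately have "((\<lambda>t. (1 / real N) * (real N *\<^sub>R h K (real N * t))) has_integral (1 / real N) * integral {0..2 * pi} (h K)) {?a..?b}"
      by (intro has_integral_mult_right) simp
    then have "((\<lambda>t. h K (real N * t)) has_integral (integral {0..2 * pi} (h K) / real N)) {?a..?b}"
      using N by simp
    \<comment> \<open>At the right endpoint the index has already jumped; a single point does not
      affect the integral.\<close>
    then have "(?f has_integral (integral {0..2 * pi} (h K) / real N)) {?a..?b}"
    proof (rule has_integral_spike_finite[rotated 2])
      show "?f t = h K (real N * t)" if "t \<in> {?a..?b} - {?b}" for t
        using step_index_eq[of K N t] that Suc.prems by auto
    qed simp
    from has_integral_combine[OF ab Suc.IH this] Suc.prems show ?case
      by (simp add: add_divide_distrib del: of_nat_Suc)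
  next
    case 0
    show ?case using has_integral_refl(2)[of ?f 0] by simp
  qed
  from this[of N] show ?thesis using N by simp
qed

lemma step_function_LINT:
  fixes h :: "nat \<Rightarrow> real \<Rightarrow> real"
  assumes N: "N \<ge> 1" and cont: "\<And>k. continuous_on UNIV (h k)" and per: "\<And>k u. h k (u + 2 * pi) = h k u"
    and bd: "\<And>k u. k < N \<Longrightarrow> \<bar>h k u\<bar> \<le> B"
  shows "set_integrable lebesgue {0..2 * pi} (\<lambda>t. h (step_index N t) (real N * t))"
    and "(LINT t:{0..2 * pi}|lebesgue. h (step_index N t) (real N * t)) = (\<Sum>k<N. integral {0..2 * pi} (h k)) / real N"
proof -
  show i: "set_integrable lebesgue {0..2 * pi} (\<lambda>t. h (step_index N t) (real N * t))"
    by (intro set_integrable_bounded_Icc[where B = B] step_function_measurable cont bd step_index_less N)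
  show "(LINT t:{0..2 * pi}|lebesgue. h (step_index N t) (real N * t)) = (\<Sum>k<N. integral {0..2 * pi} (h k)) / real N"
    using set_lebesgue_integral_eq_integral(2)[OF i] step_function_has_integral[of N h, OF N cont per]
    by (simp add: integral_unique)
qed

lemma step_function_periodic:
  assumes "N \<ge> 1" "\<And>k u. h k (u + 2 * pi) = h k u"
  shows "periodic_2pi (\<lambda>t. h (step_index N t) (real N * t))"
proof -
  have "h k (real N * (t + 2 * pi)) = h k (real N * t)" for k t
    using periodic_shift_int[of "h k" "2 * pi" "real N * t" "int N", OF assms(2)]
    by (simp add: algebra_simps)
  then show ?thesis by (simp add: periodic_2pi_def step_index_periodic[OF assms(1)])
qed

lemma integral_antiperiodic:
  fixes f :: "real \<Rightarrow> real"
  assumes "continuous_on UNIV f" "\<And>u. f (u + pi) = - f u"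
  shows "integral {0..2 * pi} f = 0"
proof -
  have "f (u + 2 * pi) = f u" for u using assms(2)[of "u + pi"] assms(2)[of u] by (simp add: add.assoc)
  from integral_periodic_reflect(1)[OF this assms(1), of pi]
  have "integral {0..2 * pi} (\<lambda>u. - f u) = integral {0..2 * pi} f" by (simp add: add.commute assms(2))
  then show ?thesis by simp
qed

lemma Re_cis_mult: "Re (cis u * w) = cmod w * cos (u + Arg w)"
proof -
  have "cis u * w = of_real (cmod w) * (cis u * cis (Arg w))"
    using rcis_cmod_Arg[of w] by (simp add: rcis_def)
  then have "cis u * w = of_real (cmod w) * cis (u + Arg w)" by (simp only: cis_mult)
  then show ?thesis by simp
qed

text \<open>Over a full period the argument of \<open>w\<close> is a mere translation, so a complex
  amplitude enters only through its modulus. This is what makes the norm of a modulated step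
  function factor exactly.\<close>

lemma integral_abs_Re_cis:
  assumes r: "r > 0"
  shows "integral {0..2 * pi} (\<lambda>u. \<bar>Re (cis (u + \<theta>) * w)\<bar> powr r) = cmod w powr r * integral {0..2 * pi} (\<lambda>u. \<bar>cos u\<bar> powr r)"
proof -
  have c: "continuous_on UNIV (\<lambda>u. \<bar>cos u\<bar> powr r)"
    using r by (intro continuous_on_powr' continuous_intros) auto
  have "\<bar>Re (cis (u + \<theta>) * w)\<bar> powr r = cmod w powr r * \<bar>cos ((\<theta> + Arg w) + u)\<bar> powr r" for u
    unfolding Re_cis_mult by (simp add: abs_mult powr_mult add_ac)
  then have "integral {0..2 * pi} (\<lambda>u. \<bar>Re (cis (u + \<theta>) * w)\<bar> powr r) =
    cmod w powr r * integral {0..2 * pi} (\<lambda>u. \<bar>cos ((\<theta> + Arg w) + u)\<bar> powr r)" by simp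
  also have "integral {0..2 * pi} (\<lambda>u. \<bar>cos ((\<theta> + Arg w) + u)\<bar> powr r) = integral {0..2 * pi} (\<lambda>u. \<bar>cos u\<bar> powr r)"
    by (rule integral_periodic_reflect(1)[OF _ c]) simp
  finally show ?thesis .
qed

text \<open>If the essential supremum were below the maximum, the set where the function exceeds it
  would be open, nonempty and null.\<close>

lemma Lp_norm_infinity_continuous:
  fixes u :: "real \<Rightarrow> real"
  assumes cont: "continuous_on UNIV u" and max: "\<And>t. \<bar>u t\<bar> \<le> \<bar>u t0\<bar>"
  shows "Lp_norm \<infinity> u = \<bar>u t0\<bar>"
proof (rule antisym)
  have m: "u \<in> borel_measurable lebesgue" by (rule borel_measurable_lebesgue_continuous[OF cont])
  show "Lp_norm \<infinity> u \<le> \<bar>u t0\<bar>" by (rule Lp_norm_infinity_le(1)[OF m max])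
  show "\<bar>u t0\<bar> \<le> Lp_norm \<infinity> u"
  proof (rule ccontr)
    assume less: "\<not> \<bar>u t0\<bar> \<le> Lp_norm \<infinity> u"
    define S where "S = {t. \<bar>u t\<bar> > Lp_norm \<infinity> u}"
    have ae: "AE t in lebesgue. \<bar>u t\<bar> \<le> Lp_norm \<infinity> u"
      using esssup_abs_le[OF m Lp_norm_infinity_le(2)[OF m max]] by (simp add: Lp_norm_def)
    have S: "open S" unfolding S_def
      using cont by (intro open_Collect_less continuous_intros)
    then have "S \<in> sets lebesgue" by (intro sets_completionI_sets) simp
    then have "S \<in> null_sets lebesgue"
      using ae by (intro AE_iff_null_sets[THEN iffD2]) (auto simp: S_def not_less elim!: eventually_mono)
    then have "negligible S" by (simp add: negligible_iff_null_sets)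
    moreover have "t0 \<in> S" using less by (simp add: S_def)
    ultimately show False using open_not_negligible[OF S] by blast
  qed
qed

lemma Lp_norm_infinity_cos: "Lp_norm \<infinity> cos = 1"
  using Lp_norm_infinity_continuous[of cos 0] by (simp add: continuous_intros)

lemma partition_integral:
  fixes f :: "real \<Rightarrow> real"
  assumes N: "N \<ge> 1" and f: "continuous_on UNIV f"
  shows "(\<Sum>k<N. integral {2 * pi * real k / real N..2 * pi * real (Suc k) / real N} f) = integral {0..2 * pi} f"
proof -
  have i: "f integrable_on {a..b}" for a b by (intro integrable_continuous_real continuous_on_subset[OF f]) auto
  have "(\<Sum>k<K. integral {2 * pi * real k / real N..2 * pi * real (Suc k) / real N} f) = integral {0..2 * pi * real K / real N} f" for K
  proof (induction K)
    case (Suc K)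
    have "integral {0..2 * pi * real K / real N} f + integral {2 * pi * real K / real N..2 * pi * real (Suc K) / real N} f =
      integral {0..2 * pi * real (Suc K) / real N} f"
      by (intro Henstock_Kurzweil_Integration.integral_combine i) (auto simp: divide_right_mono)
    then show ?case using Suc by simp
  qed simp
  from this[of N] show ?thesis using N by simp
qed

lemma real_of_ereal_one_divide: "0 < r \<Longrightarrow> real_of_ereal (1 / ereal r) = 1 / r"
  unfolding one_ereal_def ereal_divide by simp

lemma periodic_attains_sup:
  fixes u :: "real \<Rightarrow> real"
  assumes cont: "continuous_on UNIV u" and per: "\<And>t. u (t + 2 * pi) = u t"
  obtains t0 where "t0 \<in> {0..<2 * pi}" "\<And>t. u t \<le> u t0"
proof -
  have red: "\<exists>t'\<in>{0..<2 * pi}. u t' = u t" for t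
  proof -
    obtain k :: int where "t + of_int k * (2 * pi) \<in> {0..<2 * pi}" by (rule periodic_representative)
    then show ?thesis using periodic_shift_int[of u "2 * pi" t k, OF per] by blast
  qed
  have "\<exists>x\<in>{0..2 * pi}. \<forall>y\<in>{0..2 * pi}. u y \<le> u x"
    by (intro continuous_attains_sup continuous_on_subset[OF cont]) auto
  then obtain x where x: "\<And>y. y \<in> {0..2 * pi} \<Longrightarrow> u y \<le> u x" by blast
  obtain t0 where t0: "t0 \<in> {0..<2 * pi}" "u t0 = u x" using red by blast
  have "u t \<le> u t0" for t
  proof -
    obtain t' where "t' \<in> {0..<2 * pi}" "u t' = u t" using red by blast
    then show ?thesis using x[of t'] t0 by auto
  qed
  then show ?thesis using t0 that by blast
qed

text \<open>Common membership test for the three kinds of extremal functions below. Antiperiodicity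
  in the fast variable annihilates the integral over every single step.\<close>

lemma step_function_in_U0:
  fixes h :: "nat \<Rightarrow> real \<Rightarrow> real"
  assumes N: "N \<ge> 1" and cont: "\<And>k. continuous_on UNIV (h k)" and anti: "\<And>k u. h k (u + pi) = - h k u"
    and bd: "\<And>k u. k < N \<Longrightarrow> \<bar>h k u\<bar> \<le> B"
    and s: "1 \<le> s"
    and norm: "s = \<infinity> \<Longrightarrow> B \<le> 1"
      "\<And>r. s = ereal r \<Longrightarrow> (LINT t:{0..2 * pi}|lebesgue. \<bar>h (step_index N t) (real N * t)\<bar> powr r) \<le> 1"
  shows "(\<lambda>t. h (step_index N t) (real N * t)) \<in> U0 s"
proof -
  let ?f = "\<lambda>t. h (step_index N t) (real N * t)"
  have per: "h k (u + 2 * pi) = h k u" for k u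
    using anti[of k "u + pi"] anti[of k u] by (simp add: add.assoc)
  have m: "?f \<in> borel_measurable lebesgue" by (rule step_function_measurable[OF cont])
  have fb: "\<bar>?f t\<bar> \<le> B" for t by (rule bd[OF step_index_less[OF N]])
  have mean: "(LINT t:{0..2 * pi}|lebesgue. ?f t) = 0"
    by (subst step_function_LINT(2)[of N h B, OF N cont per bd]) (auto simp: integral_antiperiodic[OF cont anti])
  have fper: "periodic_2pi ?f" by (rule step_function_periodic[of N h, OF N per])
  show ?thesis
  proof (cases "s = \<infinity>")
    case True
    have "Lp_norm \<infinity> ?f \<le> 1" "esssup lebesgue (\<lambda>t. ereal \<bar>?f t\<bar>) < \<infinity>"
      using Lp_norm_infinity_le[OF m fb] norm(1)[OF True] by auto
    then show ?thesis using True m mean fper by (simp add: U0_def Lp_space_def)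
  next
    case False
    then obtain r where sr: "s = ereal r" using s by (cases s) auto
    have r: "1 \<le> r" using s sr by simp
    have "set_integrable lebesgue {0..2 * pi} (\<lambda>t. \<bar>?f t\<bar> powr r)"
      using r fb by (intro set_integrable_bounded_Icc[where B = "B powr r"] measurable_abs_powr m) (auto intro!: powr_mono2)
    moreover have "Lp_norm s ?f \<le> 1"
    proof -
      have "(LINT t:{0..2 * pi}|lebesgue. \<bar>?f t\<bar> powr r) powr (1 / r) \<le> 1 powr (1 / r)"
        using r norm(2)[OF sr] by (intro powr_mono2 LINT_nonneg) auto
      then show ?thesis by (simp add: sr Lp_norm_finite)
    qed
    ultimately show ?thesis using sr m mean fper by (simp add: U0_def Lp_space_def)
  qed
qed

lemma Re_cis_antiperiodic: "Re (cis (u + pi + \<theta>) * w) = - Re (cis (u + \<theta>) * w)"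
proof -
  have "u + pi + \<theta> + Arg w = (u + \<theta> + Arg w) + pi" by simp
  then show ?thesis unfolding Re_cis_mult by (simp only: cos_periodic_pi)
qed

lemma Re_cis_periodic: "Re (cis (u + 2 * pi + \<theta>) * w) = Re (cis (u + \<theta>) * w)"
  using Re_cis_antiperiodic[of "u + pi" \<theta> w] Re_cis_antiperiodic[of u \<theta> w] by (simp add: add.assoc)

section \<open>Extremal functions for modulated step functions\<close>

text \<open>The points \<open>T k\<close> are mean value points of \<bar>\<open>G\<close>\<bar>^r,
  so the average of this power over the \<open>T k\<close> is exactly its integral mean. They depend
  on \<open>r\<close>, which is harmless: the later error estimate uses only that \<open>T k\<close>
  lies in its step.\<close>

lemma step_norm_finite:
  fixes G :: "real \<Rightarrow> complex"
  assumes r: "r \<ge> 1" and N: "N \<ge> 1" and G: "continuous_on UNIV G" and GB: "\<And>t. cmod (G t) \<le> B"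
  obtains T where "\<And>k. k < N \<Longrightarrow> T k \<in> {2 * pi * real k / real N..2 * pi * real (Suc k) / real N}"
    "Lp_norm (ereal r) (\<lambda>t. Re (cis (real N * t + \<theta>) * G (T (step_index N t)))) =
       Lp_norm (ereal r) cos / (2 * pi) powr (1 / r) * Lp_norm (ereal r) (\<lambda>t. cmod (G t))"
proof -
  let ?a = "\<lambda>k::nat. 2 * pi * real k / real N" and ?g = "\<lambda>t. cmod (G t) powr r"
  have gc: "continuous_on S ?g" for S
    using r by (intro continuous_on_powr' continuous_intros continuous_on_subset[OF G]) auto
  have cc: "continuous_on S (\<lambda>u. \<bar>cos u\<bar> powr r)" for S
    using r by (intro continuous_on_powr' continuous_intros) auto
  have "\<exists>c\<in>{?a k..?a (Suc k)}. integral {?a k..?a (Suc k)} ?g = (?a (Suc k) - ?a k) * ?g c" for k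
  proof -
    have "?a k < ?a (Suc k)" using N by (simp add: divide_strict_right_mono)
    from integral_mean_value[OF this gc] show ?thesis by metis
  qed
  then obtain T where T: "\<And>k. T k \<in> {?a k..?a (Suc k)}"
      "\<And>k. integral {?a k..?a (Suc k)} ?g = (?a (Suc k) - ?a k) * ?g (T k)" by metis
  define C where "C = integral {0..2 * pi} (\<lambda>u. \<bar>cos u\<bar> powr r)"
  define I where "I = integral {0..2 * pi} ?g"
  have len: "?a (Suc k) - ?a k = 2 * pi / real N" for k by (simp add: algebra_simps add_divide_distrib)
  have "(\<Sum>k<N. (2 * pi / real N) * ?g (T k)) = I"
    using partition_integral[OF N gc] unfolding T(2) len I_def by simp
  then have "(2 * pi / real N) * (\<Sum>k<N. ?g (T k)) = I" by (simp only: sum_distrib_left)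
  then have S: "(\<Sum>k<N. ?g (T k)) / real N = I / (2 * pi)"
    using N by (simp add: field_simps)
  let ?h = "\<lambda>k u. \<bar>Re (cis (u + \<theta>) * G (T k))\<bar> powr r"
  have B: "0 \<le> B" using GB[of 0] norm_ge_zero[of "G 0"] by linarith
  have "(LINT t:{0..2 * pi}|lebesgue. \<bar>Re (cis (real N * t + \<theta>) * G (T (step_index N t)))\<bar> powr r) =
      (\<Sum>k<N. integral {0..2 * pi} (?h k)) / real N"
  proof (rule step_function_LINT(2)[of N ?h, where B = "B powr r"])
    show "continuous_on UNIV (?h k)" for k
      using r by (intro continuous_on_powr' continuous_intros) auto
    show "?h k (u + 2 * pi) = ?h k u" for k u
      by (simp only: Re_cis_periodic)
    show "\<bar>?h k u\<bar> \<le> B powr r" for k u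
    proof -
      have "\<bar>Re (cis (u + \<theta>) * G (T k))\<bar> \<le> cmod (cis (u + \<theta>) * G (T k))" by (rule abs_Re_le_cmod)
      also have "\<dots> \<le> B" using GB by (simp add: norm_mult)
      finally show ?thesis using r by (auto intro!: powr_mono2)
    qed
  qed (rule N)
  also have "\<dots> = (\<Sum>k<N. ?g (T k) * C) / real N"
    using r by (subst integral_abs_Re_cis) (auto simp: C_def)
  also have "\<dots> = C * (I / (2 * pi))"
    unfolding S[symmetric] by (simp add: sum_distrib_left mult.commute)
  finally have L: "(LINT t:{0..2 * pi}|lebesgue. \<bar>Re (cis (real N * t + \<theta>) * G (T (step_index N t)))\<bar> powr r) = C * (I / (2 * pi))" .
  have C0: "C \<ge> 0" unfolding C_def
    by (intro Henstock_Kurzweil_Integration.integral_nonneg integrable_continuous_real cc) simp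
  have I0: "I \<ge> 0" unfolding I_def
    by (intro Henstock_Kurzweil_Integration.integral_nonneg integrable_continuous_real gc) simp
  have "Lp_norm (ereal r) cos = C powr (1 / r)"
    unfolding Lp_norm_finite C_def by (subst set_integrable_continuous_Icc(2)[OF cc]) simp
  moreover have "Lp_norm (ereal r) (\<lambda>t. cmod (G t)) = I powr (1 / r)"
    unfolding Lp_norm_finite I_def by (simp add: set_integrable_continuous_Icc(2)[OF gc])
  ultimately have "Lp_norm (ereal r) (\<lambda>t. Re (cis (real N * t + \<theta>) * G (T (step_index N t)))) =
       Lp_norm (ereal r) cos / (2 * pi) powr (1 / r) * Lp_norm (ereal r) (\<lambda>t. cmod (G t))"
    unfolding Lp_norm_finite L using C0 I0 by (simp add: powr_mult powr_divide)
  then show ?thesis using that[of T] T(1) by blast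
qed

text \<open>The sign is discontinuous at 0, so the function is split into the powers of its positive
  and negative parts.\<close>

lemma continuous_on_signed_powr:
  assumes "a > 0"
  shows "continuous_on S (\<lambda>x::real. sgn x * \<bar>x\<bar> powr a)"
proof -
  have eq: "(\<lambda>x::real. sgn x * \<bar>x\<bar> powr a) = (\<lambda>x. (max 0 x) powr a - (max 0 (- x)) powr a)"
    using assms by (auto simp: fun_eq_iff sgn_if)
  show ?thesis unfolding eq
    using assms by (intro continuous_on_diff continuous_on_powr' continuous_intros) auto
qed

text \<open>Step functions must be continuous in the fast variable here. The Hoelder extremal is so
  for 1 < s < \<infinity>; for s = \<infinity> a sign function has to be smoothed, and for s = 1
  mass has to be concentrated near a maximum. Hence the lower bound carries an \<epsilon>.\<close>

lemma step_extremal: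
  fixes G :: "real \<Rightarrow> complex"
  assumes s: "1 \<le> s" and N: "N \<ge> 1" and G: "continuous_on UNIV G" and per: "\<And>t. G (t + 2 * pi) = G t"
  defines "s' \<equiv> conj_exponent s"
  defines "L \<equiv> Lp_norm s' cos / (2 * pi) powr real_of_ereal (1 / s') * Lp_norm s' (\<lambda>t. cmod (G t))"
  obtains T where "\<And>k. k < N \<Longrightarrow> T k \<in> {2 * pi * real k / real N..2 * pi * real (Suc k) / real N}"
    "Lp_norm s' (\<lambda>t. Re (cis (real N * t + \<theta>) * G (T (step_index N t)))) \<le> L"
    "\<And>\<epsilon>. \<epsilon> > 0 \<Longrightarrow> \<exists>\<phi>\<in>U0 s. (LINT t:{0..2 * pi}|lebesgue. \<phi> t * Re (cis (real N * t + \<theta>) * G (T (step_index N t)))) \<ge> L - \<epsilon>"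
proof -
  have cG: "continuous_on UNIV (\<lambda>t. cmod (G t))" by (intro continuous_on_norm G)
  obtain t0 where t0: "t0 \<in> {0..<2 * pi}" "\<And>t. cmod (G t) \<le> cmod (G t0)"
    by (rule periodic_attains_sup[OF cG]) (auto simp: per)
  define B where "B = cmod (G t0)"
  have GB: "cmod (G t) \<le> B" for t using t0 by (simp add: B_def)
  have B: "B \<ge> 0" by (simp add: B_def)
  define hW :: "(nat \<Rightarrow> real) \<Rightarrow> nat \<Rightarrow> real \<Rightarrow> real" where "hW = (\<lambda>T k u. Re (cis (u + \<theta>) * G (T k)))"
  have hc[continuous_intros]: "continuous_on S (hW T k)" for S T k
    unfolding hW_def by (intro continuous_intros)
  have ha: "hW T k (u + pi) = - hW T k u" for T k u
    unfolding hW_def by (rule Re_cis_antiperiodic)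
  have hp: "hW T k (u + 2 * pi) = hW T k u" for T k u
    unfolding hW_def by (rule Re_cis_periodic)
  have hb: "\<bar>hW T k u\<bar> \<le> B" for T k u
  proof -
    have "\<bar>hW T k u\<bar> \<le> cmod (cis (u + \<theta>) * G (T k))" unfolding hW_def by (rule abs_Re_le_cmod)
    also have "\<dots> \<le> B" using GB by (simp add: norm_mult)
    finally show ?thesis .
  qed
  let ?W = "\<lambda>T t. hW T (step_index N t) (real N * t)"
  have Wm: "?W T \<in> borel_measurable lebesgue" for T by (rule step_function_measurable) (intro continuous_intros)
  have W: "Re (cis (real N * t + \<theta>) * G (T (step_index N t))) = ?W T t" for T t by (simp add: hW_def)
  show ?thesis
    using s
  proof (cases rule: conj_exponent_cases)
    case infinite
    have s1: "s' = ereal 1" using infinite by (simp add: s'_def one_ereal_def)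
    obtain T where T: "\<And>k. k < N \<Longrightarrow> T k \<in> {2 * pi * real k / real N..2 * pi * real (Suc k) / real N}"
      "Lp_norm (ereal 1) (?W T) = Lp_norm (ereal 1) cos / (2 * pi) powr (1 / 1) * Lp_norm (ereal 1) (\<lambda>t. cmod (G t))"
      using step_norm_finite[OF order_refl N G GB, of \<theta>] unfolding W by blast
    have LT: "Lp_norm s' (?W T) = L" unfolding L_def s1 T(2) by (subst real_of_ereal_one_divide) auto
    have "\<exists>\<phi>\<in>U0 s. (LINT t:{0..2 * pi}|lebesgue. \<phi> t * ?W T t) \<ge> L - \<epsilon>" if e: "\<epsilon> > 0" for \<epsilon>
    proof
      \<comment> \<open>The sign is replaced by a clipped line of slope 1/\<open>d\<close>. This
        loses at most \<open>d\<close> pointwise, hence at most \<epsilon> over the period, and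
        oddness keeps the antiperiodicity.\<close>
      define d where "d = \<epsilon> / (2 * pi)"
      have d: "d > 0" using e by (simp add: d_def)
      let ?h = "\<lambda>k u. max (-1) (min 1 (hW T k u / d))"
      let ?\<phi> = "\<lambda>t. ?h (step_index N t) (real N * t)"
      show U: "?\<phi> \<in> U0 s"
        by (rule step_function_in_U0[of N ?h 1, OF N])
          (use s infinite d in \<open>auto intro!: continuous_intros simp: ha\<close>)
      have "L - \<epsilon> = (LINT t:{0..2 * pi}|lebesgue. \<bar>?W T t\<bar>) - (LINT t:{0..2 * pi}|lebesgue. d)"
        unfolding LT[symmetric] s1 LINT_const_2pi by (simp add: d_def Lp_norm_1 flip: one_ereal_def)
      also have "\<dots> = (LINT t:{0..2 * pi}|lebesgue. \<bar>?W T t\<bar> - d)"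
        by (rule set_integral_diff(2)[symmetric])
          (intro set_integrable_abs set_integrable_bounded_Icc[OF Wm hb], intro set_integrable_continuous_Icc continuous_intros)
      also have "\<dots> \<le> (LINT t:{0..2 * pi}|lebesgue. ?\<phi> t * ?W T t)"
      proof (rule set_integral_mono)
        show "set_integrable lebesgue {0..2 * pi} (\<lambda>t. ?\<phi> t * ?W T t)"
          by (rule Holder_U0(1)[OF U s Wm hb])
        show "set_integrable lebesgue {0..2 * pi} (\<lambda>t. \<bar>?W T t\<bar> - d)"
          by (rule set_integral_diff(1))
            (intro set_integrable_abs set_integrable_bounded_Icc[OF Wm hb], intro set_integrable_continuous_Icc continuous_intros)
        have "\<bar>x\<bar> - d \<le> max (-1) (min 1 (x / d)) * x" for x
        proof (cases "\<bar>x\<bar> \<le> d")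
          case True
          then have "max (-1) (min 1 (x / d)) = x / d" using d by (auto simp: field_simps abs_le_iff)
          then have "max (-1) (min 1 (x / d)) * x = x * x / d" by simp
          also have "\<dots> \<ge> 0" using d by (intro divide_nonneg_pos) auto
          finally show ?thesis using True by linarith
        next
          case False
          then have "max (-1) (min 1 (x / d)) = sgn x" using d by (auto simp: field_simps sgn_if abs_if split: if_splits)
          then show ?thesis using d by (simp add: abs_sgn mult.commute)
        qed
        then show "\<bar>?W T t\<bar> - d \<le> ?\<phi> t * ?W T t" for t .
      qed
      finally show "L - \<epsilon> \<le> (LINT t:{0..2 * pi}|lebesgue. ?\<phi> t * ?W T t)" .
    qed
    then show ?thesis using that[of T] T(1) LT unfolding W by auto
  next
    case (finite \<rho> r)
    have sr: "s' = ereal r" using finite by (simp add: s'_def)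
    have r1: "1 \<le> r" using finite by simp
    obtain T where T: "\<And>k. k < N \<Longrightarrow> T k \<in> {2 * pi * real k / real N..2 * pi * real (Suc k) / real N}"
      "Lp_norm (ereal r) (?W T) = Lp_norm (ereal r) cos / (2 * pi) powr (1 / r) * Lp_norm (ereal r) (\<lambda>t. cmod (G t))"
      using step_norm_finite[OF r1 N G GB, of \<theta>] unfolding W by blast
    have LT: "Lp_norm s' (?W T) = L" unfolding L_def sr T(2) using r1 by (subst real_of_ereal_one_divide) auto
    define I where "I = (LINT t:{0..2 * pi}|lebesgue. \<bar>?W T t\<bar> powr r)"
    have I0: "I \<ge> 0" unfolding I_def by (intro LINT_nonneg) auto
    have LI: "L = I powr (1 / r)" unfolding LT[symmetric] sr Lp_norm_finite I_def ..
    have "\<exists>\<phi>\<in>U0 s. (LINT t:{0..2 * pi}|lebesgue. \<phi> t * ?W T t) \<ge> L"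
    proof (cases "I = 0")
      case True
      have "(\<lambda>t. (\<lambda>k u. 0 :: real) (step_index N t) (real N * t)) \<in> U0 s"
        by (rule step_function_in_U0[of N "\<lambda>k u. 0" 0]) (use N s in \<open>auto simp: LINT_const_2pi\<close>)
      then show ?thesis using True LI by (intro bexI[of _ "\<lambda>t. 0"]) auto
    next
      case False
      with I0 have I: "I > 0" by simp
      \<comment> \<open>Normalises the equality case sgn(W) \<bar>W\<bar>^(r-1) of Hoelder's
        inequality, whose power \<rho> is \<bar>W\<bar>^r because (r-1) \<rho> = r.\<close>
      define c where "c = I powr (1 / \<rho>)"
      have c: "c > 0" using I by (simp add: c_def)
      have c\<rho>: "c powr \<rho> = I" using I finite by (simp add: c_def powr_powr)
      let ?h = "\<lambda>k u. sgn (hW T k u) * \<bar>hW T k u\<bar> powr (r - 1) / c"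
      let ?\<phi> = "\<lambda>t. ?h (step_index N t) (real N * t)"
      have ab: "\<bar>sgn x * \<bar>x\<bar> powr (r - 1) / c\<bar> = \<bar>x\<bar> powr (r - 1) / c" for x
        using c by (simp add: abs_mult sgn_if)
      show ?thesis
      proof
        show U: "?\<phi> \<in> U0 s"
        proof (rule step_function_in_U0[of N ?h "B powr (r - 1) / c", OF N _ _ _ s])
          show "continuous_on UNIV (?h k)" for k
            by (intro continuous_on_divide continuous_on_compose2[OF continuous_on_signed_powr[of _ UNIV] hc] continuous_intros)
              (use finite c in auto)
          show "?h k (u + pi) = - ?h k u" for k u by (simp add: ha sgn_if)
          show "\<bar>?h k u\<bar> \<le> B powr (r - 1) / c" for k u
            unfolding ab using hb c finite by (intro divide_right_mono powr_mono2) auto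
          show "s = \<infinity> \<Longrightarrow> B powr (r - 1) / c \<le> 1" using finite by simp
          show "(LINT t:{0..2 * pi}|lebesgue. \<bar>?h (step_index N t) (real N * t)\<bar> powr a) \<le> 1" if "s = ereal a" for a
          proof -
            have a: "a = \<rho>" using that finite by simp
            have "(\<bar>x\<bar> powr (r - 1) / c) powr \<rho> = \<bar>x\<bar> powr r / I" for x
              using c c\<rho> finite by (simp add: powr_divide powr_powr)
            then show ?thesis unfolding a ab using I by (simp add: I_def)
          qed
        qed
        have eq: "sgn x * \<bar>x\<bar> powr (r - 1) / c * x = \<bar>x\<bar> powr r / c" for x
        proof -
          have "sgn x * \<bar>x\<bar> powr (r - 1) * x = \<bar>x\<bar> * \<bar>x\<bar> powr (r - 1)"
            by (simp add: abs_sgn mult_ac)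
          also have "\<dots> = \<bar>x\<bar> powr r" by (cases "x = 0") (auto simp: powr_mult_base)
          finally show ?thesis by simp
        qed
        have "(LINT t:{0..2 * pi}|lebesgue. ?\<phi> t * ?W T t) = I / c" unfolding eq by (simp add: I_def)
        also have "\<dots> = I powr (1 - 1 / \<rho>)" using I by (simp add: c_def powr_diff)
        also have "1 - 1 / \<rho> = 1 / r" using finite by simp
        finally show "L \<le> (LINT t:{0..2 * pi}|lebesgue. ?\<phi> t * ?W T t)" using LI by simp
      qed
    qed
    then have "\<exists>\<phi>\<in>U0 s. (LINT t:{0..2 * pi}|lebesgue. \<phi> t * ?W T t) \<ge> L - \<epsilon>" if "\<epsilon> > 0" for \<epsilon>
      using that by force
    then show ?thesis using that[of T] T(1) LT unfolding W by auto
  next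
    case one
    have s1: "s' = \<infinity>" using one by (simp add: s'_def)
    define k0 where "k0 = step_index N t0"
    \<comment> \<open>Only the step containing a maximum point of \<bar>\<open>G\<close>\<bar>
      matters for the supremum norm, and there the maximum point itself is taken.\<close>
    define T where "T = (\<lambda>k. if k = k0 then t0 else 2 * pi * real k / real N)"
    have T: "T k \<in> {2 * pi * real k / real N..2 * pi * real (Suc k) / real N}" if "k < N" for k
      using step_index_interval[OF N t0(1)] by (auto simp: T_def k0_def divide_right_mono)
    have k0N: "k0 < N" unfolding k0_def by (rule step_index_less[OF N])
    have "Lp_norm \<infinity> (\<lambda>t. cmod (G t)) = B"
      using Lp_norm_infinity_continuous[of "\<lambda>t. cmod (G t)" t0] G GB
      by (simp add: B_def continuous_on_norm)
    then have L: "L = B" by (simp add: L_def s1 Lp_norm_infinity_cos)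
    have "\<exists>\<phi>\<in>U0 s. (LINT t:{0..2 * pi}|lebesgue. \<phi> t * ?W T t) \<ge> L - \<epsilon>" if e: "\<epsilon> > 0" for \<epsilon>
    proof -
      \<comment> \<open>The 1/2 keeps the threshold \<open>1 - d\<close> positive; the other bound
        gives \<open>B * d\<close> \<le> \<epsilon>, and \<open>B + 1\<close> allows
        \<open>B = 0\<close>.\<close>
      define d where "d = min (1 / 2) (\<epsilon> / (B + 1))"
      have "d > 0" unfolding d_def using e B by simp
      moreover have "d \<le> 1 / 2" "d \<le> \<epsilon> / (B + 1)"
        unfolding d_def by (rule min.cobounded1, rule min.cobounded2)
      ultimately have d: "d > 0" "d \<le> 1 / 2" "d \<le> \<epsilon> / (B + 1)" by auto
      have "B * d \<le> (B + 1) * (\<epsilon> / (B + 1))" using d B e by (intro mult_mono) auto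
      then have Bd: "B * d \<le> \<epsilon>" using B by simp
      define a where "a = \<theta> + Arg (G t0)"
      \<comment> \<open>Soft thresholding at level \<open>1 - d\<close>: applied to the cosine it
        vanishes except where the cosine has modulus above \<open>1 - d\<close>, so it imitates
        point masses at the peaks. It is continuous and odd, and the phase \<open>a\<close> aligns
        it with the modulated kernel on the step \<open>k0\<close>.\<close>
      define soft where "soft = (\<lambda>x::real. x - max (- (1 - d)) (min (1 - d) x))"
      have sc[continuous_intros]: "continuous_on S (\<lambda>u. soft (g u))" if "continuous_on S g" for S and g :: "real \<Rightarrow> real"
        unfolding soft_def by (intro continuous_intros that)
      have sodd: "soft (- x) = - soft x" for x using d by (auto simp: soft_def)
      have sx: "(1 - d) * \<bar>soft x\<bar> \<le> x * soft x" for x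
      proof -
        consider "x > 1 - d" | "x < - (1 - d)" | "\<bar>x\<bar> \<le> 1 - d" by linarith
        then show ?thesis
        proof cases
          case 1
          then have "\<bar>soft x\<bar> = soft x" using d by (auto simp: soft_def)
          then show ?thesis using 1 by (simp add: mult_right_mono)
        next
          case 2
          then have neg: "soft x < 0" using d by (auto simp: soft_def)
          have "- (1 - d) * soft x \<le> x * soft x" using 2 neg by (intro mult_right_mono_neg) auto
          then show ?thesis unfolding abs_of_neg[OF neg] minus_mult_commute .
        next
          case 3
          then have "soft x = 0" by (auto simp: soft_def)
          then show ?thesis by simp
        qed
      qed
      have sb: "\<bar>soft (cos u)\<bar> \<le> 1" for u
      proof -
        have "\<bar>soft x\<bar> \<le> 1" if "-1 \<le> x" "x \<le> 1" for x
          using that d unfolding soft_def by (auto simp: max_def min_def)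
        then show ?thesis by simp
      qed
      define c0 where "c0 = integral {0..2 * pi} (\<lambda>u. \<bar>soft (cos (u + a))\<bar>)"
      have "c0 \<noteq> 0"
      proof
        assume "c0 = 0"
        then have z: "\<forall>u\<in>{0..2 * pi}. \<bar>soft (cos (u + a))\<bar> = 0"
          unfolding c0_def by (subst (asm) integral_eq_0_iff) (auto intro!: continuous_intros)
        have "integral {0..2 * pi} (\<lambda>u. \<bar>soft (cos (a + u))\<bar>) = integral {0..2 * pi} (\<lambda>u. \<bar>soft (cos u)\<bar>)"
          by (rule integral_periodic_reflect(1)) (auto intro!: continuous_intros)
        then have "integral {0..2 * pi} (\<lambda>u. \<bar>soft (cos u)\<bar>) = 0" using \<open>c0 = 0\<close> by (simp add: c0_def add.commute)
        then have "\<forall>u\<in>{0..2 * pi}. \<bar>soft (cos u)\<bar> = 0"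
          by (subst (asm) integral_eq_0_iff) (auto intro!: continuous_intros)
        then have "\<bar>soft (cos 0)\<bar> = 0" by (rule bspec) simp
        then show False using d by (simp add: soft_def)
      qed
      moreover have "c0 \<ge> 0" unfolding c0_def
        by (intro Henstock_Kurzweil_Integration.integral_nonneg integrable_continuous_real continuous_intros) auto
      ultimately have c0: "c0 > 0" by simp
      \<comment> \<open>Only one of the \<open>N\<close> steps carries mass, of amount
        \<open>c0\<close> divided by \<open>N\<close>; dividing by \<open>c\<close> makes the L_1
        norm 1.\<close>
      define c where "c = c0 / real N"
      have c: "c > 0" using c0 N by (simp add: c_def)
      define h where "h = (\<lambda>k u. if k = k0 then soft (cos (u + a)) / c else 0)"
      have hhc: "continuous_on UNIV (h k)" for k
        unfolding h_def using c by (cases "k = k0") (auto intro!: continuous_intros)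
      have hha: "h k (u + pi) = - h k u" for k u
      proof -
        have "u + pi + a = (u + a) + pi" by simp
        then have "cos (u + pi + a) = - cos (u + a)" by (simp only: cos_periodic_pi)
        then show ?thesis by (simp add: h_def sodd)
      qed
      have hhp: "h k (u + 2 * pi) = h k u" for k u
        using hha[of k "u + pi"] hha[of k u] by (simp add: add.assoc)
      have hhb: "\<bar>h k u\<bar> \<le> 1 / c" for k u
        using sb c by (auto simp: h_def abs_mult intro!: divide_right_mono)
      let ?\<phi> = "\<lambda>t. h (step_index N t) (real N * t)"
      have L1: "(LINT t:{0..2 * pi}|lebesgue. \<bar>?\<phi> t\<bar>) = 1"
      proof -
        have "(LINT t:{0..2 * pi}|lebesgue. \<bar>?\<phi> t\<bar>) = (\<Sum>k<N. integral {0..2 * pi} (\<lambda>u. \<bar>h k u\<bar>)) / real N"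
          by (rule step_function_LINT(2)[of N "\<lambda>k u. \<bar>h k u\<bar>" "1 / c", OF N])
            (use hhb in \<open>auto simp: hhp intro!: continuous_intros hhc\<close>)
        also have "(\<Sum>k<N. integral {0..2 * pi} (\<lambda>u. \<bar>h k u\<bar>)) = (\<Sum>k<N. if k = k0 then c0 / c else 0)"
          using c by (intro sum.cong refl) (auto simp: h_def c0_def)
        also have "\<dots> = c0 / c" using k0N by simp
        finally show ?thesis using c0 N by (simp add: c_def)
      qed
      have U: "?\<phi> \<in> U0 s"
        by (rule step_function_in_U0[of N h "1 / c", OF N hhc hha hhb s])
          (use one L1 in \<open>auto simp: one_ereal_def\<close>)
      have "L - \<epsilon> \<le> B * (1 - d)" using Bd L by (simp add: algebra_simps)
      also have "\<dots> = (LINT t:{0..2 * pi}|lebesgue. B * (1 - d) * \<bar>?\<phi> t\<bar>)"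
        using L1 by simp
      also have "\<dots> \<le> (LINT t:{0..2 * pi}|lebesgue. ?\<phi> t * ?W T t)"
      proof (rule set_integral_mono)
        show "set_integrable lebesgue {0..2 * pi} (\<lambda>t. ?\<phi> t * ?W T t)"
          by (rule Holder_U0(1)[OF U s Wm hb])
        show "set_integrable lebesgue {0..2 * pi} (\<lambda>t. B * (1 - d) * \<bar>?\<phi> t\<bar>)"
          by (intro set_integrable_mult_right set_integrable_abs set_integrable_bounded_Icc[where B = "1 / c"]
              step_function_measurable hhc hhb)
        have "B * (1 - d) * \<bar>h k u\<bar> \<le> h k u * hW T k u" for k u
        proof (cases "k = k0")
          case True
          have hw: "hW T k u = B * cos (u + a)"
            using True unfolding hW_def Re_cis_mult by (simp add: T_def B_def a_def add_ac)
          have "(B / c) * ((1 - d) * \<bar>soft (cos (u + a))\<bar>) \<le> (B / c) * (cos (u + a) * soft (cos (u + a)))"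
            using B c by (intro mult_left_mono sx) auto
          then show ?thesis using True c unfolding hw by (simp add: h_def abs_mult mult_ac)
        qed (simp add: h_def)
        then show "B * (1 - d) * \<bar>?\<phi> t\<bar> \<le> ?\<phi> t * ?W T t" for t .
      qed
      finally have fin: "L - \<epsilon> \<le> (LINT t:{0..2 * pi}|lebesgue. ?\<phi> t * ?W T t)" .
      show ?thesis by (rule bexI[of _ ?\<phi>]) (rule fin, rule U)
    qed
    moreover have "Lp_norm s' (?W T) \<le> L"
      unfolding L s1 by (rule Lp_norm_infinity_le(1)[OF Wm hb])
    ultimately show ?thesis using that[of T] T unfolding W by auto
  qed
qed

section \<open>The extremal problem for moduli of continuity\<close>

lemma modulus_of_continuityD:
  assumes "modulus_of_continuity \<omega>"
  shows "continuous_on {0..} \<omega>" "0 \<le> x \<Longrightarrow> x \<le> y \<Longrightarrow> \<omega> x \<le> \<omega> y" "\<omega> 0 = 0" "0 \<le> x \<Longrightarrow> 0 \<le> \<omega> x"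
    "0 \<le> s \<Longrightarrow> 0 \<le> t \<Longrightarrow> \<omega> (s + t) \<le> \<omega> s + \<omega> t"
proof -
  show "continuous_on {0..} \<omega>" "\<omega> 0 = 0" "0 \<le> s \<Longrightarrow> 0 \<le> t \<Longrightarrow> \<omega> (s + t) \<le> \<omega> s + \<omega> t"
    using assms by (auto simp: modulus_of_continuity_def)
  show m: "0 \<le> x \<Longrightarrow> x \<le> y \<Longrightarrow> \<omega> x \<le> \<omega> y" for x y
    using assms by (auto simp: modulus_of_continuity_def mono_on_def)
  show "0 \<le> x \<Longrightarrow> 0 \<le> \<omega> x" using m[of 0 x] \<open>\<omega> 0 = 0\<close> by simp
qed

lemma concave_modulus_scale:
  assumes \<omega>: "modulus_of_continuity \<omega>" "concave_on {0..} \<omega>" and x: "0 \<le> x" and c: "0 \<le> c" "c \<le> 1"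
  shows "c * \<omega> x \<le> \<omega> (c * x)"
proof -
  have "(1 - c) * \<omega> 0 + c * \<omega> x \<le> \<omega> ((1 - c) *\<^sub>R 0 + c *\<^sub>R x)"
    by (rule concave_onD[OF \<omega>(2)]) (use x c in auto)
  then show ?thesis using modulus_of_continuityD(3)[OF \<omega>(1)] by simp
qed

lemma C_space_bounded:
  assumes "\<phi> \<in> C_space"
  obtains B where "\<And>t. \<bar>\<phi> t\<bar> \<le> B"
proof -
  have "compact (\<phi> ` {0..2 * pi})" by (intro compact_continuous_image C_spaceD(1)[OF assms]) auto
  then obtain B where B: "\<And>t. t \<in> {0..2 * pi} \<Longrightarrow> \<bar>\<phi> t\<bar> \<le> B"
    using compact_imp_bounded bounded_iff by (metis imageI real_norm_def)
  have "\<bar>\<phi> t\<bar> \<le> B" for t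
  proof -
    obtain k :: int where "t + of_int k * (2 * pi) \<in> {0..<2 * pi}" by (rule periodic_representative)
    then have "t + of_int k * (2 * pi) \<in> {0..2 * pi}" by auto
    from B[OF this] show ?thesis
      using periodic_shift_int[of \<phi> "2 * pi" t k, OF C_spaceD(2)[OF assms]] by simp
  qed
  then show ?thesis using that by blast
qed

lemma abs_le_C_norm:
  assumes "\<And>t. \<bar>f t\<bar> \<le> B"
  shows "\<bar>f t\<bar> \<le> C_norm f"
  unfolding C_norm_def by (rule cSUP_upper) (use assms in \<open>auto intro!: bdd_aboveI[of _ B]\<close>)

lemma C_norm_le: "(\<And>t. \<bar>f t\<bar> \<le> B) \<Longrightarrow> C_norm f \<le> B"
  unfolding C_norm_def by (rule cSUP_least) auto

text \<open>The class is defined by nested real suprema, which control their members only when the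
  sets are bounded; boundedness of a continuous periodic function supplies that, and a pointwise
  condition results.\<close>

lemma H_class_iff:
  assumes \<omega>: "modulus_of_continuity \<omega>" and \<phi>: "\<phi> \<in> C_space"
  shows "\<phi> \<in> H_class \<omega> \<longleftrightarrow> (\<forall>x y. \<bar>\<phi> x - \<phi> y\<bar> \<le> \<omega> \<bar>x - y\<bar>)"
proof
  obtain B where B: "\<And>t. \<bar>\<phi> t\<bar> \<le> B" using C_space_bounded[OF \<phi>] by blast
  have d: "\<bar>\<phi> (x + h) - \<phi> x\<bar> \<le> 2 * B" for x h using B[of x] B[of "x + h"] by linarith
  show "\<forall>x y. \<bar>\<phi> x - \<phi> y\<bar> \<le> \<omega> \<bar>x - y\<bar>" if H: "\<phi> \<in> H_class \<omega>"
  proof (intro allI)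
    fix x y
    have "\<bar>\<phi> (y + (x - y)) - \<phi> y\<bar> \<le> C_norm (\<lambda>t. \<phi> (t + (x - y)) - \<phi> t)"
      by (rule abs_le_C_norm[of "\<lambda>t. \<phi> (t + (x - y)) - \<phi> t"]) (rule d)
    also have "\<dots> \<le> modulus_of \<phi> \<bar>x - y\<bar>" unfolding modulus_of_def
      by (rule cSUP_upper) (auto intro!: bdd_aboveI[of _ "2 * B"] C_norm_le d)
    also have "\<dots> \<le> \<omega> \<bar>x - y\<bar>" using H by (auto simp: H_class_def)
    finally show "\<bar>\<phi> x - \<phi> y\<bar> \<le> \<omega> \<bar>x - y\<bar>" by simp
  qed
  show "\<phi> \<in> H_class \<omega>" if H: "\<forall>x y. \<bar>\<phi> x - \<phi> y\<bar> \<le> \<omega> \<bar>x - y\<bar>"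
  proof -
    have "modulus_of \<phi> t \<le> \<omega> t" if t: "t \<ge> 0" for t
      unfolding modulus_of_def
    proof (rule cSUP_least)
      show "{h. \<bar>h\<bar> \<le> t} \<noteq> {}" using t by (auto intro!: exI[of _ 0])
      fix h assume h: "h \<in> {h. \<bar>h\<bar> \<le> t}"
      show "C_norm (\<lambda>x. \<phi> (x + h) - \<phi> x) \<le> \<omega> t"
      proof (rule C_norm_le)
        fix x
        have "\<bar>\<phi> (x + h) - \<phi> x\<bar> \<le> \<omega> \<bar>x + h - x\<bar>" using H by blast
        also have "\<dots> \<le> \<omega> t" using h by (intro modulus_of_continuityD(2)[OF \<omega>]) auto
        finally show "\<bar>\<phi> (x + h) - \<phi> x\<bar> \<le> \<omega> t" .
      qed
    qed
    then show ?thesis using \<phi> by (simp add: H_class_def)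
  qed
qed

lemma H_classD:
  assumes \<omega>: "modulus_of_continuity \<omega>" and \<phi>: "\<phi> \<in> H_class \<omega>"
  shows "\<phi> \<in> C_space" "\<bar>\<phi> x - \<phi> y\<bar> \<le> \<omega> \<bar>x - y\<bar>" "\<bar>\<phi> x - \<phi> 0\<bar> \<le> \<omega> pi"
proof -
  show C: "\<phi> \<in> C_space" using \<phi> by (simp add: H_class_def)
  show d: "\<bar>\<phi> x - \<phi> y\<bar> \<le> \<omega> \<bar>x - y\<bar>" for x y using H_class_iff[OF \<omega> C] \<phi> by blast
  \<comment> \<open>Adding pi before reducing places the representative of \<open>x\<close> in [-pi,
    pi), within distance pi of 0.\<close>
  obtain k :: int where "x + pi + of_int k * (2 * pi) \<in> {0..<2 * pi}" by (rule periodic_representative)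
  then have "\<bar>x + of_int k * (2 * pi)\<bar> \<le> pi" by (auto simp: abs_le_iff)
  then have "\<bar>\<phi> (x + of_int k * (2 * pi)) - \<phi> 0\<bar> \<le> \<omega> pi"
    using d[of "x + of_int k * (2 * pi)" 0] modulus_of_continuityD(2)[OF \<omega>, of "\<bar>x + of_int k * (2 * pi)\<bar>" pi] by simp
  then show "\<bar>\<phi> x - \<phi> 0\<bar> \<le> \<omega> pi"
    using periodic_shift_int[of \<phi> "2 * pi" x k, OF C_spaceD(2)[OF C]] by simp
qed

text \<open>A translation by pi/k changes the sign of the cosine, so twice the coefficient is an
  integral of the increment of \<phi> over pi/k. Since pi/k \<le> 4/N, subadditivity bounds the
  increment by 4 \<omega>(1/N).\<close>

lemma H_class_phase_coeff_bound:
  assumes \<omega>: "modulus_of_continuity \<omega>" and \<phi>: "\<phi> \<in> H_class \<omega>" and N: "N \<ge> 1" and k: "k \<ge> N"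
  shows "\<bar>phase_coeff k b \<phi> x\<bar> \<le> 4 * \<omega> (1 / real N)"
proof -
  note C = H_classD(1)[OF \<omega> \<phi>]
  have c[continuous_intros]: "continuous_on S (\<lambda>t. \<phi> (g t))" if "continuous_on S g" for S and g :: "real \<Rightarrow> real"
    by (rule continuous_on_compose2[OF C_spaceD(1)[OF C, of UNIV] that]) auto
  let ?f = "\<lambda>t. \<phi> t * cos (real k * (t - x) + b)"
  let ?h = "pi / real k"
  have k1: "k \<ge> 1" using k N by simp
  have fc: "continuous_on UNIV ?f" by (intro continuous_intros)
  have fper: "?f (t + 2 * pi) = ?f t" for t
  proof -
    have e: "real k * (t + 2 * pi - x) + b = (real k * (t - x) + b) + of_int (int k) * (2 * pi)"
      by (simp add: algebra_simps)
    have "cos (real k * (t + 2 * pi - x) + b) = cos (real k * (t - x) + b)"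
      unfolding e by (rule periodic_shift_int) simp
    then show ?thesis using C_spaceD(2)[OF C] by simp
  qed
  have I: "(LINT t:{0..2 * pi}|lebesgue. ?f t) = integral {0..2 * pi} ?f"
    by (intro set_integrable_continuous_Icc continuous_intros)
  have shift: "?f (?h + t) = - (\<phi> (t + ?h) * cos (real k * (t - x) + b))" for t
  proof -
    have "real k * (?h + t - x) + b = (real k * (t - x) + b) + pi" using k1 by (simp add: field_simps)
    then show ?thesis by (simp only: cos_periodic_pi) (simp add: add.commute)
  qed
  have "integral {0..2 * pi} ?f = integral {0..2 * pi} (\<lambda>t. - (\<phi> (t + ?h) * cos (real k * (t - x) + b)))"
    using integral_periodic_reflect(1)[OF fper fc, of ?h] unfolding shift by simp
  then have "2 * integral {0..2 * pi} ?f = integral {0..2 * pi} ?f + integral {0..2 * pi} (\<lambda>t. - (\<phi> (t + ?h) * cos (real k * (t - x) + b)))"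
    by simp
  also have "\<dots> = integral {0..2 * pi} (\<lambda>t. (\<phi> t - \<phi> (t + ?h)) * cos (real k * (t - x) + b))"
    by (subst integral_add[symmetric]) (auto intro!: integrable_continuous_real continuous_intros simp: left_diff_distrib)
  finally have "2 * \<bar>integral {0..2 * pi} ?f\<bar> = norm (integral {0..2 * pi} (\<lambda>t. (\<phi> t - \<phi> (t + ?h)) * cos (real k * (t - x) + b)))"
    by simp
  also have "\<dots> \<le> (4 * \<omega> (1 / real N)) * (2 * pi - 0)"
  proof (rule integral_bound)
    fix t assume "t \<in> {0..2 * pi}"
    have q: "\<omega> (2 * y) \<le> 2 * \<omega> y" if "y \<ge> 0" for y
      using modulus_of_continuityD(5)[OF \<omega>, of y y] that by (simp only: mult_2)
    have "\<bar>\<phi> t - \<phi> (t + ?h)\<bar> \<le> \<omega> ?h" using H_classD(2)[OF \<omega> \<phi>, of t "t + ?h"] by simp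
    also have "\<dots> \<le> \<omega> (2 * (2 * (1 / real N)))"
    proof (rule modulus_of_continuityD(2)[OF \<omega>])
      have "pi / real k \<le> 4 / real N" using k N pi_less_4 by (intro frac_le) auto
      then show "?h \<le> 2 * (2 * (1 / real N))" by simp
    qed simp
    also have "\<dots> \<le> 4 * \<omega> (1 / real N)"
      using q[of "2 * (1 / real N)"] q[of "1 / real N"] by simp
    finally have le: "\<bar>\<phi> t - \<phi> (t + ?h)\<bar> \<le> 4 * \<omega> (1 / real N)" .
    have "\<bar>\<phi> t - \<phi> (t + ?h)\<bar> * \<bar>cos (real k * (t - x) + b)\<bar> \<le> \<bar>\<phi> t - \<phi> (t + ?h)\<bar> * 1"
      by (intro mult_left_mono) auto
    then show "norm ((\<phi> t - \<phi> (t + ?h)) * cos (real k * (t - x) + b)) \<le> 4 * \<omega> (1 / real N)"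
      using le by (simp add: abs_mult)
  qed (auto intro!: continuous_intros)
  finally have "\<bar>integral {0..2 * pi} ?f\<bar> \<le> 4 * \<omega> (1 / real N) * pi" by (simp add: mult_ac)
  then show ?thesis unfolding phase_coeff_def I by (simp add: abs_mult field_simps)
qed

section \<open>Pairing about the zeros of the cosine\<close>

lemma cos_odd_quarter: "cos (real k * pi + pi / 2 + w) = - ((-1) ^ k * sin w)"
proof -
  have "real k * pi + pi / 2 + w = (w + pi / 2) + real k * pi" by simp
  then have "cos (real k * pi + pi / 2 + w) = cos (w + pi / 2) * cos (real k * pi) - sin (w + pi / 2) * sin (real k * pi)"
    by (simp only: cos_add)
  then show ?thesis by (simp add: cos_add mult.commute)
qed

text \<open>The cosine is odd about its zero \<open>c\<close>, so only increments of
  \<open>y\<close> between mirror points survive, weighted by \<open>sin w\<close>; (-1)^k is the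
  alternating slope at the zero.\<close>

lemma integral_cos_half_period:
  fixes y :: "real \<Rightarrow> real" and k :: nat
  assumes y: "continuous_on UNIV y"
  defines "c \<equiv> real k * pi + pi / 2"
  shows "integral {real k * pi..real (Suc k) * pi} (\<lambda>u. y u * cos u) =
    integral {0..pi / 2} (\<lambda>w. (-1) ^ k * (y (c - w) - y (c + w)) * sin w)"
proof -
  have yc[continuous_intros]: "continuous_on S (\<lambda>t. y (g t))" if "continuous_on S g" for S and g :: "real \<Rightarrow> real"
    by (rule continuous_on_compose2[OF y that]) auto
  let ?f = "\<lambda>u. y u * cos u"
  have i: "f integrable_on {a..b}" if "continuous_on UNIV f" for f :: "real \<Rightarrow> real" and a b
    by (intro integrable_continuous_real continuous_on_subset[OF that]) auto
  have fc: "continuous_on UNIV ?f" by (intro continuous_intros)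
  have shift: "integral {a + d..b + d} ?f = integral {a..b} (\<lambda>t. ?f (t + d))" for a b d
    using integral_shift[of a d b ?f] continuous_on_subset[OF fc] by (simp add: o_def)
  have sg: "cos (c + w) = - ((-1) ^ k * sin w)" for w
    unfolding c_def by (rule cos_odd_quarter)
  have right: "integral {c..real (Suc k) * pi} ?f = integral {0..pi / 2} (\<lambda>w. - ((-1) ^ k * y (c + w) * sin w))"
  proof -
    have "integral {c..real (Suc k) * pi} ?f = integral {0 + c..pi / 2 + c} ?f"
      by (simp add: c_def algebra_simps)
    also have "\<dots> = integral {0..pi / 2} (\<lambda>t. ?f (c + t))" unfolding shift by (simp add: add.commute)
    also have "\<dots> = integral {0..pi / 2} (\<lambda>w. - ((-1) ^ k * y (c + w) * sin w))"
      unfolding sg by (simp add: mult_ac)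
    finally show ?thesis .
  qed
  have left: "integral {real k * pi..c} ?f = integral {0..pi / 2} (\<lambda>w. (-1) ^ k * y (c - w) * sin w)"
  proof -
    have "integral {real k * pi..c} ?f = integral {- (pi / 2) + c..0 + c} ?f" by (simp add: c_def)
    also have "\<dots> = integral {- (pi / 2)..- 0} (\<lambda>t. ?f (c + t))" unfolding shift by (simp add: add.commute)
    also have "\<dots> = integral {0..pi / 2} (\<lambda>w. ?f (c + (- w)))"
      using Henstock_Kurzweil_Integration.integral_reflect_real[of "pi / 2" 0 "\<lambda>w. ?f (c + (- w))"] by simp
    also have "\<dots> = integral {0..pi / 2} (\<lambda>w. (-1) ^ k * y (c - w) * sin w)"
      unfolding sg by (simp add: mult_ac)
    finally show ?thesis .
  qed
  have "integral {real k * pi..real (Suc k) * pi} ?f = integral {real k * pi..c} ?f + integral {c..real (Suc k) * pi} ?f"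
    by (rule Henstock_Kurzweil_Integration.integral_combine[OF _ _ i[OF fc], symmetric]) (simp_all add: c_def algebra_simps)
  also have "\<dots> = integral {0..pi / 2} (\<lambda>w. (-1) ^ k * y (c - w) * sin w + - ((-1) ^ k * y (c + w) * sin w))"
    unfolding left right by (rule integral_add[symmetric]) (intro i continuous_intros)+
  finally show ?thesis by (simp add: algebra_simps)
qed

lemma integral_split_pi:
  fixes f :: "real \<Rightarrow> real"
  assumes f: "continuous_on UNIV f"
  shows "integral {0..real K * pi} f = (\<Sum>k<K. integral {real k * pi..real (Suc k) * pi} f)"
proof (induction K)
  case (Suc K)
  have "integral {0..real K * pi} f + integral {real K * pi..real (Suc K) * pi} f = integral {0..real (Suc K) * pi} f"
    by (intro Henstock_Kurzweil_Integration.integral_combine integrable_continuous_real continuous_on_subset[OF f]) 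
      (auto simp: algebra_simps)
  then show ?case using Suc by simp
qed simp

section \<open>The total phase as a new variable\<close>

text \<open>\<open>L\<close> bounds the drift of the slow phase. The condition 2L \<le> N keeps the
  speed of \<Phi> at least N/2, hence \<Phi> invertible; N - L and N + L are the extreme speeds that
  enter the upper and lower estimates.\<close>

locale phase_change =
  fixes N :: nat and L :: real and \<Phi> \<Phi>' :: "real \<Rightarrow> real"
  assumes N1: "N \<ge> 1" and L0: "0 \<le> L" and NL: "2 * L \<le> real N"
    and deriv: "\<And>t. (\<Phi> has_real_derivative \<Phi>' t) (at t)"
    and deriv_cont: "continuous_on UNIV \<Phi>'"
    and deriv_bound: "\<And>t. \<bar>\<Phi>' t - real N\<bar> \<le> L"
    and shift: "\<And>t. \<Phi> (t + 2 * pi) = \<Phi> t + real N * (2 * pi)"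
begin

lemma NLpos: "real N - L > 0"
  using NL L0 N1 by linarith

lemma expand:
  assumes "s \<le> t"
  shows "(real N - L) * (t - s) \<le> \<Phi> t - \<Phi> s" "\<Phi> t - \<Phi> s \<le> (real N + L) * (t - s)"
proof -
  have "\<exists>z. \<Phi> t - \<Phi> s = (t - s) * \<Phi>' z"
  proof (cases "s = t")
    case False
    then show ?thesis using MVT2[of s t \<Phi> \<Phi>'] assms deriv by fastforce
  qed simp
  then obtain z where z: "\<Phi> t - \<Phi> s = (t - s) * \<Phi>' z" by blast
  have "real N - L \<le> \<Phi>' z" "\<Phi>' z \<le> real N + L" using deriv_bound[of z] by linarith+
  then show "(real N - L) * (t - s) \<le> \<Phi> t - \<Phi> s" "\<Phi> t - \<Phi> s \<le> (real N + L) * (t - s)"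
    unfolding z using assms by (auto simp: mult.commute[of "t - s"] intro!: mult_right_mono)
qed

lemma continuous_phase: "continuous_on S \<Phi>"
  by (intro continuous_at_imp_continuous_on ballI DERIV_isCont[OF deriv])

lemma bij_phase: "bij \<Phi>"
proof (rule bijI)
  show "inj \<Phi>"
  proof (rule injI)
    have le: "x = y" if "x \<le> y" "\<Phi> x = \<Phi> y" for x y
    proof -
      have "(real N - L) * (y - x) \<le> 0" using expand(1)[OF that(1)] that(2) by linarith
      then have "y - x \<le> 0" using NLpos mult_pos_pos[of "real N - L" "y - x"] by linarith
      then show ?thesis using that(1) by linarith
    qed
    fix x y assume e: "\<Phi> x = \<Phi> y"
    show "x = y" using le[of x y] le[of y x] e by linarith
  qed
  show "surj \<Phi>"
    unfolding surj_def
  proof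
    fix u
    define R where "R = \<bar>u - \<Phi> 0\<bar> / (real N - L)"
    have R: "0 \<le> R" "(real N - L) * R = \<bar>u - \<Phi> 0\<bar>" using NLpos by (auto simp: R_def)
    have "(real N - L) * R \<le> \<Phi> 0 - \<Phi> (- R)" "(real N - L) * R \<le> \<Phi> R - \<Phi> 0"
      using expand(1)[of "- R" 0] expand(1)[of 0 R] R(1) by simp_all
    then have "\<Phi> (- R) \<le> u" "u \<le> \<Phi> R" unfolding R(2) by linarith+
    from IVT'[OF this _ continuous_phase] R(1) obtain x where "\<Phi> x = u" by auto
    then show "\<exists>x. u = \<Phi> x" by metis
  qed
qed

definition \<tau> where "\<tau> = inv \<Phi>"

lemma \<tau>_\<Phi>: "\<tau> (\<Phi> t) = t" and \<Phi>_\<tau>: "\<Phi> (\<tau> u) = u"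
  using bij_phase by (auto simp: \<tau>_def bij_is_inj bij_is_surj surj_f_inv_f)

lemma \<tau>_Lipschitz: "\<bar>\<tau> u - \<tau> v\<bar> \<le> \<bar>u - v\<bar> / (real N - L)"
proof -
  have le: "\<bar>\<tau> u - \<tau> v\<bar> \<le> \<bar>u - v\<bar> / (real N - L)" if "\<tau> u \<le> \<tau> v" for u v
  proof -
    have "(real N - L) * (\<tau> v - \<tau> u) \<le> v - u" using expand(1)[OF that] by (simp only: \<Phi>_\<tau>)
    then have "\<tau> v - \<tau> u \<le> (v - u) / (real N - L)" using NLpos by (simp add: pos_le_divide_eq mult.commute)
    also have "\<dots> \<le> \<bar>u - v\<bar> / (real N - L)" using NLpos by (intro divide_right_mono) auto
    finally show ?thesis using that by simp
  qed
  show ?thesis using le[of u v] le[of v u] by (cases "\<tau> u \<le> \<tau> v") (simp_all add: abs_minus_commute)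
qed

lemma \<tau>_continuous: "continuous_on S \<tau>"
proof (rule lipschitz_on_continuous_on)
  show "(1 / (real N - L))-lipschitz_on S \<tau>"
    using \<tau>_Lipschitz NLpos by (auto simp: lipschitz_on_def dist_real_def)
qed

lemma \<tau>_shift: "\<tau> (u + real N * (2 * pi)) = \<tau> u + 2 * pi"
proof -
  have "\<Phi> (\<tau> u + 2 * pi) = u + real N * (2 * pi)" by (simp add: shift \<Phi>_\<tau>)
  then show ?thesis by (metis \<tau>_\<Phi>)
qed

text \<open>The Jacobian \<open>\<Phi>'\<close> stays under the integral on the left; replacing it
  by the constant N is a separate estimate, \<open>derivative_replacement\<close>.\<close>

lemma change_of_variable:
  fixes f g :: "real \<Rightarrow> real"
  assumes f: "continuous_on UNIV f" "\<And>t. f (t + 2 * pi) = f t"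
    and g: "continuous_on UNIV g" "\<And>u. g (u + 2 * pi) = g u"
  shows "integral {0..2 * pi} (\<lambda>t. f t * g (\<Phi> t) * \<Phi>' t) = integral {0..real (2 * N) * pi} (\<lambda>u. f (\<tau> u) * g u)"
proof -
  let ?F = "\<lambda>u. f (\<tau> u) * g u"
  have Fc: "continuous_on UNIV ?F"
    by (intro continuous_on_mult g continuous_on_compose2[OF f(1) \<tau>_continuous]) auto
  have le: "\<Phi> 0 \<le> \<Phi> (2 * pi)" using shift[of 0] by simp
  have mono: "\<Phi> x \<le> \<Phi> y" if "x \<le> y" for x y
    using expand(1)[OF that] NLpos that mult_nonneg_nonneg[of "real N - L" "y - x"] by linarith
  have "((\<lambda>t. \<Phi>' t *\<^sub>R ?F (\<Phi> t)) has_integral integral {\<Phi> 0..\<Phi> (2 * pi)} ?F) {0..2 * pi}"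
    by (rule has_integral_substitution[where c = "\<Phi> 0" and d = "\<Phi> (2 * pi)"])
      (use le mono in \<open>auto intro!: continuous_on_subset[OF Fc] DERIV_subset[OF deriv]\<close>)
  then have "integral {0..2 * pi} (\<lambda>t. f t * g (\<Phi> t) * \<Phi>' t) = integral {\<Phi> 0..\<Phi> 0 + real N * (2 * pi)} ?F"
    using shift[of 0] by (simp add: \<tau>_\<Phi> integral_unique mult_ac)
  \<comment> \<open>Periodicity moves the start from \<Phi>(0) to 0, so that the range consists of
    whole half periods of the cosine beginning at multiples of pi.\<close>
  also have "\<dots> = integral {0..real N * (2 * pi)} ?F"
  proof (rule integral_periodic_shift[OF _ Fc])
    show "?F (u + real N * (2 * pi)) = ?F u" for u
      using periodic_shift_int[of g "2 * pi" u "int N", OF g(2)] by (simp add: \<tau>_shift f(2))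
  qed simp
  finally show ?thesis by (simp add: mult_ac)
qed

end

section \<open>The extremal profile and its mean\<close>

lemma integral_abs_le:
  fixes f :: "real \<Rightarrow> real"
  assumes "continuous_on {a..b} f" "a \<le> b" "\<And>t. t \<in> {a..b} \<Longrightarrow> \<bar>f t\<bar> \<le> C"
  shows "\<bar>integral {a..b} f\<bar> \<le> C * (b - a)"
  using integral_bound[OF assms(2,1)] assms(3) by auto

lemma modulus_bound_imp_continuous:
  fixes f :: "real \<Rightarrow> real"
  assumes \<omega>: "modulus_of_continuity \<omega>" and f: "\<And>x y. \<bar>f x - f y\<bar> \<le> \<omega> \<bar>x - y\<bar>"
  shows "continuous_on S f"
proof (rule continuous_at_imp_continuous_on, rule ballI)
  fix x
  have c: "continuous_on UNIV (\<lambda>y. \<omega> \<bar>y - x\<bar>)"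
    by (rule continuous_on_compose2[OF modulus_of_continuityD(1)[OF \<omega>]]) (auto intro!: continuous_intros)
  then have "isCont (\<lambda>y. \<omega> \<bar>y - x\<bar>) x" by (simp add: continuous_on_eq_continuous_at)
  then have "((\<lambda>y. \<omega> \<bar>y - x\<bar>) \<longlongrightarrow> \<omega> \<bar>x - x\<bar>) (at x)" unfolding isCont_def .
  then have "((\<lambda>y. \<omega> \<bar>y - x\<bar>) \<longlongrightarrow> 0) (at x)" using modulus_of_continuityD(3)[OF \<omega>] by simp
  then have "((\<lambda>y. f y - f x) \<longlongrightarrow> 0) (at x)"
    by (rule Lim_null_comparison[rotated]) (use f in auto)
  then show "isCont f x" by (simp add: isCont_def LIM_zero_iff)
qed

text \<open>This is the triangle wave. With a, b the two arcsines, cos a is \<bar>sin u\<bar>, so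
  cos \<bar>u-v\<bar> \<le> cos \<bar>a-b\<bar>; for \<bar>u-v\<bar> \<le> pi the monotonicity of
  the cosine finishes, and otherwise \<bar>a-b\<bar> \<le> pi does.\<close>

lemma arcsin_cos_Lipschitz: "\<bar>arcsin (cos u) - arcsin (cos v)\<bar> \<le> \<bar>u - v\<bar>"
proof -
  define a b where "a = arcsin (cos u)" and "b = arcsin (cos v)"
  have ab: "\<bar>a - b\<bar> \<le> pi"
    using arcsin_bounded[of "cos u"] arcsin_bounded[of "cos v"] by (auto simp: a_def b_def abs_le_iff)
  show ?thesis
  proof (cases "\<bar>u - v\<bar> \<le> pi")
    case True
    have c: "cos (arcsin (cos x)) = \<bar>sin x\<bar>" for x :: real
      by (simp add: cos_arcsin cos_squared_eq)
    have "cos \<bar>u - v\<bar> = cos u * cos v + sin u * sin v" by (simp add: cos_diff)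
    also have "\<dots> \<le> cos u * cos v + \<bar>sin u\<bar> * \<bar>sin v\<bar>" by (simp flip: abs_mult)
    also have "\<dots> = cos \<bar>a - b\<bar>" by (simp add: cos_diff a_def b_def c)
    finally have "cos \<bar>u - v\<bar> \<le> cos \<bar>a - b\<bar>" .
    then show ?thesis unfolding a_def[symmetric] b_def[symmetric]
      using cos_mono_le_eq[of "\<bar>u - v\<bar>" "\<bar>a - b\<bar>"] True ab by simp
  qed (use ab in \<open>simp add: a_def b_def\<close>)
qed

text \<open>Its increment from -x to x is \<omega>(2x) for x \<ge> 0, the largest that H_\<omega>
  allows at mirror points.\<close>

definition odd_modulus :: "(real \<Rightarrow> real) \<Rightarrow> real \<Rightarrow> real" where
  "odd_modulus \<omega> x = sgn x * \<omega> (2 * \<bar>x\<bar>) / 2"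

lemma odd_modulus_minus: "odd_modulus \<omega> (- x) = - odd_modulus \<omega> x"
  by (simp add: odd_modulus_def sgn_minus)

text \<open>For arguments of equal sign, two applications of subadditivity suffice. For opposite
  signs the increment is (\<omega>(2x) + \<omega>(2y))/2, and concavity at the midpoint bounds it by
  \<omega>(x+y).\<close>

lemma odd_modulus_bound:
  assumes \<omega>: "modulus_of_continuity \<omega>" "concave_on {0..} \<omega>"
  shows "\<bar>odd_modulus \<omega> x - odd_modulus \<omega> y\<bar> \<le> \<omega> \<bar>x - y\<bar>"
proof -
  note D = modulus_of_continuityD[OF \<omega>(1)]
  have pos: "odd_modulus \<omega> x = \<omega> (2 * x) / 2" if "x \<ge> 0" for x
    using that D(3) by (auto simp: odd_modulus_def sgn_if)
  have pp: "\<bar>odd_modulus \<omega> x - odd_modulus \<omega> y\<bar> \<le> \<omega> \<bar>x - y\<bar>" if "0 \<le> y" "y \<le> x" for x y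
  proof -
    have "\<omega> (2 * x) \<le> \<omega> (2 * y) + \<omega> (2 * (x - y))" using D(5)[of "2 * y" "2 * (x - y)"] that by simp
    moreover have "\<omega> (2 * (x - y)) \<le> \<omega> (x - y) + \<omega> (x - y)" 
      using D(5)[of "x - y" "x - y"] that by (simp only: mult_2)
    moreover have "\<omega> (2 * y) \<le> \<omega> (2 * x)" using that by (intro D(2)) auto
    ultimately show ?thesis using that by (simp add: pos)
  qed
  have pn: "\<bar>odd_modulus \<omega> x - odd_modulus \<omega> (- y)\<bar> \<le> \<omega> \<bar>x - (- y)\<bar>" if "0 \<le> x" "0 \<le> y" for x y
  proof -
    have "(1 - 1/2) * \<omega> (2 * x) + (1/2) * \<omega> (2 * y) \<le> \<omega> ((1 - 1/2) *\<^sub>R (2 * x) + (1/2) *\<^sub>R (2 * y))"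
      by (rule concave_onD[OF \<omega>(2)]) (use that in auto)
    then have "\<omega> (2 * x) / 2 + \<omega> (2 * y) / 2 \<le> \<omega> (x + y)" by simp
    moreover have "0 \<le> \<omega> (2 * x)" "0 \<le> \<omega> (2 * y)" using that by (auto intro: D(4))
    ultimately show ?thesis using that by (simp add: odd_modulus_minus pos)
  qed
  consider "0 \<le> y" "y \<le> x" | "0 \<le> x" "x \<le> y" | "0 \<le> x" "y \<le> 0" | "x \<le> 0" "0 \<le> y" | "x \<le> 0" "y \<le> 0" "y \<le> x" | "x \<le> 0" "y \<le> 0" "x \<le> y"
    by linarith
  then show ?thesis
  proof cases
    case 1 then show ?thesis by (rule pp)
  next
    case 2 then show ?thesis using pp[of x y] by (simp add: abs_minus_commute)
  next
    case 3 then show ?thesis using pn[of x "- y"] by simp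
  next
    case 4 then show ?thesis using pn[of y "- x"] by (simp add: abs_minus_commute)
  next
    case 5 then show ?thesis using pp[of "- x" "- y"] by (simp add: odd_modulus_minus abs_minus_commute)
  next
    case 6 then show ?thesis using pp[of "- y" "- x"] by (simp add: odd_modulus_minus)
  qed
qed

text \<open>The integral of the main term, with the frequency left free since the estimates produce
  it at N - L and N + L before it is brought to N.\<close>

definition modulus_mean :: "(real \<Rightarrow> real) \<Rightarrow> real \<Rightarrow> real" where
  "modulus_mean \<omega> c = integral {0..pi / 2} (\<lambda>w. \<omega> (2 * w / c) * sin w)"

lemma modulus_mean_integrand:
  assumes \<omega>: "modulus_of_continuity \<omega>" and c: "c > 0"
  shows "continuous_on {0..pi / 2} (\<lambda>w. \<omega> (2 * w / c) * sin w)"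
  by (intro continuous_intros continuous_on_compose2[OF modulus_of_continuityD(1)[OF \<omega>]])
    (use c in \<open>auto intro!: divide_nonneg_pos\<close>)

lemma integral_sin_quarter: "integral {0..pi / 2} sin = (1 :: real)"
proof -
  have "(sin has_integral (- cos (pi / 2) - (- cos 0))) {0..pi / 2}"
    by (rule fundamental_theorem_of_calculus)
      (auto intro!: derivative_eq_intros simp flip: has_real_derivative_iff_has_vector_derivative)
  then show ?thesis by (simp add: integral_unique)
qed

lemma modulus_mean_le:
  assumes \<omega>: "modulus_of_continuity \<omega>" and c: "c > 0" "d > 0"
    and le: "\<And>w. 0 \<le> w \<Longrightarrow> w \<le> pi / 2 \<Longrightarrow> \<omega> (2 * w / c) \<le> k * \<omega> (2 * w / d)"
  shows "modulus_mean \<omega> c \<le> k * modulus_mean \<omega> d"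
proof -
  have "modulus_mean \<omega> c \<le> integral {0..pi / 2} (\<lambda>w. k * (\<omega> (2 * w / d) * sin w))"
    unfolding modulus_mean_def
  proof (rule integral_le)
    fix w :: real assume w: "w \<in> {0..pi / 2}"
    then have "\<omega> (2 * w / c) * sin w \<le> (k * \<omega> (2 * w / d)) * sin w"
      by (intro mult_right_mono le sin_ge_zero) auto
    then show "\<omega> (2 * w / c) * sin w \<le> k * (\<omega> (2 * w / d) * sin w)" by (simp add: mult_ac)
  qed (intro integrable_continuous_real continuous_on_mult continuous_on_const modulus_mean_integrand \<omega> c)+
  then show ?thesis by (simp add: modulus_mean_def)
qed

lemma modulus_mean_bounds:
  assumes \<omega>: "modulus_of_continuity \<omega>" "concave_on {0..} \<omega>" and c: "c \<ge> 1"
  shows "0 \<le> modulus_mean \<omega> c" "modulus_mean \<omega> c \<le> \<omega> pi"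
proof -
  have c0: "c > 0" using c by simp
  show "0 \<le> modulus_mean \<omega> c" unfolding modulus_mean_def
  proof (rule Henstock_Kurzweil_Integration.integral_nonneg)
    show "0 \<le> \<omega> (2 * w / c) * sin w" if "w \<in> {0..pi / 2}" for w
      using that c0 by (intro mult_nonneg_nonneg modulus_of_continuityD(4)[OF \<omega>(1)] sin_ge_zero) auto
  qed (intro integrable_continuous_real modulus_mean_integrand \<omega> c0)
  have "modulus_mean \<omega> c \<le> integral {0..pi / 2} (\<lambda>w. \<omega> pi * sin w)" unfolding modulus_mean_def
  proof (rule integral_le)
    fix w :: real assume w: "w \<in> {0..pi / 2}"
    have "2 * w / c \<le> pi / 1" using w c by (intro frac_le) auto
    then have "\<omega> (2 * w / c) \<le> \<omega> pi" using w c0 by (intro modulus_of_continuityD(2)[OF \<omega>(1)]) auto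
    then show "\<omega> (2 * w / c) * sin w \<le> \<omega> pi * sin w" using w by (intro mult_right_mono sin_ge_zero) auto
  qed (intro integrable_continuous_real continuous_on_mult continuous_on_const continuous_on_sin continuous_on_id modulus_mean_integrand \<omega> c0)+
  then show "modulus_mean \<omega> c \<le> \<omega> pi" by (simp add: integral_sin_quarter)
qed

section \<open>Two-sided estimate for a modulated oscillation\<close>

locale modulated = phase_change +
  fixes A :: "real \<Rightarrow> real" and M B :: real and \<omega> :: "real \<Rightarrow> real"
  assumes A_Lip: "\<And>s t. \<bar>A s - A t\<bar> \<le> M * \<bar>s - t\<bar>" and A_bd: "\<And>t. 0 \<le> A t" "\<And>t. A t \<le> B"
    and A_per: "\<And>t. A (t + 2 * pi) = A t" and M0: "0 \<le> M"
    and modulus: "modulus_of_continuity \<omega>" "concave_on {0..} \<omega>"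
begin

lemma A_cont: "continuous_on S A"
proof (rule lipschitz_on_continuous_on)
  show "M-lipschitz_on S A" using A_Lip M0 by (auto simp: lipschitz_on_def dist_real_def)
qed

lemma B0: "0 \<le> B"
  using A_bd[of 0] by linarith

lemma N_real: "1 \<le> real N" "0 < real N"
  using N1 by auto

lemma half_N: "real N / 2 \<le> real N - L"
  using NL by simp

lemma a_Lip: "\<bar>A (\<tau> u) - A (\<tau> v)\<bar> \<le> 2 * M / real N * \<bar>u - v\<bar>"
proof -
  have "\<bar>A (\<tau> u) - A (\<tau> v)\<bar> \<le> M * \<bar>\<tau> u - \<tau> v\<bar>" by (rule A_Lip)
  also have "\<dots> \<le> M * (\<bar>u - v\<bar> / (real N - L))" by (intro mult_left_mono \<tau>_Lipschitz M0)
  also have "\<dots> \<le> M * (\<bar>u - v\<bar> / (real N / 2))"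
    using half_N N_real M0 by (intro mult_left_mono divide_left_mono mult_pos_pos NLpos) auto
  finally show ?thesis by (simp add: mult_ac)
qed

lemma a_cont: "continuous_on S (\<lambda>u. A (\<tau> u))"
  by (rule continuous_on_compose2[OF A_cont \<tau>_continuous]) auto

lemma phase_Lipschitz: "\<bar>\<Phi> x - \<Phi> y\<bar> \<le> (real N + L) * \<bar>x - y\<bar>"
proof -
  have le: "\<bar>\<Phi> x - \<Phi> y\<bar> \<le> (real N + L) * \<bar>x - y\<bar>" if "x \<le> y" for x y
  proof -
    have "0 \<le> (real N - L) * (y - x)" using that NLpos by simp
    then have "0 \<le> \<Phi> y - \<Phi> x" using expand(1)[OF that] by linarith
    then have "\<bar>\<Phi> x - \<Phi> y\<bar> = \<Phi> y - \<Phi> x" "\<bar>x - y\<bar> = y - x" using that by auto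
    then show ?thesis using expand(2)[OF that] by simp
  qed
  show ?thesis using le[of x y] le[of y x] by (cases "x \<le> y") (simp_all add: abs_minus_commute)
qed

text \<open>Supplies one reference value of the amplitude per half period. Their sum is exactly the
  integral of \<open>A * \<Phi>'\<close> divided by pi, and the error 2LB is the cost of replacing
  \<open>\<Phi>'\<close> by N.\<close>

lemma mean_points:
  obtains U where "\<And>k. U k \<in> {real k * pi..real (Suc k) * pi}"
    "\<bar>(\<Sum>k<2 * N. A (\<tau> (U k))) - real N * integral {0..2 * pi} A / pi\<bar> \<le> 2 * L * B"
proof -
  have "\<exists>c\<in>{real k * pi..real (Suc k) * pi}. integral {real k * pi..real (Suc k) * pi} (\<lambda>u. A (\<tau> u)) = pi * A (\<tau> c)" for k
  proof -
    have l: "real k * pi < real (Suc k) * pi" by simp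
    have d: "real (Suc k) * pi - real k * pi = pi" by (simp add: algebra_simps)
    show ?thesis using integral_mean_value[OF l a_cont] unfolding d by metis
  qed
  then obtain U where U: "\<And>k. U k \<in> {real k * pi..real (Suc k) * pi}"
    "\<And>k. integral {real k * pi..real (Suc k) * pi} (\<lambda>u. A (\<tau> u)) = pi * A (\<tau> (U k))" by metis
  have "pi * (\<Sum>k<2 * N. A (\<tau> (U k))) = integral {0..real (2 * N) * pi} (\<lambda>u. A (\<tau> u))"
    unfolding integral_split_pi[OF a_cont] U(2) by (simp add: sum_distrib_left)
  also have "\<dots> = integral {0..2 * pi} (\<lambda>t. A t * \<Phi>' t)"
    using change_of_variable[of A "\<lambda>_. 1", OF A_cont A_per] by simp
  finally have eq: "pi * (\<Sum>k<2 * N. A (\<tau> (U k))) = integral {0..2 * pi} (\<lambda>t. A t * \<Phi>' t)" .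
  have dc: "continuous_on S \<Phi>'" for S using deriv_cont continuous_on_subset by blast
  have "integral {0..2 * pi} (\<lambda>t. A t * \<Phi>' t) - real N * integral {0..2 * pi} A = integral {0..2 * pi} (\<lambda>t. A t * (\<Phi>' t - real N))"
    unfolding integral_mult_right[symmetric]
    by (subst integral_diff[symmetric]) (auto intro!: integrable_continuous_real continuous_intros A_cont dc simp: algebra_simps)
  moreover have "\<bar>integral {0..2 * pi} (\<lambda>t. A t * (\<Phi>' t - real N))\<bar> \<le> (B * L) * (2 * pi - 0)"
  proof (rule integral_abs_le)
    show "\<bar>A t * (\<Phi>' t - real N)\<bar> \<le> B * L" for t
      unfolding abs_mult using A_bd deriv_bound B0 by (intro mult_mono) auto
  qed (auto intro!: continuous_intros A_cont dc)
  ultimately have "\<bar>pi * (\<Sum>k<2 * N. A (\<tau> (U k))) - real N * integral {0..2 * pi} A\<bar> \<le> pi * (2 * L * B)"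
    unfolding eq by (simp add: mult_ac)
  then have "\<bar>pi * ((\<Sum>k<2 * N. A (\<tau> (U k))) - real N * integral {0..2 * pi} A / pi)\<bar> \<le> pi * (2 * L * B)"
    by (simp add: right_diff_distrib)
  then have "\<bar>(\<Sum>k<2 * N. A (\<tau> (U k))) - real N * integral {0..2 * pi} A / pi\<bar> \<le> 2 * L * B"
    unfolding abs_mult by simp
  then show ?thesis using U(1) that by blast
qed

lemma paired_form:
  assumes f: "continuous_on UNIV f" "\<And>t. f (t + 2 * pi) = f t"
  shows "integral {0..2 * pi} (\<lambda>t. f t * cos (\<Phi> t) * \<Phi>' t) =
    (\<Sum>k<2 * N. integral {0..pi / 2} (\<lambda>w. (-1) ^ k * (f (\<tau> (real k * pi + pi / 2 - w)) - f (\<tau> (real k * pi + pi / 2 + w))) * sin w))"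
proof -
  have fc: "continuous_on S (\<lambda>u. f (\<tau> u))" for S
    by (rule continuous_on_compose2[OF f(1) \<tau>_continuous]) auto
  have "continuous_on UNIV (\<lambda>u. f (\<tau> u) * cos u)" by (intro continuous_intros fc)
  from integral_split_pi[OF this, of "2 * N"] show ?thesis
    using change_of_variable[of f cos, OF f] unfolding integral_cos_half_period[OF fc] by (simp add: continuous_on_cos)
qed

text \<open>The wanted integral has no Jacobian. Inserting it after multiplication by N costs at
  most L pointwise, which is of relative order L/N.\<close>

lemma derivative_replacement:
  assumes f: "continuous_on UNIV f" "\<And>t. \<bar>f t\<bar> \<le> \<Omega>"
  shows "\<bar>real N * integral {0..2 * pi} (\<lambda>t. f t * A t * cos (\<Phi> t)) - integral {0..2 * pi} (\<lambda>t. f t * A t * cos (\<Phi> t) * \<Phi>' t)\<bar>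
    \<le> 2 * pi * \<Omega> * B * L"
proof -
  have fc: "continuous_on S f" and dc: "continuous_on S \<Phi>'" for S
    using f deriv_cont continuous_on_subset by blast+
  have \<Omega>: "0 \<le> \<Omega>" using f(2)[of 0] by linarith
  have "real N * integral {0..2 * pi} (\<lambda>t. f t * A t * cos (\<Phi> t)) - integral {0..2 * pi} (\<lambda>t. f t * A t * cos (\<Phi> t) * \<Phi>' t)
     = integral {0..2 * pi} (\<lambda>t. f t * A t * cos (\<Phi> t) * (real N - \<Phi>' t))"
    unfolding integral_mult_right[symmetric]
    by (subst integral_diff[symmetric])
      (auto intro!: integrable_continuous_real continuous_intros A_cont fc dc continuous_phase simp: algebra_simps)
  moreover have "\<bar>integral {0..2 * pi} (\<lambda>t. f t * A t * cos (\<Phi> t) * (real N - \<Phi>' t))\<bar> \<le> (\<Omega> * B * 1 * L) * (2 * pi - 0)"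
  proof (rule integral_abs_le)
    show "\<bar>f t * A t * cos (\<Phi> t) * (real N - \<Phi>' t)\<bar> \<le> \<Omega> * B * 1 * L" for t
      unfolding abs_mult using A_bd deriv_bound[of t] B0 f(2) \<Omega> by (intro mult_mono) (auto simp: abs_minus_commute)
  qed (auto intro!: continuous_intros A_cont fc dc continuous_phase)
  ultimately show ?thesis by (simp add: mult_ac)
qed

text \<open>For k \<ge> 1, concavity with \<omega>(0) = 0 gives \<omega>(x) \<le> k \<omega>(x/k).
  So a change of frequency by a factor \<open>k\<close> costs at most that factor, and N - L and N +
  L may be exchanged for N at relative cost of order L/N.\<close>

lemma modulus_mean_shift:
  "modulus_mean \<omega> (real N - L) \<le> (1 + 2 * L / real N) * modulus_mean \<omega> (real N)"
  "modulus_mean \<omega> (real N) \<le> (1 + L / real N) * modulus_mean \<omega> (real N + L)"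
proof -
  have key: "\<omega> (2 * w / c) \<le> k * \<omega> (2 * w / d)" if "0 < c" "0 < d" "d \<le> k * c" "0 \<le> w" "1 \<le> k" for w c d k
  proof -
    have k: "0 < k" using that by simp
    have "(1 / k) * \<omega> (2 * w / c) \<le> \<omega> ((1 / k) * (2 * w / c))"
      using that by (intro concave_modulus_scale modulus) auto
    also have "\<dots> \<le> \<omega> (2 * w / d)"
    proof (rule modulus_of_continuityD(2)[OF modulus(1)])
      have "2 * w / (k * c) \<le> 2 * w / d" using that k by (intro divide_left_mono) auto
      then show "1 / k * (2 * w / c) \<le> 2 * w / d" by (simp add: mult_ac)
    qed (use that in auto)
    finally show ?thesis using k by (simp add: pos_divide_le_eq mult.commute)
  qed
  \<comment> \<open>(1 + 2L/N)(N - L) equals N + L - 2L^2/N, which is at least N exactly because of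
    this inequality.\<close>
  have "L * (2 * L) \<le> L * real N" by (intro mult_left_mono NL L0)
  then have "real N \<le> (1 + 2 * L / real N) * (real N - L)" using N_real by (simp add: field_simps)
  then show "modulus_mean \<omega> (real N - L) \<le> (1 + 2 * L / real N) * modulus_mean \<omega> (real N)"
    using N_real L0 NLpos by (intro modulus_mean_le modulus key) auto
  have "real N + L \<le> (1 + L / real N) * real N" using N_real by (simp add: field_simps)
  then show "modulus_mean \<omega> (real N) \<le> (1 + L / real N) * modulus_mean \<omega> (real N + L)"
    using N_real L0 by (intro modulus_mean_le modulus key) auto
qed

lemma integral_A_bounds: "0 \<le> integral {0..2 * pi} A" "integral {0..2 * pi} A \<le> 2 * pi * B"
proof -
  show "0 \<le> integral {0..2 * pi} A"
    by (intro Henstock_Kurzweil_Integration.integral_nonneg integrable_continuous_real A_cont A_bd)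
  have "\<bar>integral {0..2 * pi} A\<bar> \<le> B * (2 * pi - 0)"
    using A_bd by (intro integral_abs_le A_cont) auto
  then show "integral {0..2 * pi} A \<le> 2 * pi * B" by (simp add: mult_ac)
qed

text \<open>In the phase variable mirror points are at most 2w/(N-L) apart, which bounds the
  increment of \<open>f\<close>. The amplitude is frozen at its reference value on each half period;
  the bound \<omega>(pi) on \<open>f\<close> controls the error of freezing.\<close>

lemma upper:
  assumes f: "\<And>x y. \<bar>f x - f y\<bar> \<le> \<omega> \<bar>x - y\<bar>" "\<And>t. f (t + 2 * pi) = f t" "\<And>t. \<bar>f t\<bar> \<le> \<omega> pi"
  shows "\<bar>integral {0..2 * pi} (\<lambda>t. f t * A t * cos (\<Phi> t))\<bar> \<le>
    modulus_mean \<omega> (real N) * integral {0..2 * pi} A / pi + \<omega> pi / real N * (16 * L * B + 32 * M)"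
proof -
  define \<Omega> where "\<Omega> = \<omega> pi"
  have \<Omega>: "0 \<le> \<Omega>" unfolding \<Omega>_def by (rule modulus_of_continuityD(4)[OF modulus(1)]) simp
  note fc = modulus_bound_imp_continuous[OF modulus(1) f(1)]
  obtain U where U: "\<And>k. U k \<in> {real k * pi..real (Suc k) * pi}"
    "\<bar>(\<Sum>k<2 * N. A (\<tau> (U k))) - real N * integral {0..2 * pi} A / pi\<bar> \<le> 2 * L * B"
    using mean_points by blast
  define X where "X = modulus_mean \<omega> (real N)"
  define X' where "X' = modulus_mean \<omega> (real N - L)"
  define IA where "IA = integral {0..2 * pi} A"
  \<comment> \<open>Freezing error at two mirror points: each contributes \<Omega> times the
    Lipschitz constant 2M/N of the amplitude in the phase variable times the length pi.\<close>
  define e where "e = 4 * pi * \<Omega> * M / real N"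
  let ?Q = "integral {0..2 * pi} (\<lambda>t. (f t * A t) * cos (\<Phi> t) * \<Phi>' t)"
  let ?y = "\<lambda>u. f (\<tau> u) * A (\<tau> u)"
  have yc: "continuous_on S (\<lambda>w. ?y (g w))" if "continuous_on S g" for S and g :: "real \<Rightarrow> real"
    by (intro continuous_on_mult continuous_on_compose2[OF fc[of UNIV]] continuous_on_compose2[OF A_cont[of UNIV]]
        continuous_on_compose2[OF \<tau>_continuous[of UNIV] that]) auto
  have "\<bar>integral {0..pi / 2} (\<lambda>w. (-1) ^ k * (?y (real k * pi + pi / 2 - w) - ?y (real k * pi + pi / 2 + w)) * sin w)\<bar>
     \<le> X' * A (\<tau> (U k)) + e" for k
  proof -
    define c where "c = real k * pi + pi / 2"
    have "norm (integral {0..pi / 2} (\<lambda>w. (-1) ^ k * (?y (c - w) - ?y (c + w)) * sin w)) \<le>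
      integral {0..pi / 2} (\<lambda>w. A (\<tau> (U k)) * (\<omega> (2 * w / (real N - L)) * sin w) + e * sin w)"
    proof (rule integral_norm_bound_integral)
      fix w :: real assume w: "w \<in> {0..pi / 2}"
      have near: "\<bar>A (\<tau> v) - A (\<tau> (U k))\<bar> \<le> 2 * M / real N * pi" if "v \<in> {real k * pi..real (Suc k) * pi}" for v
      proof -
        have "\<bar>v - U k\<bar> \<le> pi" using that U(1)[of k] by (auto simp: abs_le_iff algebra_simps)
        then have "2 * M / real N * \<bar>v - U k\<bar> \<le> 2 * M / real N * pi" using M0 by (intro mult_left_mono) auto
        then show ?thesis using a_Lip[of v "U k"] by linarith
      qed
      have mem: "c - w \<in> {real k * pi..real (Suc k) * pi}" "c + w \<in> {real k * pi..real (Suc k) * pi}"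
        using w by (auto simp: c_def algebra_simps)
      have fd: "\<bar>f (\<tau> (c - w)) - f (\<tau> (c + w))\<bar> \<le> \<omega> (2 * w / (real N - L))"
      proof -
        have "\<bar>\<tau> (c - w) - \<tau> (c + w)\<bar> \<le> 2 * w / (real N - L)"
          using \<tau>_Lipschitz[of "c - w" "c + w"] w by simp
        then have "\<omega> \<bar>\<tau> (c - w) - \<tau> (c + w)\<bar> \<le> \<omega> (2 * w / (real N - L))"
          by (intro modulus_of_continuityD(2)[OF modulus(1)]) auto
        then show ?thesis using f(1) order_trans by blast
      qed
      have tri: "\<bar>D\<bar> \<le> a + e" if "D = P + (Q - R)" "\<bar>P\<bar> \<le> a" "\<bar>Q\<bar> \<le> b" "\<bar>R\<bar> \<le> b" "b + b = e" for D P Q R a b :: real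
        using that by linarith
      have eq: "?y (c - w) - ?y (c + w) = (f (\<tau> (c - w)) - f (\<tau> (c + w))) * A (\<tau> (U k)) +
         (f (\<tau> (c - w)) * (A (\<tau> (c - w)) - A (\<tau> (U k))) - f (\<tau> (c + w)) * (A (\<tau> (c + w)) - A (\<tau> (U k))))"
        by (simp add: algebra_simps)
      have P: "\<bar>(f (\<tau> (c - w)) - f (\<tau> (c + w))) * A (\<tau> (U k))\<bar> \<le> \<omega> (2 * w / (real N - L)) * A (\<tau> (U k))"
        unfolding abs_mult using fd A_bd by (intro mult_mono) auto
      have QR: "\<bar>f (\<tau> v) * (A (\<tau> v) - A (\<tau> (U k)))\<bar> \<le> \<Omega> * (2 * M / real N * pi)"
        if "v \<in> {real k * pi..real (Suc k) * pi}" for v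
        unfolding abs_mult using f(3) near[OF that] \<Omega> by (intro mult_mono) (auto simp: \<Omega>_def)
      have "\<Omega> * (2 * M / real N * pi) + \<Omega> * (2 * M / real N * pi) = e" by (simp add: e_def)
      from tri[OF eq P QR[OF mem(1)] QR[OF mem(2)] this]
      have "\<bar>?y (c - w) - ?y (c + w)\<bar> \<le> \<omega> (2 * w / (real N - L)) * A (\<tau> (U k)) + e" .
      moreover have "0 \<le> sin w" using w by (intro sin_ge_zero) auto
      ultimately have le: "\<bar>?y (c - w) - ?y (c + w)\<bar> * sin w \<le> (\<omega> (2 * w / (real N - L)) * A (\<tau> (U k)) + e) * sin w"
        by (intro mult_right_mono)
      have "norm ((-1) ^ k * D * sin w) = \<bar>D\<bar> * sin w" for D
        using \<open>0 \<le> sin w\<close> by (simp add: abs_mult)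
      moreover have "(\<omega> (2 * w / (real N - L)) * A (\<tau> (U k)) + e) * sin w = A (\<tau> (U k)) * (\<omega> (2 * w / (real N - L)) * sin w) + e * sin w"
        by (simp add: algebra_simps)
      ultimately show "norm ((-1) ^ k * (?y (c - w) - ?y (c + w)) * sin w) \<le> A (\<tau> (U k)) * (\<omega> (2 * w / (real N - L)) * sin w) + e * sin w"
        using le by (simp only:)
    qed (intro integrable_continuous_real continuous_on_mult continuous_on_add continuous_on_diff yc continuous_intros
        modulus_mean_integrand[OF modulus(1) NLpos])+
    also have "\<dots> = A (\<tau> (U k)) * X' + e"
      unfolding X'_def modulus_mean_def
      by (subst integral_add) (auto intro!: integrable_continuous_real continuous_intros modulus_mean_integrand[OF modulus(1) NLpos] simp: integral_sin_quarter)
    finally show ?thesis by (simp add: c_def mult.commute)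
  qed
  then have "\<bar>\<Sum>k<2 * N. integral {0..pi / 2} (\<lambda>w. (-1) ^ k * (?y (real k * pi + pi / 2 - w) - ?y (real k * pi + pi / 2 + w)) * sin w)\<bar>
     \<le> (\<Sum>k<2 * N. X' * A (\<tau> (U k)) + e)" by (intro sum_norm_le[where 'a = real, unfolded real_norm_def])
  moreover have "continuous_on UNIV (\<lambda>t. f t * A t)" by (intro continuous_on_mult fc A_cont)
  ultimately have Q: "\<bar>?Q\<bar> \<le> X' * (\<Sum>k<2 * N. A (\<tau> (U k))) + 2 * real N * e"
    by (subst paired_form) (simp_all add: f(2) A_per sum.distrib sum_distrib_left)
  have X: "0 \<le> X" "X \<le> \<Omega>" unfolding X_def \<Omega>_def by (intro modulus_mean_bounds modulus N_real)+
  have LN: "0 \<le> 2 * L / real N" "2 * L / real N \<le> 1" using L0 NL N_real by auto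
  have X': "X' \<le> X + 2 * L / real N * X" "X' \<le> 2 * \<Omega>"
  proof -
    show 1: "X' \<le> X + 2 * L / real N * X" using modulus_mean_shift(1) by (simp add: X_def X'_def algebra_simps)
    have "2 * L / real N * X \<le> 1 * X" using LN X by (intro mult_right_mono)
    then show "X' \<le> 2 * \<Omega>" using 1 X by linarith
  qed
  have IA: "0 \<le> IA" "IA / pi \<le> 2 * B" using integral_A_bounds by (auto simp: IA_def field_simps)
  have X'0: "0 \<le> X'"
  proof -
    have "0 \<le> \<omega> (2 * w / (real N - L)) * sin w" if "w \<in> {0..pi / 2}" for w
      using that NLpos by (intro mult_nonneg_nonneg modulus_of_continuityD(4)[OF modulus(1)] sin_ge_zero) auto
    then show ?thesis unfolding X'_def modulus_mean_def
      by (intro Henstock_Kurzweil_Integration.integral_nonneg integrable_continuous_real modulus_mean_integrand[OF modulus(1) NLpos])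
  qed
  have "X' * (\<Sum>k<2 * N. A (\<tau> (U k))) \<le> X' * (real N * (IA / pi) + 2 * L * B)"
    using U(2) X'0 by (intro mult_left_mono) (auto simp: IA_def abs_le_iff)
  also have "\<dots> \<le> X * (real N * (IA / pi)) + 2 * L * \<Omega> * (2 * B) + 2 * \<Omega> * (2 * L * B)"
  proof -
    have "X' * (real N * (IA / pi)) \<le> (X + 2 * L / real N * X) * (real N * (IA / pi))"
      using IA by (intro mult_right_mono X') auto
    also have "\<dots> = X * (real N * (IA / pi)) + 2 * L * X * (IA / pi)" using N_real by (simp add: field_simps)
    also have "2 * L * X * (IA / pi) \<le> 2 * L * \<Omega> * (2 * B)"
      using X IA L0 \<Omega> by (intro mult_mono) auto
    finally have "X' * (real N * (IA / pi)) \<le> X * (real N * (IA / pi)) + 2 * L * \<Omega> * (2 * B)" by simp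
    moreover have "X' * (2 * L * B) \<le> 2 * \<Omega> * (2 * L * B)" using L0 B0 X' by (intro mult_right_mono) auto
    ultimately show ?thesis unfolding distrib_left[of X'] by linarith
  qed
  finally have Q2: "\<bar>?Q\<bar> \<le> real N * (X * IA / pi) + 8 * L * \<Omega> * B + 8 * pi * \<Omega> * M"
    using Q N_real by (simp add: e_def algebra_simps)
  have "\<bar>real N * integral {0..2 * pi} (\<lambda>t. f t * A t * cos (\<Phi> t)) - ?Q\<bar> \<le> 2 * pi * \<Omega> * B * L"
    using derivative_replacement[OF fc, of \<Omega>] f(3) by (simp add: \<Omega>_def)
  then have "\<bar>real N * integral {0..2 * pi} (\<lambda>t. f t * A t * cos (\<Phi> t))\<bar> \<le>
     real N * (X * IA / pi) + 8 * L * \<Omega> * B + 8 * pi * \<Omega> * M + 2 * pi * \<Omega> * B * L" using Q2 by linarith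
  \<comment> \<open>Rounding with pi < 4: 8 + 2 pi \<le> 16 and 8 pi \<le> 32.\<close>
  also have "\<dots> \<le> real N * (X * IA / pi) + \<Omega> * (16 * L * B + 32 * M)"
  proof -
    have "pi * (\<Omega> * M) \<le> 4 * (\<Omega> * M)" "pi * (\<Omega> * B * L) \<le> 4 * (\<Omega> * B * L)"
      using pi_less_4 \<Omega> M0 B0 L0 by (auto intro!: mult_right_mono)
    then show ?thesis by (simp add: algebra_simps)
  qed
  also have "\<dots> = real N * (X * IA / pi + \<Omega> / real N * (16 * L * B + 32 * M))"
    using N_real by (simp add: distrib_left)
  finally have "real N * \<bar>integral {0..2 * pi} (\<lambda>t. f t * A t * cos (\<Phi> t))\<bar> \<le>
    real N * (X * IA / pi + \<Omega> / real N * (16 * L * B + 32 * M))" by (simp add: abs_mult)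
  then have "\<bar>integral {0..2 * pi} (\<lambda>t. f t * A t * cos (\<Phi> t))\<bar> \<le> X * IA / pi + \<Omega> / real N * (16 * L * B + 32 * M)"
    using N_real(2) by (rule mult_left_le_imp_le)
  then show ?thesis by (simp add: X_def IA_def \<Omega>_def)
qed

text \<open>The folded odd profile alternates with the cosine, so all half periods contribute with
  the same sign, and its increments at mirror points are exactly \<omega>(2w/(N+L)). The constants
  are kept equal to those of \<open>upper\<close>.\<close>

lemma lower:
  obtains f where "\<And>x y. \<bar>f x - f y\<bar> \<le> \<omega> \<bar>x - y\<bar>" "\<And>t. f (t + 2 * pi) = f t"
    "integral {0..2 * pi} (\<lambda>t. f t * A t * cos (\<Phi> t)) \<ge>
    modulus_mean \<omega> (real N) * integral {0..2 * pi} A / pi - \<omega> pi / real N * (16 * L * B + 32 * M)"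
proof -
  define \<Omega> where "\<Omega> = \<omega> pi"
  have \<Omega>: "0 \<le> \<Omega>" unfolding \<Omega>_def by (rule modulus_of_continuityD(4)[OF modulus(1)]) simp
  \<comment> \<open>N + L is the Lipschitz constant of the phase; dividing by it makes the argument
    of the odd profile 1-Lipschitz in t.\<close>
  define H where "H = (\<lambda>u. odd_modulus \<omega> (arcsin (cos u) / (real N + L)))"
  define f where "f = (\<lambda>t. H (\<Phi> t))"
  have NLp: "real N + L > 0" "real N + L \<ge> 1" using N_real L0 by linarith+
  have f1: "\<bar>f x - f y\<bar> \<le> \<omega> \<bar>x - y\<bar>" for x y
  proof -
    have "\<bar>f x - f y\<bar> \<le> \<omega> \<bar>arcsin (cos (\<Phi> x)) / (real N + L) - arcsin (cos (\<Phi> y)) / (real N + L)\<bar>"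
      unfolding f_def H_def by (rule odd_modulus_bound[OF modulus])
    also have "\<dots> \<le> \<omega> \<bar>x - y\<bar>"
    proof (rule modulus_of_continuityD(2)[OF modulus(1)])
      have "\<bar>\<Phi> x - \<Phi> y\<bar> \<le> (real N + L) * \<bar>x - y\<bar>"
        by (rule phase_Lipschitz)
      then have "\<bar>arcsin (cos (\<Phi> x)) - arcsin (cos (\<Phi> y))\<bar> \<le> (real N + L) * \<bar>x - y\<bar>"
        using arcsin_cos_Lipschitz[of "\<Phi> x" "\<Phi> y"] by linarith
      then show "\<bar>arcsin (cos (\<Phi> x)) / (real N + L) - arcsin (cos (\<Phi> y)) / (real N + L)\<bar> \<le> \<bar>x - y\<bar>"
        using NLp by (simp add: pos_divide_le_eq mult.commute flip: diff_divide_distrib)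
    qed simp
    finally show ?thesis .
  qed
  have f2: "f (t + 2 * pi) = f t" for t
    using periodic_shift_int[of cos "2 * pi" "\<Phi> t" "int N"] by (simp add: f_def H_def shift)
  have f3: "\<bar>f t\<bar> \<le> \<Omega>" for t
  proof -
    have "\<bar>f t\<bar> \<le> \<omega> \<bar>arcsin (cos (\<Phi> t)) / (real N + L)\<bar>"
      using odd_modulus_bound[OF modulus, of "arcsin (cos (\<Phi> t)) / (real N + L)" 0] by (simp add: f_def H_def odd_modulus_def)
    also have "\<dots> \<le> \<omega> pi"
    proof (rule modulus_of_continuityD(2)[OF modulus(1)])
      have "\<bar>arcsin (cos (\<Phi> t))\<bar> \<le> pi" using arcsin_bounded[of "cos (\<Phi> t)"] by (auto simp: abs_le_iff)
      then have "\<bar>arcsin (cos (\<Phi> t))\<bar> / (real N + L) \<le> pi / 1" using NLp by (intro frac_le) auto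
      then show "\<bar>arcsin (cos (\<Phi> t)) / (real N + L)\<bar> \<le> pi" using NLp by simp
    qed simp
    finally show ?thesis by (simp add: \<Omega>_def)
  qed
  note fc = modulus_bound_imp_continuous[OF modulus(1) f1]
  obtain U where U: "\<And>k. U k \<in> {real k * pi..real (Suc k) * pi}"
    "\<bar>(\<Sum>k<2 * N. A (\<tau> (U k))) - real N * integral {0..2 * pi} A / pi\<bar> \<le> 2 * L * B"
    using mean_points by blast
  define X where "X = modulus_mean \<omega> (real N)"
  define X' where "X' = modulus_mean \<omega> (real N + L)"
  define IA where "IA = integral {0..2 * pi} A"
  define e where "e = 2 * pi * M / real N"
  let ?Q = "integral {0..2 * pi} (\<lambda>t. (f t * A t) * cos (\<Phi> t) * \<Phi>' t)"
  let ?y = "\<lambda>u. f (\<tau> u) * A (\<tau> u)"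
  have yc: "continuous_on S (\<lambda>w. ?y (g w))" if "continuous_on S g" for S and g :: "real \<Rightarrow> real"
    by (intro continuous_on_mult continuous_on_compose2[OF fc[of UNIV]] continuous_on_compose2[OF A_cont[of UNIV]]
        continuous_on_compose2[OF \<tau>_continuous[of UNIV] that]) auto
  have "integral {0..pi / 2} (\<lambda>w. (-1) ^ k * (?y (real k * pi + pi / 2 - w) - ?y (real k * pi + pi / 2 + w)) * sin w)
     \<ge> (A (\<tau> (U k)) - e) * X'" for k
  proof -
    define c where "c = real k * pi + pi / 2"
    have "integral {0..pi / 2} (\<lambda>w. (A (\<tau> (U k)) - e) * (\<omega> (2 * w / (real N + L)) * sin w)) \<le>
      integral {0..pi / 2} (\<lambda>w. (-1) ^ k * (?y (c - w) - ?y (c + w)) * sin w)"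
    proof (rule integral_le)
      fix w :: real assume w: "w \<in> {0..pi / 2}"
      have near: "A (\<tau> (U k)) - e \<le> A (\<tau> v)" if "v \<in> {real k * pi..real (Suc k) * pi}" for v
      proof -
        have "\<bar>v - U k\<bar> \<le> pi" using that U(1)[of k] by (auto simp: abs_le_iff algebra_simps)
        then have "2 * M / real N * \<bar>v - U k\<bar> \<le> 2 * M / real N * pi" using M0 by (intro mult_left_mono) auto
        then show ?thesis using a_Lip[of v "U k"] by (simp add: e_def mult_ac abs_le_iff)
      qed
      have mem: "c - w \<in> {real k * pi..real (Suc k) * pi}" "c + w \<in> {real k * pi..real (Suc k) * pi}"
        using w by (auto simp: c_def algebra_simps)
      have sg: "cos (c + v) = - ((-1) ^ k * sin v)" for v
        unfolding c_def by (rule cos_odd_quarter)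
      define h where "h = odd_modulus \<omega> (w / (real N + L))"
      have h: "h = \<omega> (2 * w / (real N + L)) / 2"
        using w NLp modulus_of_continuityD(3)[OF modulus(1)] by (auto simp: h_def odd_modulus_def sgn_if)
      have as: "arcsin (sin w) = w" using w by (intro arcsin_sin) auto
      \<comment> \<open>At phase c - w or c + w the cosine is \<open>sin w\<close> up to sign, and
        its arcsine recovers \<open>w\<close> because \<open>w\<close> \<le> pi/2.\<close>
      have fm: "f (\<tau> (c - w)) = (-1) ^ k * h" and fp: "f (\<tau> (c + w)) = - ((-1) ^ k * h)"
        using sg[of "- w"] sg[of w]
        by (cases "even k"; simp add: f_def H_def \<Phi>_\<tau> arcsin_minus as h_def odd_modulus_minus)+
      have "(-1) ^ k * (?y (c - w) - ?y (c + w)) = h * A (\<tau> (c - w)) + h * A (\<tau> (c + w))"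
        unfolding fm fp by (cases "even k") (auto simp: algebra_simps)
      moreover have h0: "0 \<le> h" unfolding h using w NLp
        by (intro divide_nonneg_pos modulus_of_continuityD(4)[OF modulus(1)]) auto
      moreover have "h * (A (\<tau> (U k)) - e) \<le> h * A (\<tau> (c - w))" "h * (A (\<tau> (U k)) - e) \<le> h * A (\<tau> (c + w))"
        using near mem h0 by (auto intro!: mult_left_mono)
      ultimately have "2 * h * (A (\<tau> (U k)) - e) \<le> (-1) ^ k * (?y (c - w) - ?y (c + w))" by linarith
      moreover have "0 \<le> sin w" using w by (intro sin_ge_zero) auto
      ultimately have "(2 * h * (A (\<tau> (U k)) - e)) * sin w \<le> ((-1) ^ k * (?y (c - w) - ?y (c + w))) * sin w"
        by (intro mult_right_mono)
      then show "(A (\<tau> (U k)) - e) * (\<omega> (2 * w / (real N + L)) * sin w) \<le> (-1) ^ k * (?y (c - w) - ?y (c + w)) * sin w"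
        by (simp add: h mult_ac)
    qed (intro integrable_continuous_real continuous_on_mult continuous_on_diff yc continuous_intros
        modulus_mean_integrand[OF modulus(1) NLp(1)])+
    then show ?thesis by (simp add: X'_def modulus_mean_def c_def)
  qed
  then have "(\<Sum>k<2 * N. (A (\<tau> (U k)) - e) * X') \<le> (\<Sum>k<2 * N. integral {0..pi / 2}
      (\<lambda>w. (-1) ^ k * (?y (real k * pi + pi / 2 - w) - ?y (real k * pi + pi / 2 + w)) * sin w))"
    by (intro sum_mono)
  moreover have "continuous_on UNIV (\<lambda>t. f t * A t)" by (intro continuous_on_mult fc A_cont)
  ultimately have Q: "((\<Sum>k<2 * N. A (\<tau> (U k))) - 2 * real N * e) * X' \<le> ?Q"
    by (subst paired_form) (simp_all add: f2 A_per sum_subtractf flip: sum_distrib_right)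
  have X: "0 \<le> X" "X \<le> \<Omega>" unfolding X_def \<Omega>_def by (intro modulus_mean_bounds modulus N_real)+
  have X': "0 \<le> X'" "X' \<le> \<Omega>" unfolding X'_def \<Omega>_def by (intro modulus_mean_bounds modulus NLp)+
  have X1: "X \<le> X' + L / real N * X'" using modulus_mean_shift(2) by (simp add: X_def X'_def algebra_simps)
  have IA: "0 \<le> IA" "IA / pi \<le> 2 * B" using integral_A_bounds by (auto simp: IA_def field_simps)
  have "real N * (X * IA / pi) - \<Omega> * (4 * L * B + 4 * pi * M) \<le> (real N * (IA / pi) - 2 * L * B - 4 * pi * M) * X'"
  proof -
    have "X * (real N * (IA / pi)) \<le> (X' + L / real N * X') * (real N * (IA / pi))"
      using IA by (intro mult_right_mono X1) auto
    also have "\<dots> = X' * (real N * (IA / pi)) + L * X' * (IA / pi)" using N_real by (simp add: field_simps)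
    also have "L * X' * (IA / pi) \<le> L * \<Omega> * (2 * B)" using X' IA L0 \<Omega> by (intro mult_mono) auto
    finally have "X * (real N * (IA / pi)) \<le> X' * (real N * (IA / pi)) + L * \<Omega> * (2 * B)" by simp
    moreover have "(2 * L * B + 4 * pi * M) * X' \<le> (2 * L * B + 4 * pi * M) * \<Omega>"
      using L0 B0 M0 X' by (intro mult_left_mono) auto
    ultimately show ?thesis by (simp add: algebra_simps)
  qed
  also have "\<dots> \<le> ((\<Sum>k<2 * N. A (\<tau> (U k))) - 2 * real N * e) * X'"
    using U(2) X' N_real by (intro mult_right_mono) (auto simp: IA_def e_def abs_le_iff)
  finally have Q2: "real N * (X * IA / pi) - \<Omega> * (4 * L * B + 4 * pi * M) \<le> ?Q" using Q by linarith
  have "\<bar>real N * integral {0..2 * pi} (\<lambda>t. f t * A t * cos (\<Phi> t)) - ?Q\<bar> \<le> 2 * pi * \<Omega> * B * L"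
    by (rule derivative_replacement[OF fc f3])
  then have "real N * (X * IA / pi) - \<Omega> * (4 * L * B + 4 * pi * M) - 2 * pi * \<Omega> * B * L \<le>
    real N * integral {0..2 * pi} (\<lambda>t. f t * A t * cos (\<Phi> t))" using Q2 by linarith
  moreover have "real N * (X * IA / pi) - \<Omega> * (16 * L * B + 32 * M) \<le>
    real N * (X * IA / pi) - \<Omega> * (4 * L * B + 4 * pi * M) - 2 * pi * \<Omega> * B * L"
  proof -
    have "pi * (\<Omega> * M) \<le> 4 * (\<Omega> * M)" "pi * (\<Omega> * B * L) \<le> 4 * (\<Omega> * B * L)"
      using pi_less_4 \<Omega> M0 B0 L0 by (auto intro!: mult_right_mono)
    moreover have "0 \<le> \<Omega> * M" "0 \<le> \<Omega> * B * L" using \<Omega> M0 B0 L0 by auto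
    ultimately show ?thesis by (simp add: algebra_simps)
  qed
  moreover have "real N * (X * IA / pi) - \<Omega> * (16 * L * B + 32 * M) = real N * (X * IA / pi - \<Omega> / real N * (16 * L * B + 32 * M))"
    using N_real by (simp add: right_diff_distrib)
  ultimately have "real N * (X * IA / pi - \<Omega> / real N * (16 * L * B + 32 * M)) \<le>
    real N * integral {0..2 * pi} (\<lambda>t. f t * A t * cos (\<Phi> t))" by linarith
  then have "X * IA / pi - \<Omega> / real N * (16 * L * B + 32 * M) \<le> integral {0..2 * pi} (\<lambda>t. f t * A t * cos (\<Phi> t))"
    using N_real(2) by (rule mult_left_le_imp_le)
  then show ?thesis using that[of f] f1 f2 by (simp add: X_def IA_def \<Omega>_def)
qed

end

section \<open>Amplitude and phase of the kernel\<close>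

lemma one_minus_cis_square: "(1 - r * cos t)\<^sup>2 + (r * sin t)\<^sup>2 = 1 - 2 * r * cos t + r\<^sup>2" for r t :: real
  unfolding power_mult_distrib sin_squared_eq by (simp add: power2_eq_square algebra_simps)

lemma cmod_one_minus_cis: "cmod (1 - of_real r * cis t) = sqrt (1 - 2 * r * cos t + r\<^sup>2)"
  using one_minus_cis_square[of r t] by (simp add: cmod_def)

lemma one_minus_cis_square_pos:
  fixes r t :: real
  assumes "0 \<le> r" "r < 1"
  shows "(1 - r)\<^sup>2 \<le> 1 - 2 * r * cos t + r\<^sup>2" "0 < 1 - 2 * r * cos t + r\<^sup>2" "0 < 1 - r * cos t"
proof -
  have rc: "r * cos t \<le> r * 1" using assms by (intro mult_left_mono) auto
  then show "(1 - r)\<^sup>2 \<le> 1 - 2 * r * cos t + r\<^sup>2" by (simp add: power2_eq_square algebra_simps)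
  moreover have "0 < (1 - r)\<^sup>2" using assms by simp
  ultimately show "0 < 1 - 2 * r * cos t + r\<^sup>2" by linarith
  show "0 < 1 - r * cos t" using rc assms by linarith
qed

lemma one_minus_cis_square_nonzero:
  fixes r t :: real
  assumes "0 \<le> r" "r < 1"
  shows "1 - 2 * r * cos t + r\<^sup>2 \<noteq> 0"
  using one_minus_cis_square_pos(2)[OF assms, of t] by linarith

text \<open>Identifies the modulus of the kernel with the function whose norm defines
  \<open>K_const\<close>.\<close>

lemma cmod_kern:
  "cmod (kern q p t) = sqrt (1 - 2 * q ^ p * cos (real p * t) + q ^ (2 * p)) / (1 - 2 * q * cos t + q\<^sup>2)" if "0 < q" "q < 1"
proof -
  have "cmod (kern q p t) = cmod (1 - of_real (q ^ p) * cis (real p * t)) / (cmod (1 - of_real q * cis t))\<^sup>2"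
    unfolding kern_def cis_scaled_power by (simp add: norm_divide norm_power)
  also have "\<dots> = sqrt (1 - 2 * q ^ p * cos (real p * t) + (q ^ p)\<^sup>2) / (1 - 2 * q * cos t + q\<^sup>2)"
    unfolding cmod_one_minus_cis using one_minus_cis_square_pos(2)[of q t] that by simp
  also have "(q ^ p)\<^sup>2 = q ^ (2 * p)" by (metis mult.commute power_mult)
  finally show ?thesis .
qed

text \<open>Minus the argument of 1 - r exp(it). The real part 1 - r cos t is positive for 0 \<le> r
  < 1, so the arctangent gives a smooth periodic branch.\<close>

definition disc_arg :: "real \<Rightarrow> real \<Rightarrow> real" where
  "disc_arg r t = arctan (r * sin t / (1 - r * cos t))"

lemma disc_arg:
  assumes r: "0 \<le> r" "r < 1"
  shows "1 - of_real r * cis t = of_real (cmod (1 - of_real r * cis t)) * cis (- disc_arg r t)"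
proof -
  define x y where "x = 1 - r * cos t" and "y = r * sin t"
  have x: "x > 0" using one_minus_cis_square_pos(3)[OF r] by (simp add: x_def)
  have xy: "cmod (1 - of_real r * cis t) = sqrt (x\<^sup>2 + y\<^sup>2)" by (simp add: cmod_def x_def y_def)
  have "x\<^sup>2 + y\<^sup>2 = x\<^sup>2 * (1 + (y / x)\<^sup>2)" using x by (simp add: power_divide distrib_left)
  then have s: "sqrt (x\<^sup>2 + y\<^sup>2) = x * sqrt (1 + (y / x)\<^sup>2)" using x by (simp add: real_sqrt_mult)
  have s0: "sqrt (1 + (y / x)\<^sup>2) > 0" by (simp add: add_pos_nonneg)
  have "sqrt (x\<^sup>2 + y\<^sup>2) * cos (arctan (y / x)) = x" "sqrt (x\<^sup>2 + y\<^sup>2) * sin (arctan (y / x)) = y"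
    unfolding s cos_arctan sin_arctan using s0 x by (auto simp: field_simps)
  then show ?thesis
    unfolding xy disc_arg_def by (intro complex_eqI) (simp_all add: x_def y_def)
qed

lemma disc_arg_derivative:
  assumes r: "0 \<le> r" "r < 1"
  shows "(disc_arg r has_real_derivative r * (cos t - r) / (1 - 2 * r * cos t + r\<^sup>2)) (at t)"
proof -
  define x y where "x = 1 - r * cos t" and "y = r * sin t"
  note P = one_minus_cis_square_pos[OF r, of t]
  have x: "x \<noteq> 0" using P(3) by (simp add: x_def)
  have xy: "x\<^sup>2 + y\<^sup>2 = 1 - 2 * r * cos t + r\<^sup>2"
    unfolding x_def y_def by (rule one_minus_cis_square)
  have num: "r * cos t * x - y * (r * sin t) = r * (cos t - r)"
  proof -
    have "r * cos t * x - y * (r * sin t) = r * cos t - r\<^sup>2 * (cos t)\<^sup>2 - r\<^sup>2 * (sin t)\<^sup>2"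
      unfolding x_def y_def by (simp add: power2_eq_square algebra_simps)
    then show ?thesis unfolding sin_squared_eq by (simp add: power2_eq_square algebra_simps)
  qed
  have "((\<lambda>t. arctan (r * sin t / (1 - r * cos t))) has_real_derivative
     (1 / (1 + (y / x)\<^sup>2)) * ((r * cos t * x - y * (r * sin t)) / (x * x))) (at t)"
    using x unfolding x_def y_def
    by (auto intro!: derivative_eq_intros simp: inverse_eq_divide)
  moreover have "(1 / (1 + (y / x)\<^sup>2)) * ((r * cos t * x - y * (r * sin t)) / (x * x)) = (r * (cos t - r)) / (x\<^sup>2 + y\<^sup>2)"
    unfolding num using x by (simp add: power_divide power2_eq_square add_divide_eq_iff)
  ultimately show ?thesis unfolding disc_arg_def[abs_def] xy by simp
qed

text \<open>With d = \<bar>1 - r exp(it)\<bar> one has d^2 - (cos t - r)^2 = (sin t)^2, so the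
  quotient is at most r/d, and d \<ge> 1 - r.\<close>

lemma disc_arg_derivative_bound:
  fixes r t :: real
  assumes r: "0 \<le> r" "r < 1"
  shows "\<bar>r * (cos t - r) / (1 - 2 * r * cos t + r\<^sup>2)\<bar> \<le> r / (1 - r)"
proof -
  note P = one_minus_cis_square_pos[OF r, of t]
  define d where "d = sqrt (1 - 2 * r * cos t + r\<^sup>2)"
  have d2: "d\<^sup>2 = 1 - 2 * r * cos t + r\<^sup>2" and d0: "d > 0" using P by (auto simp: d_def)
  have dr: "1 - r \<le> d" unfolding d_def using r P(1) by (intro real_le_rsqrt)
  have "(cos t - r)\<^sup>2 \<le> d\<^sup>2"
  proof -
    have "d\<^sup>2 - (cos t - r)\<^sup>2 = 1 - (cos t)\<^sup>2" unfolding d2 by (simp add: power2_eq_square algebra_simps)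
    also have "\<dots> \<ge> 0" by (simp add: abs_square_le_1)
    finally show ?thesis by simp
  qed
  then have "\<bar>cos t - r\<bar> \<le> d" using d0 by (simp add: abs_le_square_iff[symmetric])
  then have "r * \<bar>cos t - r\<bar> / d\<^sup>2 \<le> r * d / d\<^sup>2" using r d0 by (intro divide_right_mono mult_left_mono) auto
  also have "\<dots> = r / d" using d0 by (simp add: power2_eq_square)
  also have "\<dots> \<le> r / (1 - r)" using r dr by (intro divide_left_mono) auto
  finally show ?thesis using r d0 unfolding d2[symmetric] by (simp add: abs_mult)
qed

definition kern_arg :: "real \<Rightarrow> nat \<Rightarrow> real \<Rightarrow> real" where
  "kern_arg q p t = 2 * disc_arg q t - disc_arg (q ^ p) (real p * t)"

definition kern_arg_deriv :: "real \<Rightarrow> nat \<Rightarrow> real \<Rightarrow> real" where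
  "kern_arg_deriv q p t = 2 * (q * (cos t - q) / (1 - 2 * q * cos t + q\<^sup>2)) -
     (q ^ p * (cos (real p * t) - q ^ p) / (1 - 2 * q ^ p * cos (real p * t) + (q ^ p)\<^sup>2)) * real p"

lemma power_less_one: "0 < q \<Longrightarrow> q < 1 \<Longrightarrow> p \<ge> 1 \<Longrightarrow> 0 \<le> q ^ p \<and> q ^ p < (1 :: real)"
  by (simp add: power_less_one_iff)

lemma kern_polar:
  assumes q: "0 < q" "q < 1" and p: "p \<ge> 1"
  shows "kern q p t = of_real (cmod (kern q p t)) * cis (kern_arg q p t)"
proof -
  define a b where "a = cmod (1 - of_real q * cis t)" and "b = cmod (1 - of_real (q ^ p) * cis (real p * t))"
  have a: "a \<noteq> 0" using one_minus_cis_nonzero[OF q] by (simp add: a_def)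
  have 1: "1 - of_real q * cis t = of_real a * cis (- disc_arg q t)"
    unfolding a_def using q by (intro disc_arg) auto
  have 2: "1 - of_real (q ^ p) * cis (real p * t) = of_real b * cis (- disc_arg (q ^ p) (real p * t))"
    unfolding b_def using power_less_one[OF q p] by (intro disc_arg) auto
  have "kern q p t = (of_real b * cis (- disc_arg (q ^ p) (real p * t))) / (of_real a * cis (- disc_arg q t))\<^sup>2"
    unfolding kern_def cis_scaled_power 1[symmetric] 2[symmetric] ..
  also have "\<dots> = of_real (b / a\<^sup>2) * (cis (- disc_arg (q ^ p) (real p * t)) / cis (- disc_arg q t) ^ 2)"
    by (simp add: power_mult_distrib)
  also have "cis (- disc_arg (q ^ p) (real p * t)) / cis (- disc_arg q t) ^ 2 = cis (kern_arg q p t)"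
    by (simp add: Complex.DeMoivre cis_divide kern_arg_def algebra_simps)
  finally have eq: "kern q p t = of_real (b / a\<^sup>2) * cis (kern_arg q p t)" .
  have "0 \<le> b" by (simp add: b_def)
  then have "cmod (kern q p t) = b / a\<^sup>2" unfolding eq norm_mult norm_of_real norm_cis by simp
  then show ?thesis using eq by simp
qed

text \<open>The squared denominator contributes 2/(1-q). The numerator contributes p q^p / (1 -
  q^p), which stays below 1/(1-q) for every \<open>p\<close>, since p q^p is at most the geometric
  sum 1 + q + ... + q^(p-1).\<close>

lemma kern_arg_derivative:
  assumes q: "0 < q" "q < 1" and p: "p \<ge> 1"
  shows "(kern_arg q p has_real_derivative kern_arg_deriv q p t) (at t)"
    and "continuous_on S (kern_arg_deriv q p)"
    and "\<bar>kern_arg_deriv q p t\<bar> \<le> 3 / (1 - q)"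
proof -
  note r = power_less_one[OF q p]
  have "((\<lambda>t. disc_arg (q ^ p) (real p * t)) has_real_derivative
      (q ^ p * (cos (real p * t) - q ^ p) / (1 - 2 * q ^ p * cos (real p * t) + (q ^ p)\<^sup>2)) * real p) (at t)"
    by (rule DERIV_chain2[OF disc_arg_derivative]) (use r in \<open>auto intro!: derivative_eq_intros\<close>)
  then show "(kern_arg q p has_real_derivative kern_arg_deriv q p t) (at t)"
    unfolding kern_arg_def[abs_def] kern_arg_deriv_def using q
    by (intro DERIV_diff DERIV_cmult disc_arg_derivative) auto
  show "continuous_on S (kern_arg_deriv q p)"
    unfolding kern_arg_deriv_def[abs_def]
    using q r by (intro continuous_intros ballI one_minus_cis_square_nonzero) auto
  have pq: "real p * (q ^ p / (1 - q ^ p)) \<le> 1 / (1 - q)"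
  proof -
    have "(\<Sum>i<p. q ^ p) \<le> (\<Sum>i<p. q ^ i)"
      using q by (intro sum_mono power_decreasing) auto
    then have "real p * q ^ p \<le> (1 - q ^ p) / (1 - q)" using q by (simp add: sum_gp_strict)
    then show ?thesis using q r by (simp add: field_simps)
  qed
  have "\<bar>kern_arg_deriv q p t\<bar> \<le> 2 * (q / (1 - q)) + (q ^ p / (1 - q ^ p)) * real p"
  proof -
    have "\<bar>2 * (q * (cos t - q) / (1 - 2 * q * cos t + q\<^sup>2))\<bar> \<le> 2 * (q / (1 - q))"
      using disc_arg_derivative_bound[of q t] q by (simp only: abs_mult) auto
    moreover have "\<bar>(q ^ p * (cos (real p * t) - q ^ p) / (1 - 2 * q ^ p * cos (real p * t) + (q ^ p)\<^sup>2)) * real p\<bar> \<le> (q ^ p / (1 - q ^ p)) * real p"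
      unfolding abs_mult[of _ "real p"] abs_of_nat using disc_arg_derivative_bound[of "q ^ p" "real p * t"] r by (intro mult_right_mono) auto
    ultimately show ?thesis unfolding kern_arg_deriv_def by linarith
  qed
  also have "\<dots> \<le> 2 * (1 / (1 - q)) + 1 / (1 - q)"
  proof -
    have 1: "2 * (q / (1 - q)) \<le> 2 * (1 / (1 - q))" using q by (intro mult_left_mono divide_right_mono) auto
    have 2: "(q ^ p / (1 - q ^ p)) * real p \<le> 1 / (1 - q)" using pq by (subst mult.commute)
    show ?thesis by (rule add_mono[OF 1 2])
  qed
  finally show "\<bar>kern_arg_deriv q p t\<bar> \<le> 3 / (1 - q)" by simp
qed

lemma disc_arg_periodic: "disc_arg r (t + real n * (2 * pi)) = disc_arg r t"
  using periodic_shift_int[of "disc_arg r" "2 * pi" t "int n"] by (simp add: disc_arg_def)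

lemma kern_arg_periodic: "kern_arg q p (t + 2 * pi) = kern_arg q p t"
proof -
  have "real p * (t + 2 * pi) = real p * t + real p * (2 * pi)" by (simp add: algebra_simps)
  then show ?thesis using disc_arg_periodic[of q t 1] disc_arg_periodic[of "q ^ p" "real p * t" p]
    by (simp add: kern_arg_def)
qed

section \<open>Poisson integrals and dilation\<close>

lemma poisson_kernel_sums:
  assumes q: "0 \<le> q" "q < 1"
  shows "(\<lambda>k. (if k = 0 then 1 else 2) * q ^ k * cos (real k * t)) sums ((1 - q\<^sup>2) / (1 - 2 * q * cos t + q\<^sup>2))"
proof -
  define z where "z = of_real q * cis t"
  have z: "norm z < 1" using q by (simp add: z_def norm_mult)
  have d: "1 - 2 * q * cos t + q\<^sup>2 > 0" using one_minus_cis_square_pos(2)[OF q] .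
  have "(\<lambda>k. Re (z ^ k)) sums Re (1 / (1 - z))" by (intro sums_Re geometric_sums z)
  moreover have "Re (z ^ k) = q ^ k * cos (real k * t)" for k
    unfolding z_def cis_scaled_power by simp
  moreover have "Re (1 / (1 - z)) = (1 - q * cos t) / (1 - 2 * q * cos t + q\<^sup>2)"
  proof -
    have "(1 - q * cos t)\<^sup>2 + (q * sin t)\<^sup>2 = 1 - 2 * q * cos t + q\<^sup>2" by (rule one_minus_cis_square)
    then show ?thesis by (simp add: Re_divide z_def)
  qed
  ultimately have s: "(\<lambda>k. q ^ k * cos (real k * t)) sums ((1 - q * cos t) / (1 - 2 * q * cos t + q\<^sup>2))" by simp
  have "(\<lambda>k. 2 * (q ^ k * cos (real k * t)) - (if k = 0 then 1 else 0)) sums (2 * ((1 - q * cos t) / (1 - 2 * q * cos t + q\<^sup>2)) - 1)"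
    by (intro sums_diff sums_mult s) (use sums_single[of 0 "\<lambda>_. 1 :: real"] in simp)
  moreover have "2 * ((1 - q * cos t) / (1 - 2 * q * cos t + q\<^sup>2)) - 1 = (1 - q\<^sup>2) / (1 - 2 * q * cos t + q\<^sup>2)"
    using d by (simp add: field_simps)
  moreover have "2 * (q ^ k * cos (real k * t)) - (if k = 0 then 1 else 0) = (if k = 0 then 1 else 2) * q ^ k * cos (real k * t)" for k
    by simp
  ultimately show ?thesis by simp
qed

lemma poisson_integral_sums:
  fixes f :: "real \<Rightarrow> real"
  assumes q: "0 \<le> q" "q < 1" and f: "continuous_on UNIV f"
  shows "(\<lambda>k. (if k = 0 then 1 else 2) * q ^ k * integral {0..2 * pi} (\<lambda>t. f t * cos (real k * t))) sums
    integral {0..2 * pi} (\<lambda>t. f t * ((1 - q\<^sup>2) / (1 - 2 * q * cos t + q\<^sup>2)))"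
proof -
  let ?u = "\<lambda>k t. (if k = 0 then 1 else 2) * q ^ k * cos (real k * t)"
  have fc[continuous_intros]: "continuous_on S f" for S using f continuous_on_subset by blast
  have "(\<lambda>k. LINT t:{0..2 * pi}|lebesgue. f t * ?u k t) sums (LINT t:{0..2 * pi}|lebesgue. f t * (\<Sum>k. ?u k t))"
  proof (rule set_integral_sums_bounded)
    show "set_integrable lebesgue {0..2 * pi} f" by (intro set_integrable_continuous_Icc fc)
    show "?u k \<in> borel_measurable lebesgue" for k by (intro borel_measurable_lebesgue_continuous continuous_intros)
    show "\<bar>?u k t\<bar> \<le> 2 * q ^ k" for k t
    proof -
      have "\<bar>?u k t\<bar> \<le> (2 * q ^ k) * 1" unfolding abs_mult using q by (intro mult_mono) auto
      then show ?thesis by simp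
    qed
    show "summable (\<lambda>k. 2 * q ^ k)" using q by (intro summable_mult summable_geometric) auto
  qed
  moreover have "(\<Sum>k. ?u k t) = (1 - q\<^sup>2) / (1 - 2 * q * cos t + q\<^sup>2)" for t
    using poisson_kernel_sums[OF q, of t] by (simp add: sums_iff)
  moreover have "(LINT t:{0..2 * pi}|lebesgue. f t * ((1 - q\<^sup>2) / (1 - 2 * q * cos t + q\<^sup>2))) =
    integral {0..2 * pi} (\<lambda>t. f t * ((1 - q\<^sup>2) / (1 - 2 * q * cos t + q\<^sup>2)))"
    by (rule set_integrable_continuous_Icc) (intro continuous_intros ballI one_minus_cis_square_nonzero q)
  moreover have "(LINT t:{0..2 * pi}|lebesgue. f t * ?u k t) = (if k = 0 then 1 else 2) * q ^ k * integral {0..2 * pi} (\<lambda>t. f t * cos (real k * t))" for k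
  proof -
    have "(LINT t:{0..2 * pi}|lebesgue. f t * ?u k t) = (LINT t:{0..2 * pi}|lebesgue. ((if k = 0 then 1 else 2) * q ^ k) * (f t * cos (real k * t)))"
      by (simp only: mult_ac)
    also have "\<dots> = ((if k = 0 then 1 else 2) * q ^ k) * (LINT t:{0..2 * pi}|lebesgue. f t * cos (real k * t))"
      by (rule set_integral_mult_right)
    also have "(LINT t:{0..2 * pi}|lebesgue. f t * cos (real k * t)) = integral {0..2 * pi} (\<lambda>t. f t * cos (real k * t))"
      by (intro set_integrable_continuous_Icc continuous_intros)
    finally show ?thesis .
  qed
  ultimately show ?thesis by simp
qed

lemma poisson_kernel_integral:
  assumes q: "0 \<le> q" "q < 1"
  shows "integral {0..2 * pi} (\<lambda>t. (1 - q\<^sup>2) / (1 - 2 * q * cos t + q\<^sup>2)) = 2 * pi"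
proof -
  have "(\<lambda>k. (if k = 0 then 1 else 2) * q ^ k * integral {0..2 * pi} (\<lambda>t. 1 * cos (real k * t))) sums
    integral {0..2 * pi} (\<lambda>t. 1 * ((1 - q\<^sup>2) / (1 - 2 * q * cos t + q\<^sup>2)))"
    by (rule poisson_integral_sums[OF q]) simp
  moreover have "(if k = 0 then 1 else 2) * q ^ k * integral {0..2 * pi} (\<lambda>t. 1 * cos (real k * t)) = (if k = 0 then 2 * pi else 0)" for k
    using integral_cos_frequency[of "int k" 0] by simp
  ultimately have "(\<lambda>k. if k = 0 then 2 * pi else 0) sums integral {0..2 * pi} (\<lambda>t. 1 * ((1 - q\<^sup>2) / (1 - 2 * q * cos t + q\<^sup>2)))"
    by (simp only:)
  from sums_unique2[OF this sums_single[of 0 "\<lambda>_. 2 * pi"]] show ?thesis by simp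
qed

lemma integral_dilated:
  fixes f :: "real \<Rightarrow> real"
  assumes f: "continuous_on UNIV f" "\<And>t. f (t + 2 * pi) = f t" and p: "p \<ge> 1"
  shows "integral {0..2 * pi} (\<lambda>t. f (real p * t)) = integral {0..2 * pi} f"
proof -
  have "((\<lambda>t. (\<lambda>k. f) (step_index p t) (real p * t)) has_integral (\<Sum>k<p. integral {0..2 * pi} f) / real p) {0..2 * pi}"
    by (rule step_function_has_integral[OF p]) (use f in auto)
  then show ?thesis using p by (simp add: integral_unique)
qed

text \<open>Translation by 2 pi/p leaves f(p t) fixed and rotates the vector of cosine and sine
  integrals by 2 pi k/p. This is not a multiple of 2 pi, so the vector is zero.\<close>

lemma integral_dilated_cos_eq_0:
  fixes f :: "real \<Rightarrow> real"
  assumes f: "continuous_on UNIV f" "\<And>t. f (t + 2 * pi) = f t" and p: "p \<ge> 1" and k: "\<not> p dvd k"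
  shows "integral {0..2 * pi} (\<lambda>t. f (real p * t) * cos (real k * t)) = 0"
proof -
  define h where "h = 2 * pi / real p"
  define I where "I = integral {0..2 * pi} (\<lambda>t. f (real p * t) * cos (real k * t))"
  define J where "J = integral {0..2 * pi} (\<lambda>t. f (real p * t) * sin (real k * t))"
  have fc[continuous_intros]: "continuous_on S (\<lambda>t. f (g t))" if "continuous_on S g" for S and g :: "real \<Rightarrow> real"
    by (rule continuous_on_compose2[OF f(1) that]) auto
  have fp: "f (real p * (h + t)) = f (real p * t)" for t
    using f(2)[of "real p * t"] p by (simp add: h_def algebra_simps)
  have fper: "f (real p * (t + 2 * pi)) = f (real p * t)" for t
    using periodic_shift_int[of f "2 * pi" "real p * t" "int p", OF f(2)] by (simp add: algebra_simps)
  have "I = integral {0..2 * pi} (\<lambda>t. f (real p * (h + t)) * cos (real k * (h + t)))"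
    unfolding I_def
    by (rule integral_periodic_reflect(1)[symmetric]) (intro continuous_intros | simp only: fper cos_nat_periodic)+
  also have "\<dots> = integral {0..2 * pi} (\<lambda>t. cos (real k * h) * (f (real p * t) * cos (real k * t)) - sin (real k * h) * (f (real p * t) * sin (real k * t)))"
    unfolding fp by (simp add: distrib_left cos_add algebra_simps)
  also have "\<dots> = cos (real k * h) * I - sin (real k * h) * J"
    unfolding I_def J_def by (subst integral_diff) (auto intro!: integrable_continuous_real continuous_intros)
  finally have 1: "I = cos (real k * h) * I - sin (real k * h) * J" .
  have "J = integral {0..2 * pi} (\<lambda>t. f (real p * (h + t)) * sin (real k * (h + t)))"
    unfolding J_def
    by (rule integral_periodic_reflect(1)[symmetric]) (intro continuous_intros | simp only: fper sin_nat_periodic)+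
  also have "\<dots> = integral {0..2 * pi} (\<lambda>t. sin (real k * h) * (f (real p * t) * cos (real k * t)) + cos (real k * h) * (f (real p * t) * sin (real k * t)))"
    unfolding fp by (simp add: distrib_left sin_add algebra_simps)
  also have "\<dots> = sin (real k * h) * I + cos (real k * h) * J"
    unfolding I_def J_def by (subst integral_add) (auto intro!: integrable_continuous_real continuous_intros)
  finally have 2: "J = sin (real k * h) * I + cos (real k * h) * J" .
  have "cos (real k * h) \<noteq> 1"
  proof
    assume "cos (real k * h) = 1"
    then obtain n :: int where "real k * h = of_int n * 2 * pi" using cos_one_2pi_int by blast
    then have "real k = of_int n * real p" using p by (simp add: h_def field_simps)
    then have "of_int (int k) = (of_int (n * int p) :: real)" by simp
    then have "int k = n * int p" by (simp only: of_int_eq_iff)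
    then have "int p dvd int k" by simp
    then show False using k by simp
  qed
  define c s where "c = cos (real k * h)" and "s = sin (real k * h)"
  have c1: "c \<noteq> 1" using \<open>cos (real k * h) \<noteq> 1\<close> by (simp add: c_def)
  have e1: "(1 - c) * I = - s * J" and e2: "(1 - c) * J = s * I"
    using 1 2 by (auto simp: c_def s_def algebra_simps)
  have "(1 - c) * ((1 - c) * I) = - s * ((1 - c) * J)" unfolding e1 by (simp add: mult_ac)
  then have "((1 - c)\<^sup>2 + s\<^sup>2) * I = 0" unfolding e2 by (simp add: power2_eq_square algebra_simps)
  moreover have "(1 - c)\<^sup>2 + s\<^sup>2 > 0" using c1 by (simp add: add_pos_nonneg)
  ultimately have "I = 0" by (metis less_irrefl mult_eq_0_iff)
  then show ?thesis by (simp add: I_def)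
qed

text \<open>In the Poisson series of f(p t) only frequencies p j survive, with weights q^(p j).
  Hence the series is that of \<open>f\<close> at radius q^p.\<close>

lemma poisson_integral_dilated:
  fixes f :: "real \<Rightarrow> real"
  assumes f: "continuous_on UNIV f" "\<And>t. f (t + 2 * pi) = f t" and p: "p \<ge> 1" and q: "0 < q" "q < 1"
  shows "integral {0..2 * pi} (\<lambda>t. f (real p * t) * ((1 - q\<^sup>2) / (1 - 2 * q * cos t + q\<^sup>2))) =
    integral {0..2 * pi} (\<lambda>t. f t * ((1 - (q ^ p)\<^sup>2) / (1 - 2 * q ^ p * cos t + (q ^ p)\<^sup>2)))"
proof -
  have fc: "continuous_on UNIV (\<lambda>t. f (real p * t))"
    by (rule continuous_on_compose2[OF f(1)]) (auto intro!: continuous_intros)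
  let ?a = "\<lambda>k. (if k = 0 then 1 else 2) * q ^ k * integral {0..2 * pi} (\<lambda>t. f (real p * t) * cos (real k * t))"
  have S1: "?a sums integral {0..2 * pi} (\<lambda>t. f (real p * t) * ((1 - q\<^sup>2) / (1 - 2 * q * cos t + q\<^sup>2)))"
    using q by (intro poisson_integral_sums fc) auto
  have "(\<lambda>j. ?a (p * j)) sums integral {0..2 * pi} (\<lambda>t. f (real p * t) * ((1 - q\<^sup>2) / (1 - 2 * q * cos t + q\<^sup>2)))"
  proof (subst sums_mono_reindex)
    show "strict_mono (\<lambda>j. p * j)" using p by (intro strict_monoI) simp
    show "?a k = 0" if "k \<notin> range (\<lambda>j. p * j)" for k
    proof -
      have "\<not> p dvd k" using that by (auto simp: dvd_def)
      then show ?thesis using integral_dilated_cos_eq_0[OF f p] by simp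
    qed
  qed (rule S1)
  moreover have "?a (p * j) = (if j = 0 then 1 else 2) * (q ^ p) ^ j * integral {0..2 * pi} (\<lambda>t. f t * cos (real j * t))" for j
  proof -
    have "integral {0..2 * pi} (\<lambda>t. f (real p * t) * cos (real j * (real p * t))) = integral {0..2 * pi} (\<lambda>t. f t * cos (real j * t))"
      by (rule integral_dilated[OF _ _ p, of "\<lambda>t. f t * cos (real j * t)"])
        (intro continuous_intros f | simp only: f cos_nat_periodic)+
    moreover have "real (p * j) * t = real j * (real p * t)" for t by simp
    ultimately show ?thesis using p by (simp only: power_mult) auto
  qed
  ultimately have "(\<lambda>j. (if j = 0 then 1 else 2) * (q ^ p) ^ j * integral {0..2 * pi} (\<lambda>t. f t * cos (real j * t))) sums
     integral {0..2 * pi} (\<lambda>t. f (real p * t) * ((1 - q\<^sup>2) / (1 - 2 * q * cos t + q\<^sup>2)))" by simp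
  moreover have "(\<lambda>j. (if j = 0 then 1 else 2) * (q ^ p) ^ j * integral {0..2 * pi} (\<lambda>t. f t * cos (real j * t))) sums
     integral {0..2 * pi} (\<lambda>t. f t * ((1 - (q ^ p)\<^sup>2) / (1 - 2 * q ^ p * cos t + (q ^ p)\<^sup>2)))"
    using power_less_one[OF q p] by (intro poisson_integral_sums f(1)) auto
  ultimately show ?thesis by (rule sums_unique2)
qed

section \<open>The complete elliptic integral\<close>

lemma elliptic_integrand:
  assumes "0 \<le> \<rho>" "\<rho> < 1"
  shows "1 - \<rho>\<^sup>2 * (sin t)\<^sup>2 > 0" "continuous_on S (\<lambda>t. 1 / sqrt (1 - \<rho>\<^sup>2 * (sin t)\<^sup>2))"
proof -
  show pos: "1 - \<rho>\<^sup>2 * (sin t)\<^sup>2 > 0" for t :: real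
  proof -
    have "\<rho>\<^sup>2 * (sin t)\<^sup>2 \<le> \<rho>\<^sup>2 * 1" by (intro mult_left_mono) (auto simp: abs_square_le_1)
    moreover have "\<rho>\<^sup>2 < 1" using assms by (simp add: abs_square_less_1)
    ultimately show ?thesis by linarith
  qed
  show "continuous_on S (\<lambda>t. 1 / sqrt (1 - \<rho>\<^sup>2 * (sin t)\<^sup>2))"
    by (intro continuous_intros ballI) (metis less_irrefl pos real_sqrt_eq_0_iff)
qed

lemma elliptic_full_period:
  assumes \<rho>: "0 \<le> \<rho>" "\<rho> < 1"
  shows "integral {0..2 * pi} (\<lambda>t. 1 / sqrt (1 - \<rho>\<^sup>2 * (sin t)\<^sup>2)) = 4 * elliptic_K \<rho>"
proof -
  let ?h = "\<lambda>t. 1 / sqrt (1 - \<rho>\<^sup>2 * (sin t)\<^sup>2)"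
  note hc = elliptic_integrand(2)[OF \<rho>]
  have i: "?h integrable_on {a..b}" for a b by (intro integrable_continuous_real hc)
  have K: "elliptic_K \<rho> = integral {0..pi / 2} ?h"
    unfolding elliptic_K_def by (rule set_integrable_continuous_Icc(2)[OF hc])
  have hpi: "?h (t + pi) = ?h t" for t by simp
  have "integral {0..pi} ?h + integral {pi..pi + pi} ?h = integral {0..pi + pi} ?h"
    by (intro Henstock_Kurzweil_Integration.integral_combine i) auto
  moreover have "integral {pi..pi + pi} ?h = integral {0..pi} ?h"
    by (rule integral_periodic_shift[OF hpi hc]) simp
  ultimately have 1: "integral {0..2 * pi} ?h = 2 * integral {0..pi} ?h" by simp
  have "integral {- (pi / 2)..0} ?h + integral {0..pi / 2} ?h = integral {- (pi / 2)..pi / 2} ?h"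
    by (intro Henstock_Kurzweil_Integration.integral_combine i) auto
  moreover have "integral {- (pi / 2)..0} ?h = integral {0..pi / 2} ?h"
    using Henstock_Kurzweil_Integration.integral_reflect_real[of "pi / 2" 0 ?h] by simp
  moreover have "integral {- (pi / 2)..- (pi / 2) + pi} ?h = integral {0..pi} ?h"
    by (rule integral_periodic_shift[OF hpi hc]) simp
  ultimately have "integral {0..pi} ?h = 2 * integral {0..pi / 2} ?h" by simp
  then show ?thesis using 1 K by simp
qed

text \<open>Landen's substitution \<open>u = t + arcsin (\<rho> sin t)\<close>: in the triangle with sides \<open>1\<close>, \<open>\<rho>\<close> enclosing the
  angle \<open>pi - u\<close>, the third side is \<open>cos (u - t) + \<rho> cos t\<close>.\<close>

lemma landen_integral:
  assumes \<rho>: "0 \<le> \<rho>" "\<rho> < 1"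
  shows "integral {0..2 * pi} (\<lambda>u. 1 / sqrt (1 - 2 * \<rho> * cos u + \<rho>\<^sup>2)) = 4 * elliptic_K \<rho>"
proof -
  let ?f = "\<lambda>u. 1 / sqrt (1 - 2 * \<rho> * cos u + \<rho>\<^sup>2)"
  let ?g = "\<lambda>u. 1 / sqrt (1 + 2 * \<rho> * cos u + \<rho>\<^sup>2)"
  have fc: "continuous_on S ?f" for S
    by (intro continuous_intros ballI) (metis less_irrefl one_minus_cis_square_pos(2)[OF \<rho>] real_sqrt_eq_0_iff)
  have fg: "?f (pi + u) = ?g u" for u by (simp add: cos_add)
  have gpos: "1 + 2 * \<rho> * cos u + \<rho>\<^sup>2 > 0" for u
    using one_minus_cis_square_pos(2)[OF \<rho>, of "pi + u"] by (simp add: cos_add)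
  have gc: "continuous_on S ?g" for S
    by (intro continuous_intros ballI) (metis less_irrefl gpos real_sqrt_eq_0_iff)
  have "integral {0..2 * pi} (\<lambda>u. ?f (pi + u)) = integral {0..2 * pi} ?f"
    by (rule integral_periodic_reflect(1)[OF _ fc]) simp
  then have 1: "integral {0..2 * pi} ?f = integral {0..2 * pi} ?g" unfolding fg by simp
  define U where "U = (\<lambda>t. t + arcsin (\<rho> * sin t))"
  define S where "S = (\<lambda>t. sqrt (1 - \<rho>\<^sup>2 * (sin t)\<^sup>2))"
  have S: "S t > 0" "(S t)\<^sup>2 = 1 - \<rho>\<^sup>2 * (sin t)\<^sup>2" for t
    using elliptic_integrand(1)[OF \<rho>, of t] by (auto simp: S_def)
  have rs: "- 1 < \<rho> * sin t" "\<rho> * sin t < 1" for t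
  proof -
    have "\<bar>\<rho> * sin t\<bar> \<le> \<rho> * 1" unfolding abs_mult using \<rho> by (intro mult_mono) auto
    then show "- 1 < \<rho> * sin t" "\<rho> * sin t < 1" using \<rho> by auto
  qed
  have dist: "sqrt (1 + 2 * \<rho> * cos (U t) + \<rho>\<^sup>2) = S t + \<rho> * cos t" "0 < S t + \<rho> * cos t" for t
  proof -
    have cu: "cos (U t) = cos t * S t - \<rho> * (sin t)\<^sup>2"
      using rs[of t] by (simp add: U_def cos_add cos_arcsin S_def power_mult_distrib power2_eq_square)
    have sc: "(cos t)\<^sup>2 = 1 - (sin t)\<^sup>2" by (rule cos_squared_eq)
    have "(\<rho> * cos t)\<^sup>2 < (S t)\<^sup>2"
    proof -
      have "(S t)\<^sup>2 - (\<rho> * cos t)\<^sup>2 = 1 - \<rho>\<^sup>2" unfolding S(2) power_mult_distrib sc by (simp add: algebra_simps)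
      also have "\<dots> > 0" using \<rho> by (simp add: abs_square_less_1)
      finally show ?thesis by simp
    qed
    then have "\<bar>\<rho> * cos t\<bar> < \<bar>S t\<bar>" using abs_le_square_iff[of "S t" "\<rho> * cos t"] by linarith
    then show pos: "0 < S t + \<rho> * cos t" using S(1)[of t] by linarith
    have "(S t + \<rho> * cos t)\<^sup>2 = (S t)\<^sup>2 + 2 * \<rho> * (cos t * S t) + \<rho>\<^sup>2 * (cos t)\<^sup>2"
      by (simp add: power2_eq_square algebra_simps)
    also have "\<dots> = 1 + 2 * \<rho> * cos (U t) + \<rho>\<^sup>2"
      unfolding S(2) cu sc by (simp add: power2_eq_square algebra_simps)
    finally show "sqrt (1 + 2 * \<rho> * cos (U t) + \<rho>\<^sup>2) = S t + \<rho> * cos t"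
      using pos by (metis less_imp_le real_sqrt_unique)
  qed
  have dU: "(U has_real_derivative (S t + \<rho> * cos t) / S t) (at t)" for t
  proof -
    have "(U has_real_derivative 1 + (\<rho> * cos t) * inverse (sqrt (1 - (\<rho> * sin t)\<^sup>2))) (at t)"
      unfolding U_def using rs[of t] by (auto intro!: derivative_eq_intros)
    moreover have "1 + (\<rho> * cos t) * inverse (sqrt (1 - (\<rho> * sin t)\<^sup>2)) = (S t + \<rho> * cos t) / S t"
      using S(1)[of t] by (simp add: S_def power_mult_distrib inverse_eq_divide add_divide_distrib)
    ultimately show ?thesis by simp
  qed
  have U0: "U 0 = 0" "U (2 * pi) = 2 * pi" by (auto simp: U_def)
  have mono: "U x \<le> U y" if "x \<le> y" for x y
    using that
  proof (rule DERIV_nonneg_imp_nondecreasing)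
    fix t show "\<exists>d. (U has_real_derivative d) (at t) \<and> 0 \<le> d"
      using dU[of t] dist(2)[of t] S(1)[of t] by (intro exI[of _ "(S t + \<rho> * cos t) / S t"]) auto
  qed
  \<comment> \<open>The third side is the numerator of the derivative of \<open>U\<close> and the
    denominator of the integrand, so it cancels and leaves 1/\<open>S\<close>.\<close>
  have "((\<lambda>t. ((S t + \<rho> * cos t) / S t) *\<^sub>R ?g (U t)) has_integral integral {U 0..U (2 * pi)} ?g) {0..2 * pi}"
  proof (rule has_integral_substitution[where c = 0 and d = "2 * pi"])
    show "U ` {0..2 * pi} \<subseteq> {0..2 * pi}" using mono[of 0] mono[of _ "2 * pi"] U0 by auto
  qed (use U0 in \<open>auto intro!: gc DERIV_subset[OF dU]\<close>)
  moreover have "((S t + \<rho> * cos t) / S t) *\<^sub>R ?g (U t) = 1 / S t" for t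
    using dist(2)[of t] unfolding dist(1) by simp
  ultimately have "((\<lambda>t. 1 / S t) has_integral integral {0..2 * pi} ?g) {0..2 * pi}" using U0 by simp
  then have "integral {0..2 * pi} ?g = integral {0..2 * pi} (\<lambda>t. 1 / S t)" by (simp add: integral_unique)
  then show ?thesis using 1 elliptic_full_period[OF \<rho>] by (simp add: S_def)
qed

text \<open>After dilation to radius \<rho> = q^p the integrand is sqrt(x) (1 - \<rho>^2)/x = (1 -
  \<rho>^2)/sqrt(x), which is the form Landen's substitution treats. The prefactor is the ratio of
  the numerators of the two Poisson kernels.\<close>

lemma integral_cmod_kern:
  assumes q: "0 < q" "q < 1" and p: "p \<ge> 1"
  shows "integral {0..2 * pi} (\<lambda>t. cmod (kern q p t)) = (1 - q ^ (2 * p)) / (1 - q\<^sup>2) * (4 * elliptic_K (q ^ p))"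
proof -
  define \<rho> where "\<rho> = q ^ p"
  have \<rho>: "0 \<le> \<rho>" "\<rho> < 1" using power_less_one[OF q p] by (auto simp: \<rho>_def)
  have \<rho>2: "q ^ (2 * p) = \<rho>\<^sup>2" unfolding \<rho>_def by (metis mult.commute power_mult)
  have q2: "1 - q\<^sup>2 > 0" using q by (simp add: abs_square_less_1)
  let ?F = "\<lambda>u. sqrt (1 - 2 * \<rho> * cos u + \<rho>\<^sup>2)"
  note Fpos = one_minus_cis_square_pos(2)[OF \<rho>]
  have cancel: "x * (c / d) = c * (1 / x)" if "0 < x" "x * x = d" for x c d :: real
    using that by (auto simp: field_simps)
  have "cmod (kern q p t) = (1 / (1 - q\<^sup>2)) * (?F (real p * t) * ((1 - q\<^sup>2) / (1 - 2 * q * cos t + q\<^sup>2)))" for t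
    using q2 unfolding cmod_kern[OF q] \<rho>2 by (simp add: \<rho>_def)
  then have "integral {0..2 * pi} (\<lambda>t. cmod (kern q p t)) =
    (1 / (1 - q\<^sup>2)) * integral {0..2 * pi} (\<lambda>t. ?F (real p * t) * ((1 - q\<^sup>2) / (1 - 2 * q * cos t + q\<^sup>2)))"
    by (simp only: integral_mult_right)
  also have "integral {0..2 * pi} (\<lambda>t. ?F (real p * t) * ((1 - q\<^sup>2) / (1 - 2 * q * cos t + q\<^sup>2))) =
    integral {0..2 * pi} (\<lambda>t. ?F t * ((1 - \<rho>\<^sup>2) / (1 - 2 * \<rho> * cos t + \<rho>\<^sup>2)))"
    unfolding \<rho>_def by (rule poisson_integral_dilated[OF _ _ p q]) (intro continuous_intros | simp)+
  also have "(\<lambda>t. ?F t * ((1 - \<rho>\<^sup>2) / (1 - 2 * \<rho> * cos t + \<rho>\<^sup>2))) = (\<lambda>t. (1 - \<rho>\<^sup>2) * (1 / ?F t))"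
  proof
    fix t
    have "?F t * ?F t = 1 - 2 * \<rho> * cos t + \<rho>\<^sup>2" using Fpos[of t] by simp
    then show "?F t * ((1 - \<rho>\<^sup>2) / (1 - 2 * \<rho> * cos t + \<rho>\<^sup>2)) = (1 - \<rho>\<^sup>2) * (1 / ?F t)"
      using Fpos[of t] by (intro cancel) auto
  qed
  also have "integral {0..2 * pi} (\<lambda>t. (1 - \<rho>\<^sup>2) * (1 / ?F t)) = (1 - \<rho>\<^sup>2) * (4 * elliptic_K \<rho>)"
    by (simp only: integral_mult_right landen_integral[OF \<rho>])
  finally show ?thesis unfolding \<rho>2 by (simp add: \<rho>_def)
qed

section \<open>The asymptotic equalities\<close>

text \<open>Extremal functions are available only up to \<epsilon>. The two bounds also show that
  the extended supremum is a real number.\<close>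

lemma approx_error_between:
  assumes upper: "\<And>f x. f \<in> M \<Longrightarrow> \<bar>f x - vallee_poussin n p f x\<bar> \<le> U"
    and lower: "\<And>\<epsilon>. \<epsilon> > 0 \<Longrightarrow> \<exists>f\<in>M. \<exists>x. Lo - \<epsilon> \<le> \<bar>f x - vallee_poussin n p f x\<bar>"
  obtains v where "approx_error M n p = ereal v" "Lo \<le> v" "v \<le> U"
proof -
  let ?e = "\<lambda>f. C_norm (\<lambda>x. f x - vallee_poussin n p f x)"
  have up: "approx_error M n p \<le> ereal U"
    unfolding approx_error_def by (intro SUP_least) (simp add: C_norm_le upper)
  have low: "ereal (Lo - \<epsilon>) \<le> approx_error M n p" if e: "\<epsilon> > 0" for \<epsilon>
  proof -
    obtain f x where f: "f \<in> M" "Lo - \<epsilon> \<le> \<bar>f x - vallee_poussin n p f x\<bar>" using lower[OF e] by blast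
    have "\<bar>f x - vallee_poussin n p f x\<bar> \<le> ?e f"
      by (rule abs_le_C_norm[of "\<lambda>x. f x - vallee_poussin n p f x"]) (rule upper[OF f(1)])
    then have "ereal (Lo - \<epsilon>) \<le> ereal (?e f)" using f(2) by simp
    also have "\<dots> \<le> approx_error M n p" unfolding approx_error_def using f(1) by (rule SUP_upper)
    finally show ?thesis .
  qed
  obtain v where v: "approx_error M n p = ereal v"
    using up low[of 1] by (cases "approx_error M n p") auto
  have "Lo \<le> v" by (rule field_le_epsilon) (use low v in \<open>auto simp: algebra_simps\<close>)
  then show ?thesis using that v up by simp
qed

lemma asymptotic_form:
  fixes c :: real
  assumes c: "0 < c" and e: "0 < e" and N: "0 < N"
    and low: "c * (m - K * e / N) \<le> v" and up: "v \<le> c * (m + K * e / N)"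
  shows "\<exists>R. \<bar>R\<bar> \<le> K \<and> v = c * (m + R / N * e)"
proof -
  define R where "R = (v / c - m) * N / e"
  have "v = c * (m + R / N * e)" using c e N by (simp add: R_def field_simps)
  moreover have "\<bar>R\<bar> \<le> K"
  proof -
    have "v / c \<le> m + K * e / N" using up c by (subst pos_divide_le_eq) (simp_all add: mult.commute)
    moreover have "m - K * e / N \<le> v / c" using low c by (subst pos_le_divide_eq) (simp_all add: mult.commute)
    ultimately have "\<bar>v / c - m\<bar> \<le> K * e / N" by (simp add: abs_le_iff)
    then have "\<bar>v / c - m\<bar> * (N / e) \<le> K * e / N * (N / e)" using N e by (intro mult_right_mono) auto
    then show ?thesis using N e by (simp add: R_def abs_mult)
  qed
  ultimately show ?thesis by blast
qed

lemma C_class_iff: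
  assumes "\<And>k. k \<ge> 1 \<Longrightarrow> \<psi> k > 0"
  shows "f \<in> C_class \<psi> \<beta> M \<longleftrightarrow> f \<in> C_space \<and> (\<exists>\<phi>\<in>M. \<phi> \<in> Lp_space 1 \<and> fourier_a 0 \<phi> = 0 \<and>
    (\<forall>k\<ge>1. \<forall>x. harmonic k f x = \<psi> k * phase_coeff k (\<beta> * pi / 2) \<phi> x))"
  using C_space_subset_Lp_1 by (auto simp: C_class_def L_class_def has_psi_beta_derivative_iff[OF assms])

text \<open>For \<open>m = 1\<close> the remainder at \<open>x\<close> is this integral divided by
  pi, times q^N / p.\<close>

definition kern_int :: "real \<Rightarrow> nat \<Rightarrow> nat \<Rightarrow> real \<Rightarrow> (real \<Rightarrow> real) \<Rightarrow> real \<Rightarrow> real" where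
  "kern_int q p N b \<phi> x = (LINT t:{0..2 * pi}|lebesgue. \<phi> t * Re (cis (real N * (t - x) + b) * kern q p (t - x)))"

text \<open>Reduces both asymptotic formulas to the extremal problem for the Poisson kernel (the case
  \<open>m = 1\<close>) on the class of derivatives.\<close>

lemma approx_error_reduction:
  assumes q: "0 < q" "q < 1" and m: "m \<ge> 1" and p: "1 \<le> p" "p \<le> n" and N: "N = n - p + 1" "large_index q m N"
    and M: "\<And>\<phi>. \<phi> \<in> M \<Longrightarrow> \<phi> \<in> Lp_space 1"
    and D: "\<And>\<phi> k x. \<phi> \<in> M \<Longrightarrow> k \<ge> N \<Longrightarrow> \<bar>phase_coeff k (\<beta> * pi / 2) \<phi> x\<bar> \<le> D"
    and upper: "\<And>\<phi> x. \<phi> \<in> M \<Longrightarrow> fourier_a 0 \<phi> = 0 \<Longrightarrow> \<bar>kern_int q p N (\<beta> * pi / 2) \<phi> x\<bar> / pi \<le> main + err"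
    and lower: "\<And>\<epsilon>. \<epsilon> > 0 \<Longrightarrow> \<exists>\<phi>\<in>M. fourier_a 0 \<phi> = 0 \<and> kern_int q p N (\<beta> * pi / 2) \<phi> 0 / pi \<ge> main - err - \<epsilon>"
    and total: "err + 32 * D * (real m * q / (1 - q)\<^sup>2 * min (real p) (1 / (1 - q))) / real N \<le> K * e / real N"
    and e: "0 < e"
  shows "\<exists>R. \<bar>R\<bar> \<le> K \<and> approx_error (C_class (psi_polyharmonic m q) \<beta> M) n p =
    ereal (q ^ N / real p * polyharmonic_factor m q N * (main + R / real N * e))"
proof -
  define c where "c = q ^ N / real p * polyharmonic_factor m q N"
  define E where "E = 32 * D * (real m * q / (1 - q)\<^sup>2 * min (real p) (1 / (1 - q))) / real N"
  define T where "T = K * e / real N"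
  have c: "c > 0" using q p polyharmonic_factor_ge_1[OF q, of m N] by (simp add: c_def)
  have eT: "err + E \<le> T" using total by (simp add: E_def T_def)
  have repr: "\<exists>E'. f x - vallee_poussin n p f x = c * (kern_int q p N (\<beta> * pi / 2) \<phi> x / pi + E') \<and> \<bar>E'\<bar> \<le> E"
    if f: "f \<in> C_space" and \<phi>: "\<phi> \<in> M" and
      h: "\<And>k x. k \<ge> 1 \<Longrightarrow> harmonic k f x = psi_polyharmonic m q k * phase_coeff k (\<beta> * pi / 2) \<phi> x" for f \<phi> x
    by (rule remainder_formula[OF q m p N f Lp_space_1D(3)[OF M[OF \<phi>]] h D[OF \<phi>], of x])
      (auto simp: c_def E_def kern_int_def)
  have up: "\<bar>f x - vallee_poussin n p f x\<bar> \<le> c * (main + T)" if f: "f \<in> C_class (psi_polyharmonic m q) \<beta> M" for f x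
  proof -
    obtain \<phi> where \<phi>: "f \<in> C_space" "\<phi> \<in> M" "fourier_a 0 \<phi> = 0"
      "\<And>k x. k \<ge> 1 \<Longrightarrow> harmonic k f x = psi_polyharmonic m q k * phase_coeff k (\<beta> * pi / 2) \<phi> x"
      using f unfolding C_class_iff[OF psi_polyharmonic_pos[OF q]] by blast
    obtain E' where E': "f x - vallee_poussin n p f x = c * (kern_int q p N (\<beta> * pi / 2) \<phi> x / pi + E')" "\<bar>E'\<bar> \<le> E"
      using repr[OF \<phi>(1,2,4)] by blast
    have "\<bar>kern_int q p N (\<beta> * pi / 2) \<phi> x / pi\<bar> \<le> main + err" using upper[OF \<phi>(2,3), of x] by simp
    then have "\<bar>kern_int q p N (\<beta> * pi / 2) \<phi> x / pi + E'\<bar> \<le> main + T" using E'(2) eT by linarith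
    then show ?thesis unfolding E'(1) abs_mult using c by (simp add: mult_left_mono)
  qed
  \<comment> \<open>One point bounds the norm from below, so the extremal derivative need only be
    matched to the kernel at \<open>x = 0\<close>.\<close>
  have low: "\<exists>f\<in>C_class (psi_polyharmonic m q) \<beta> M. \<exists>x. c * (main - T) - \<epsilon> \<le> \<bar>f x - vallee_poussin n p f x\<bar>" if "\<epsilon> > 0" for \<epsilon>
  proof -
    have "\<epsilon> / c > 0" using that c by simp
    then obtain \<phi> where \<phi>: "\<phi> \<in> M" "fourier_a 0 \<phi> = 0" "kern_int q p N (\<beta> * pi / 2) \<phi> 0 / pi \<ge> main - err - \<epsilon> / c"
      using lower by blast
    obtain f where f: "f \<in> C_class (psi_polyharmonic m q) \<beta> M"
      "\<And>k x. k \<ge> 1 \<Longrightarrow> harmonic k f x = psi_polyharmonic m q k * phase_coeff k (\<beta> * pi / 2) \<phi> x"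
      by (rule C_class_surjective[OF M[OF \<phi>(1)] \<phi>(2,1) psi_polyharmonic_pos[OF q] summable_psi_polyharmonic[OF q m], where \<beta> = \<beta>]; rule that; blast)
    have fC: "f \<in> C_space" using f(1) by (simp add: C_class_def)
    obtain E' where E': "f 0 - vallee_poussin n p f 0 = c * (kern_int q p N (\<beta> * pi / 2) \<phi> 0 / pi + E')" "\<bar>E'\<bar> \<le> E"
      using repr[OF fC \<phi>(1) f(2)] by blast
    have "main - T - \<epsilon> / c \<le> kern_int q p N (\<beta> * pi / 2) \<phi> 0 / pi + E'" using \<phi>(3) E'(2) eT by linarith
    then have "c * (main - T - \<epsilon> / c) \<le> f 0 - vallee_poussin n p f 0" unfolding E'(1) using c by (intro mult_left_mono) auto
    moreover have "c * (main - T - \<epsilon> / c) = c * (main - T) - \<epsilon>" using c by (simp add: right_diff_distrib)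
    ultimately have "c * (main - T) - \<epsilon> \<le> \<bar>f 0 - vallee_poussin n p f 0\<bar>" by linarith
    then show ?thesis using f(1) by blast
  qed
  obtain v where v: "approx_error (C_class (psi_polyharmonic m q) \<beta> M) n p = ereal v" "c * (main - T) \<le> v" "v \<le> c * (main + T)"
    using approx_error_between[OF up low] by blast
  have "0 < real N" using N by simp
  from asymptotic_form[OF c e this v(2,3)[unfolded T_def]] show ?thesis
    unfolding v(1) c_def by auto
qed

section \<open>The kernel on the classes of moduli of continuity\<close>

text \<open>Origin of the exponent \<gamma>(p): the minimum of \<open>p\<close> and 1/(1-q) is 1 for
  \<open>p = 1\<close> and otherwise costs a third power.\<close>

lemma kern_Lipschitz_const:
  assumes q: "0 < q" "q < 1"
  shows "norm (kern q p t - kern q p s) \<le> 2 / (1 - q) ^ gamma_exp p * \<bar>t - s\<bar>"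
proof -
  have "2 * q / (1 - q)\<^sup>2 * min (real p) (1 / (1 - q)) \<le> 2 / (1 - q) ^ gamma_exp p"
  proof (cases "p = 1")
    case True
    have "2 * q / (1 - q)\<^sup>2 * min (real p) (1 / (1 - q)) \<le> 2 * 1 / (1 - q)\<^sup>2 * 1"
      using q True by (intro mult_mono divide_right_mono) auto
    then show ?thesis using True by (simp add: gamma_exp_def)
  next
    case False
    have "2 * q / (1 - q)\<^sup>2 * min (real p) (1 / (1 - q)) \<le> 2 * 1 / (1 - q)\<^sup>2 * (1 / (1 - q))"
      using q by (intro mult_mono divide_right_mono) auto
    then show ?thesis using False by (simp add: gamma_exp_def power2_eq_square power3_eq_cube)
  qed
  then show ?thesis using kern_Lipschitz[OF q, of p t s] by (meson abs_ge_zero mult_right_mono order_trans)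
qed

text \<open>One power of 1/(1-q) below the Lipschitz constant, since for \<open>p = 1\<close> the
  numerator cancels a factor of the denominator. Multiplied by the phase drift 3/(1-q) it has the
  order of the Lipschitz constant.\<close>

lemma kern_bound:
  assumes q: "0 < q" "q < 1" and p: "p \<ge> 1"
  shows "cmod (kern q p t) \<le> 2 / (1 - q) ^ (gamma_exp p - 1)"
proof -
  let ?z = "of_real q * cis t"
  have nz: "norm ?z = q" using q by (simp add: norm_mult)
  have "1 - q \<le> cmod (1 - ?z)" using norm_triangle_ineq2[of 1 ?z] nz by simp
  show ?thesis
  proof (cases "p = 1")
    case True
    have "kern q p t = 1 / (1 - ?z)"
      using True one_minus_cis_nonzero[OF q] by (simp add: kern_def power2_eq_square)
    then have "cmod (kern q p t) = 1 / cmod (1 - ?z)" by (simp add: norm_divide)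
    also have "\<dots> \<le> 2 / (1 - q)" using q \<open>1 - q \<le> _\<close> by (intro frac_le) auto
    finally show ?thesis using True by (simp add: gamma_exp_def)
  next
    case False
    have "cmod (1 - ?z ^ p) \<le> 1 + q ^ p" using norm_triangle_ineq4[of 1 "?z ^ p"] nz by (simp add: norm_power)
    also have "\<dots> \<le> 2" using power_less_one[OF q p] by simp
    finally have 1: "cmod (1 - ?z ^ p) \<le> 2" .
    have 2: "(1 - q)\<^sup>2 \<le> (cmod (1 - ?z))\<^sup>2" using q \<open>1 - q \<le> _\<close> by (intro power_mono) auto
    have "cmod (kern q p t) = cmod (1 - ?z ^ p) / (cmod (1 - ?z))\<^sup>2" by (simp add: kern_def norm_divide norm_power)
    also have "\<dots> \<le> 2 / (1 - q)\<^sup>2" using 1 2 q by (intro frac_le) auto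
    finally show ?thesis using False by (simp add: gamma_exp_def)
  qed
qed

lemma kern_shift_continuous:
  assumes q: "0 < q" "q < 1"
  shows "continuous_on S (\<lambda>t. kern q p (t - x))"
  by (rule continuous_on_compose2[OF kern_continuous[OF q, of UNIV]]) (auto intro!: continuous_intros)

lemma kern_shift_periodic: "kern q p (t + 2 * pi - x) = kern q p (t - x)"
  using kern_periodic[of q p "t - x"] by (simp add: algebra_simps)

text \<open>All harmonics of the kernel have frequency at least N \<ge> 1. So \<phi> may be changed
  by a constant: to make it bounded by \<omega>(pi) in the upper estimate, and to give it mean zero
  in the lower one.\<close>

lemma kern_int_const:
  assumes q: "0 < q" "q < 1" and N: "N \<ge> 1"
  shows "integral {0..2 * pi} (\<lambda>t. Re (cis (real N * (t - x) + b) * kern q p (t - x))) = 0"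
proof -
  have i: "set_integrable lebesgue {0..2 * pi} (\<lambda>t. 1 :: real)" by (intro set_integrable_continuous_Icc) auto
  have z: "phase_coeff (N + i) b (\<lambda>t. 1) x = 0" for i
  proof -
    have "integral {0..2 * pi} (\<lambda>t. cos (of_int (int (N + i)) * t + (b - real (N + i) * x))) = 0"
      using N by (intro integral_cos_frequency) auto
    moreover have "(LINT t:{0..2 * pi}|lebesgue. 1 * cos (real (N + i) * (t - x) + b)) =
      integral {0..2 * pi} (\<lambda>t. 1 * cos (real (N + i) * (t - x) + b))"
      by (intro set_integrable_continuous_Icc continuous_intros)
    ultimately show ?thesis by (simp add: phase_coeff_def algebra_simps)
  qed
  have "(\<lambda>i. 0 :: real) sums ((1 / pi) * (LINT t:{0..2 * pi}|lebesgue. 1 * Re (cis (real N * (t - x) + b) * kern q p (t - x))))"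
    using phase_coeff_kern_sums[OF q i, of p N b x] unfolding z by simp
  then have "(LINT t:{0..2 * pi}|lebesgue. 1 * Re (cis (real N * (t - x) + b) * kern q p (t - x))) = 0"
    using sums_unique2[OF _ sums_zero] by fastforce
  moreover have "(LINT t:{0..2 * pi}|lebesgue. 1 * Re (cis (real N * (t - x) + b) * kern q p (t - x))) =
     integral {0..2 * pi} (\<lambda>t. 1 * Re (cis (real N * (t - x) + b) * kern q p (t - x)))"
    by (intro set_integrable_continuous_Icc continuous_intros kern_shift_continuous q)
  ultimately show ?thesis by simp
qed

text \<open>The condition 6/(1-q) \<le> N is 2L \<le> N for the drift L = 3/(1-q).\<close>

lemma modulated_kern:
  assumes q: "0 < q" "q < 1" and p: "p \<ge> 1" and N: "N \<ge> 1" "6 / (1 - q) \<le> real N"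
    and \<omega>: "modulus_of_continuity \<omega>" "concave_on {0..} \<omega>"
  shows "modulated N (3 / (1 - q)) (\<lambda>t. real N * (t - x) + b + kern_arg q p (t - x)) (\<lambda>t. real N + kern_arg_deriv q p (t - x))
    (\<lambda>t. cmod (kern q p (t - x))) (2 / (1 - q) ^ gamma_exp p) (2 / (1 - q) ^ (gamma_exp p - 1)) \<omega>"
proof unfold_locales
  show "((\<lambda>t. real N * (t - x) + b + kern_arg q p (t - x)) has_real_derivative real N + kern_arg_deriv q p (t - x)) (at t)" for t
  proof -
    have "((\<lambda>t. kern_arg q p (t - x)) has_real_derivative kern_arg_deriv q p (t - x) * 1) (at t)"
      by (rule DERIV_chain2[OF kern_arg_derivative(1)[OF q p]]) (auto intro!: derivative_eq_intros)
    moreover have "((\<lambda>t. real N * (t - x) + b) has_real_derivative real N) (at t)"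
      by (auto intro!: derivative_eq_intros)
    ultimately show ?thesis using DERIV_add by fastforce
  qed
  show "continuous_on UNIV (\<lambda>t. real N + kern_arg_deriv q p (t - x))"
    by (intro continuous_intros continuous_on_compose2[OF kern_arg_derivative(2)[OF q p, of UNIV]]) auto
  show "real N * (t + 2 * pi - x) + b + kern_arg q p (t + 2 * pi - x) = real N * (t - x) + b + kern_arg q p (t - x) + real N * (2 * pi)" for t
    using kern_arg_periodic[of q p "t - x"] by (simp add: algebra_simps)
  show "\<bar>cmod (kern q p (s - x)) - cmod (kern q p (t - x))\<bar> \<le> 2 / (1 - q) ^ gamma_exp p * \<bar>s - t\<bar>" for s t
    using norm_triangle_ineq3[of "kern q p (s - x)" "kern q p (t - x)"] kern_Lipschitz_const[OF q, of p "s - x" "t - x"] by simp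
qed (use q N kern_arg_derivative(3)[OF q p] kern_bound[OF q p] kern_shift_periodic \<omega> in auto)

lemma H_class_kern_int:
  assumes q: "0 < q" "q < 1" and p: "p \<ge> 1" and N: "N \<ge> 1" "6 / (1 - q) \<le> real N"
    and \<omega>: "modulus_of_continuity \<omega>" "concave_on {0..} \<omega>"
  defines "main \<equiv> 4 / pi\<^sup>2 * ((1 - q ^ (2 * p)) / (1 - q\<^sup>2)) * elliptic_K (q ^ p) * modulus_mean \<omega> (real N)"
  defines "err \<equiv> 160 * (\<omega> pi / (1 - q) ^ gamma_exp p) / real N"
  shows "\<phi> \<in> H_class \<omega> \<Longrightarrow> \<bar>kern_int q p N b \<phi> x\<bar> / pi \<le> main + err"
    and "\<exists>\<phi>\<in>H_class \<omega>. fourier_a 0 \<phi> = 0 \<and> kern_int q p N b \<phi> 0 / pi \<ge> main - err"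
proof -
  define W where "W = (\<lambda>x t. Re (cis (real N * (t - x) + b) * kern q p (t - x)))"
  define A where "A = (\<lambda>x t. cmod (kern q p (t - x)))"
  define \<Phi> where "\<Phi> = (\<lambda>x t. real N * (t - x) + b + kern_arg q p (t - x))"
  have M: "modulated N (3 / (1 - q)) (\<Phi> x) (\<lambda>t. real N + kern_arg_deriv q p (t - x))
    (A x) (2 / (1 - q) ^ gamma_exp p) (2 / (1 - q) ^ (gamma_exp p - 1)) \<omega>" for x
    unfolding A_def \<Phi>_def by (rule modulated_kern[OF q p N \<omega>])
  have Wc: "continuous_on S (W x)" for S x
    unfolding W_def by (intro continuous_intros kern_shift_continuous q)
  have W0: "integral {0..2 * pi} (W x) = 0" for x unfolding W_def by (rule kern_int_const[OF q N(1)])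
  have WA: "W x t = A x t * cos (\<Phi> x t)" for x t
  proof -
    have eq: "cis (real N * (t - x) + b) * kern q p (t - x) =
      of_real (A x t) * (cis (real N * (t - x) + b) * cis (kern_arg q p (t - x)))"
      by (subst kern_polar[OF q p]) (simp add: A_def)
    show ?thesis unfolding W_def eq cis_mult by (simp add: \<Phi>_def)
  qed
  have IA: "integral {0..2 * pi} (A x) = (1 - q ^ (2 * p)) / (1 - q\<^sup>2) * (4 * elliptic_K (q ^ p))" for x
  proof -
    have "integral {0..2 * pi} (\<lambda>t. cmod (kern q p (- x + t))) = integral {0..2 * pi} (\<lambda>t. cmod (kern q p t))"
      by (rule integral_periodic_reflect(1)) (auto simp: kern_periodic intro!: continuous_on_norm kern_continuous q)
    then show ?thesis by (simp add: A_def integral_cmod_kern[OF q p])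
  qed
  have mainA: "modulus_mean \<omega> (real N) * integral {0..2 * pi} (A x) / pi = pi * main" for x
  proof -
    have "y * (r * (4 * k)) / pi = pi * (4 / pi\<^sup>2 * r * k * y)" for y r k :: real
      by (simp add: power2_eq_square)
    then show ?thesis unfolding IA main_def .
  qed
  have g1: "gamma_exp p = Suc (gamma_exp p - 1)" by (simp add: gamma_exp_def)
  \<comment> \<open>16 * 3 * 2 + 32 * 2 = 160, the absolute constant of the final result.\<close>
  have errA: "\<omega> pi / real N * (16 * (3 / (1 - q)) * (2 / (1 - q) ^ (gamma_exp p - 1)) + 32 * (2 / (1 - q) ^ gamma_exp p)) \<le> pi * err"
  proof -
    have "(1 - q) * (1 - q) ^ (gamma_exp p - 1) = (1 - q) ^ gamma_exp p" by (subst (2) g1) simp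
    then have "16 * (3 / (1 - q)) * (2 / (1 - q) ^ (gamma_exp p - 1)) = 96 / (1 - q) ^ gamma_exp p" by simp
    then have "\<omega> pi / real N * (16 * (3 / (1 - q)) * (2 / (1 - q) ^ (gamma_exp p - 1)) + 32 * (2 / (1 - q) ^ gamma_exp p)) = 1 * err"
      by (simp add: err_def add_divide_distrib[symmetric] mult_ac)
    also have "\<dots> \<le> pi * err"
      using pi_gt3 q modulus_of_continuityD(4)[OF \<omega>(1), of pi] by (intro mult_right_mono) (auto simp: err_def)
    finally show ?thesis .
  qed
  have conv: "kern_int q p N b \<phi> x = integral {0..2 * pi} (\<lambda>t. (\<phi> t - c) * A x t * cos (\<Phi> x t))" if \<phi>: "continuous_on UNIV \<phi>" for \<phi> x c
  proof -
    have \<phi>c: "continuous_on S \<phi>" for S using \<phi> continuous_on_subset by blast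
    have "kern_int q p N b \<phi> x = (LINT t:{0..2 * pi}|lebesgue. \<phi> t * W x t)"
      unfolding kern_int_def W_def ..
    also have "\<dots> = integral {0..2 * pi} (\<lambda>t. \<phi> t * W x t)"
      by (intro set_integrable_continuous_Icc continuous_on_mult \<phi>c Wc)
    also have "\<dots> = integral {0..2 * pi} (\<lambda>t. \<phi> t * W x t) - integral {0..2 * pi} (\<lambda>t. c * W x t)"
      using W0 by simp
    also have "\<dots> = integral {0..2 * pi} (\<lambda>t. \<phi> t * W x t - c * W x t)"
      by (rule integral_diff[symmetric]) (intro integrable_continuous_real continuous_on_mult continuous_on_const \<phi>c Wc)+
    also have "\<dots> = integral {0..2 * pi} (\<lambda>t. (\<phi> t - c) * A x t * cos (\<Phi> x t))"
      by (simp add: WA algebra_simps)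
    finally show ?thesis .
  qed
  show "\<bar>kern_int q p N b \<phi> x\<bar> / pi \<le> main + err" if \<phi>: "\<phi> \<in> H_class \<omega>"
  proof -
    note H = H_classD[OF \<omega>(1) \<phi>]
    have "\<bar>integral {0..2 * pi} (\<lambda>t. (\<phi> t - \<phi> 0) * A x t * cos (\<Phi> x t))\<bar> \<le>
      pi * main + \<omega> pi / real N * (16 * (3 / (1 - q)) * (2 / (1 - q) ^ (gamma_exp p - 1)) + 32 * (2 / (1 - q) ^ gamma_exp p))"
      unfolding mainA[of x, symmetric]
      by (rule modulated.upper[OF M[of x], where f = "\<lambda>t. \<phi> t - \<phi> 0"]) (use H C_spaceD(2)[OF H(1)] in auto)
    then have "\<bar>integral {0..2 * pi} (\<lambda>t. (\<phi> t - \<phi> 0) * A x t * cos (\<Phi> x t))\<bar> \<le> pi * main + pi * err"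
      using errA by linarith
    then show ?thesis using conv[OF C_spaceD(1)[OF H(1)], of x "\<phi> 0"] by (simp add: field_simps)
  qed
  obtain f where f: "\<And>x y. \<bar>f x - f y\<bar> \<le> \<omega> \<bar>x - y\<bar>" "\<And>t. f (t + 2 * pi) = f t"
    "pi * main - \<omega> pi / real N * (16 * (3 / (1 - q)) * (2 / (1 - q) ^ (gamma_exp p - 1)) + 32 * (2 / (1 - q) ^ gamma_exp p)) \<le>
      integral {0..2 * pi} (\<lambda>t. f t * A 0 t * cos (\<Phi> 0 t))"
  proof (rule modulated.lower[OF M[of 0], unfolded mainA], goal_cases)
    case (1 g)
    show ?case by (rule 1(1)[OF 1(2-4)])
  qed
  then have f3: "pi * main - pi * err \<le> integral {0..2 * pi} (\<lambda>t. f t * A 0 t * cos (\<Phi> 0 t))"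
    using errA by linarith
  note fc = modulus_bound_imp_continuous[OF \<omega>(1) f(1)]
  \<comment> \<open>Subtracting the mean alters neither the increments of \<open>f\<close> nor its
    integral against the kernel.\<close>
  define c where "c = (LINT t:{0..2 * pi}|lebesgue. f t) / (2 * pi)"
  define \<phi> where "\<phi> = (\<lambda>t. f t - c)"
  have \<phi>c: "continuous_on S \<phi>" for S unfolding \<phi>_def by (intro continuous_intros fc)
  have "\<phi> \<in> C_space" using \<phi>c f(2) by (simp add: C_space_def periodic_2pi_def \<phi>_def)
  then have H: "\<phi> \<in> H_class \<omega>" using f(1) by (simp add: H_class_iff[OF \<omega>(1)] \<phi>_def)
  have "(LINT t:{0..2 * pi}|lebesgue. \<phi> t) = (LINT t:{0..2 * pi}|lebesgue. f t) - (LINT t:{0..2 * pi}|lebesgue. c)"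
    unfolding \<phi>_def by (intro set_integral_diff set_integrable_continuous_Icc fc) auto
  also have "\<dots> = 0" unfolding LINT_const_2pi by (simp add: c_def)
  finally have "fourier_a 0 \<phi> = 0" by (simp add: fourier_a_def)
  moreover have "kern_int q p N b \<phi> 0 = integral {0..2 * pi} (\<lambda>t. f t * A 0 t * cos (\<Phi> 0 t))"
    using conv[OF \<phi>c, of 0 "- c"] by (simp add: \<phi>_def)
  then have "kern_int q p N b \<phi> 0 / pi \<ge> main - err" using f3 by (simp add: field_simps)
  ultimately show "\<exists>\<phi>\<in>H_class \<omega>. fourier_a 0 \<phi> = 0 \<and> kern_int q p N b \<phi> 0 / pi \<ge> main - err"
    using H by blast
qed

lemma modulus_mean_LINT:
  assumes "modulus_of_continuity \<omega>" "c > 0"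
  shows "(LINT t:{0..pi / 2}|lebesgue. \<omega> (2 * t / c) * sin t) = modulus_mean \<omega> c"
  unfolding modulus_mean_def by (intro set_integrable_continuous_Icc modulus_mean_integrand assms)

section \<open>The kernel on the unit balls of L_s\<close>

text \<open>For p = 1 the kernel is 1/(1-z), and its derivative has modulus q/\<bar>1-z\<bar>^2, a
  multiple of the Poisson kernel. Bounding increments by variation rather than by the Lipschitz
  constant is what permits the exponent \<sigma> = 1.\<close>

lemma kern_1_increment:
  assumes q: "0 < q" "q < 1" and st: "s \<in> {a..b}" "t \<in> {a..b}"
  shows "norm (kern q 1 (t - x) - kern q 1 (s - x)) \<le> integral {a..b} (\<lambda>u. q / (1 - 2 * q * cos (u - x) + q\<^sup>2))"
proof -
  define G' where "G' = (\<lambda>u. \<i> * (of_real q * cis (u - x)) / (1 - of_real q * cis (u - x))\<^sup>2)"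
  have nz: "1 - of_real q * cis u \<noteq> 0" for u by (rule one_minus_cis_nonzero[OF q])
  have G: "kern q 1 u = 1 / (1 - of_real q * cis u)" for u
    using nz by (simp add: kern_def power2_eq_square)
  have d: "((\<lambda>u. kern q 1 (u - x)) has_vector_derivative G' u) (at u within S)" for u S
  proof -
    have "((\<lambda>w. 1 / (1 - of_real q * exp (\<i> * (w - of_real x)))) has_field_derivative
      (\<i> * (of_real q * exp (\<i> * (of_real u - of_real x)))) / (1 - of_real q * exp (\<i> * (of_real u - of_real x)))\<^sup>2) (at (of_real u))"
      using nz[of "u - x"]
      by (auto intro!: derivative_eq_intros simp: cis_conv_exp power2_eq_square mult_ac)
    from has_vector_derivative_real_field[OF this, of S] show ?thesis
      unfolding G G'_def by (simp add: cis_conv_exp)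
  qed
  have nG: "norm (G' u) = q / (1 - 2 * q * cos (u - x) + q\<^sup>2)" for u
  proof -
    have "norm (G' u) = q / (cmod (1 - of_real q * cis (u - x)))\<^sup>2"
      using q by (simp add: G'_def norm_divide norm_mult norm_power)
    then show ?thesis unfolding cmod_one_minus_cis
      using one_minus_cis_square_pos(2)[of q "u - x"] q by simp
  qed
  have Gc: "continuous_on S G'" for S
    unfolding G'_def using nz by (intro continuous_intros) auto
  have nc: "continuous_on S (\<lambda>u. norm (G' u))" for S by (intro continuous_on_norm Gc)
  have le: "norm (kern q 1 (t - x) - kern q 1 (s - x)) \<le> integral {a..b} (\<lambda>u. norm (G' u))"
    if "s \<le> t" "s \<in> {a..b}" "t \<in> {a..b}" for s t
  proof -
    have "(G' has_integral (kern q 1 (t - x) - kern q 1 (s - x))) {s..t}"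
      by (rule fundamental_theorem_of_calculus[OF that(1)]) (rule d)
    then have "kern q 1 (t - x) - kern q 1 (s - x) = integral {s..t} G'" by (simp add: integral_unique)
    then have "norm (kern q 1 (t - x) - kern q 1 (s - x)) \<le> integral {s..t} (\<lambda>u. norm (G' u))"
      by (simp only:) (intro integral_norm_bound_integral integrable_continuous_real Gc nc order_refl)
    also have "\<dots> \<le> integral {a..b} (\<lambda>u. norm (G' u))"
      using that by (intro integral_subset_le integrable_continuous_real nc) auto
    finally show ?thesis .
  qed
  have "norm (kern q 1 (t - x) - kern q 1 (s - x)) \<le> integral {a..b} (\<lambda>u. norm (G' u))"
    using le[OF _ st] le[OF _ st(2,1)] by (cases "s \<le> t") (simp_all add: norm_minus_commute)
  then show ?thesis unfolding nG .
qed

text \<open>In general the error is at most the Lipschitz constant times the step length 2 pi/N. For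
  p = s' = 1 it is bounded on each step by the variation there; these variations add up to an
  integral of the Poisson kernel, of order 1/(1-q), and the factor 2 pi/N is the step
  length.\<close>

lemma kern_step_error:
  fixes x \<theta> :: real
  assumes q: "0 < q" "q < 1" and p: "p \<ge> 1" and N: "N \<ge> 1" and s: "1 \<le> s'"
    and T: "\<And>k. k < N \<Longrightarrow> T k \<in> {2 * pi * real k / real N..2 * pi * real (Suc k) / real N}"
  defines "v \<equiv> \<lambda>t. Re (cis (real N * t + \<theta>) * kern q p (t - x)) - Re (cis (real N * t + \<theta>) * kern q p (T (step_index N t) - x))"
  shows "v \<in> borel_measurable lebesgue" "\<And>t. \<bar>v t\<bar> \<le> 4 * pi / (real N * (1 - q) ^ gamma_exp p)"
    "Lp_norm s' v \<le> 128 / (real N * (1 - q) ^ sigma_exp s' p)"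
proof -
  let ?j = "step_index N"
  let ?a = "\<lambda>k::nat. 2 * pi * real k / real N"
  define G where "G = (\<lambda>t. kern q p (t - x))"
  have Npos: "0 < real N" using N by simp
  have q1: "1 - q > 0" using q by simp
  have v: "v t = Re (cis (real N * t + \<theta>) * (G t - G (T (?j t))))" for t
    unfolding v_def G_def right_diff_distrib by simp
  have vle: "\<bar>v t\<bar> \<le> cmod (G t - G (T (?j t)))" for t
  proof -
    have "\<bar>v t\<bar> \<le> cmod (cis (real N * t + \<theta>) * (G t - G (T (?j t))))" unfolding v by (rule abs_Re_le_cmod)
    then show ?thesis by (simp add: norm_mult)
  qed
  have Gper: "G (t + 2 * pi) = G t" for t unfolding G_def by (rule kern_shift_periodic)
  have "(\<lambda>t. Re (cis (real N * t + \<theta>) * kern q p (t - x))) \<in> borel_measurable lebesgue"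
    by (intro borel_measurable_lebesgue_continuous continuous_intros kern_shift_continuous q)
  moreover have "(\<lambda>t. Re (cis (real N * t + \<theta>) * kern q p (T (?j t) - x))) \<in> borel_measurable lebesgue"
    by (rule step_function_measurable[of "\<lambda>k u. Re (cis (u + \<theta>) * kern q p (T k - x))"]) (intro continuous_intros)
  ultimately show vm: "v \<in> borel_measurable lebesgue" unfolding v_def by simp
  show vb: "\<bar>v t\<bar> \<le> 4 * pi / (real N * (1 - q) ^ gamma_exp p)" for t
  proof -
    obtain k :: int where k: "t + of_int k * (2 * pi) \<in> {0..<2 * pi}" by (rule periodic_representative)
    define t' where "t' = t + of_int k * (2 * pi)"
    have Gt: "G t = G t'" unfolding t'_def by (rule periodic_shift_int[of G "2 * pi" t k, OF Gper, symmetric])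
    have jt: "?j t = ?j t'" unfolding t'_def by (rule periodic_shift_int[of ?j "2 * pi" t k, OF step_index_periodic[OF N], symmetric])
    have "t' \<in> {?a (?j t')..?a (Suc (?j t'))}" using step_index_interval[OF N] k by (simp add: t'_def)
    moreover have "T (?j t') \<in> {?a (?j t')..?a (Suc (?j t'))}" by (rule T[OF step_index_less[OF N]])
    moreover have "?a (Suc k) = ?a k + 2 * pi / real N" for k by (simp add: algebra_simps add_divide_distrib)
    ultimately have close: "\<bar>t' - T (?j t')\<bar> \<le> 2 * pi / real N" by (auto simp: abs_le_iff)
    have "\<bar>v t\<bar> \<le> cmod (G t' - G (T (?j t')))" using vle[of t] by (simp add: Gt jt)
    also have "\<dots> \<le> 2 / (1 - q) ^ gamma_exp p * \<bar>(t' - x) - (T (?j t') - x)\<bar>"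
      unfolding G_def by (rule kern_Lipschitz_const[OF q])
    also have "\<dots> \<le> 2 / (1 - q) ^ gamma_exp p * (2 * pi / real N)"
      using close q1 by (intro mult_left_mono) auto
    finally show ?thesis by (simp add: mult_ac)
  qed
  have pi2: "8 * pi * pi \<le> 128"
    using mult_mono[of pi 4 pi 4] pi_less_4 by simp
  show "Lp_norm s' v \<le> 128 / (real N * (1 - q) ^ sigma_exp s' p)"
  proof (cases "p = 1 \<and> s' = 1")
    case False
    have "sigma_exp s' p = gamma_exp p" using False by (auto simp: sigma_exp_def gamma_exp_def)
    moreover have "Lp_norm s' v \<le> 2 * pi * (4 * pi / (real N * (1 - q) ^ gamma_exp p))"
      by (rule Lp_norm_bounded[OF vm vb s])
    moreover have "2 * pi * (4 * pi / (real N * (1 - q) ^ gamma_exp p)) = (8 * pi * pi) / (real N * (1 - q) ^ gamma_exp p)" by simp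
    moreover have "(8 * pi * pi) / (real N * (1 - q) ^ gamma_exp p) \<le> 128 / (real N * (1 - q) ^ gamma_exp p)"
      using pi2 Npos q1 by (intro divide_right_mono) auto
    ultimately show ?thesis by simp
  next
    case True
    let ?D = "\<lambda>u. q / (1 - 2 * q * cos (u - x) + q\<^sup>2)"
    have q0: "0 \<le> q" using q by simp
    have q2: "1 - q\<^sup>2 > 0" using q by (simp add: abs_square_less_1)
    have Dc: "continuous_on S ?D" for S
      using q by (intro continuous_intros ballI one_minus_cis_square_nonzero) auto
    define V where "V = (\<lambda>k. integral {?a k..?a (Suc k)} ?D)"
    have V0: "V k \<ge> 0" for k unfolding V_def
      by (intro Henstock_Kurzweil_Integration.integral_nonneg integrable_continuous_real Dc)
        (use q one_minus_cis_square_pos(2)[OF q0 q(2)] in \<open>auto intro!: divide_nonneg_pos\<close>)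
    have VI: "\<bar>V k\<bar> \<le> (\<Sum>k<N. V k)" if "k < N" for k
      using V0 that by (simp add: member_le_sum)
    have Pc: "continuous_on UNIV (\<lambda>t. (1 - q\<^sup>2) / (1 - 2 * q * cos t + q\<^sup>2))"
      by (intro continuous_intros ballI one_minus_cis_square_nonzero q0 q(2))
    have "integral {0..2 * pi} (\<lambda>t. (1 - q\<^sup>2) / (1 - 2 * q * cos (- x + t) + q\<^sup>2)) =
        integral {0..2 * pi} (\<lambda>t. (1 - q\<^sup>2) / (1 - 2 * q * cos t + q\<^sup>2))"
      by (rule integral_periodic_reflect(1)[OF _ Pc]) simp
    then have PI: "integral {0..2 * pi} (\<lambda>t. (1 - q\<^sup>2) / (1 - 2 * q * cos (t - x) + q\<^sup>2)) = 2 * pi"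
      using poisson_kernel_integral[OF q0 q(2)] by simp
    have "?D = (\<lambda>t. (q / (1 - q\<^sup>2)) * ((1 - q\<^sup>2) / (1 - 2 * q * cos (t - x) + q\<^sup>2)))"
      using q2 by auto
    then have ID: "integral {0..2 * pi} ?D = (q / (1 - q\<^sup>2)) * (2 * pi)"
      using PI by (simp only: integral_mult_right)
    have ILV: "set_integrable lebesgue {0..2 * pi} (\<lambda>t. V (?j t))"
      "(LINT t:{0..2 * pi}|lebesgue. V (?j t)) = (\<Sum>k<N. integral {0..2 * pi} (\<lambda>u. V k)) / real N"
      using step_function_LINT[of N "\<lambda>k u. V k" "\<Sum>k<N. V k", OF N] VI by auto
    have "Lp_norm s' v = (LINT t:{0..2 * pi}|lebesgue. \<bar>v t\<bar>)" using True by (simp add: Lp_norm_1)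
    also have "\<dots> \<le> (LINT t:{0..2 * pi}|lebesgue. V (?j t))"
    proof (rule set_integral_mono_AE)
      have "\<bar>v t\<bar> \<le> V (?j t)" if t: "t \<in> {0..<2 * pi}" for t
      proof -
        have "\<bar>v t\<bar> \<le> cmod (G t - G (T (?j t)))" by (rule vle)
        also have "\<dots> \<le> V (?j t)" unfolding G_def V_def using True
          by (simp only:) (rule kern_1_increment[OF q T[OF step_index_less[OF N]] step_index_interval[OF N t]])
        finally show ?thesis .
      qed
      \<comment> \<open>At 2 pi the index has wrapped to 0, so the variation of the last step does
        not apply there.\<close>
      moreover have "AE t in lebesgue. t \<noteq> 2 * pi"
        by (rule AE_I'[of "{2 * pi}"]) (auto simp: negligible_iff_null_sets[symmetric])
      ultimately show "AE t in lebesgue. t \<in> {0..2 * pi} \<longrightarrow> \<bar>v t\<bar> \<le> V (?j t)"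
        by (auto elim!: eventually_mono simp: less_le)
    qed (intro set_integrable_abs set_integrable_bounded_Icc[OF vm vb] ILV)+
    also have "\<dots> = 2 * pi / real N * (\<Sum>k<N. V k)"
      unfolding ILV by (simp add: sum_distrib_left sum_divide_distrib)
    also have "(\<Sum>k<N. V k) = (q / (1 - q\<^sup>2)) * (2 * pi)"
      unfolding V_def partition_integral[OF N Dc] ID ..
    also have "2 * pi / real N * ((q / (1 - q\<^sup>2)) * (2 * pi)) \<le> 2 * pi / real N * ((1 / (1 - q)) * (2 * pi))"
    proof (intro mult_left_mono mult_right_mono frac_le)
      show "1 - q \<le> 1 - q\<^sup>2" using q by (simp add: power2_eq_square mult_left_le)
    qed (use q Npos in auto)
    also have "\<dots> = (4 * pi * pi) / (real N * (1 - q))" by simp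
    also have "\<dots> \<le> 128 / (real N * (1 - q))"
      using pi2 Npos q1 by (intro divide_right_mono) auto
    finally show ?thesis using True by (simp add: sigma_exp_def)
  qed
qed

lemma Lp_norm_shift:
  fixes u :: "real \<Rightarrow> real"
  assumes cont: "continuous_on UNIV u" and per: "\<And>t. u (t + 2 * pi) = u t" and pos: "\<And>t. 0 \<le> u t" and s: "1 \<le> s"
  shows "Lp_norm s (\<lambda>t. u (t - x)) = Lp_norm s u"
proof (cases "s = \<infinity>")
  case True
  obtain t0 where t0: "\<And>t. u t \<le> u t0" using periodic_attains_sup[OF cont per] by blast
  have "continuous_on UNIV (\<lambda>t. u (t - x))"
    by (rule continuous_on_compose2[OF cont]) (auto intro!: continuous_intros)
  then have "Lp_norm \<infinity> (\<lambda>t. u (t - x)) = \<bar>u (t0 + x - x)\<bar>"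
    by (rule Lp_norm_infinity_continuous[where u = "\<lambda>t. u (t - x)" and ?t0.0 = "t0 + x"]) (use t0 pos in simp)
  moreover have "Lp_norm \<infinity> u = \<bar>u t0\<bar>"
    by (rule Lp_norm_infinity_continuous[OF cont]) (use t0 pos in simp)
  ultimately show ?thesis using True by simp
next
  case False
  then obtain r where sr: "s = ereal r" using s by (cases s) auto
  have r: "1 \<le> r" using s sr by simp
  have pc: "continuous_on S (\<lambda>t. \<bar>u (g t)\<bar> powr r)" if "continuous_on S g" for S and g :: "real \<Rightarrow> real"
    using r by (intro continuous_on_powr' continuous_intros continuous_on_compose2[OF cont that]) auto
  have "integral {0..2 * pi} (\<lambda>t. \<bar>u (- x + t)\<bar> powr r) = integral {0..2 * pi} (\<lambda>t. \<bar>u t\<bar> powr r)"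
    by (rule integral_periodic_reflect(1)) (auto simp: per intro!: pc continuous_intros)
  moreover have "(LINT t:{0..2 * pi}|lebesgue. \<bar>u t\<bar> powr r) = integral {0..2 * pi} (\<lambda>t. \<bar>u t\<bar> powr r)"
    by (intro set_integrable_continuous_Icc pc continuous_intros)
  moreover have "(LINT t:{0..2 * pi}|lebesgue. \<bar>u (t - x)\<bar> powr r) = integral {0..2 * pi} (\<lambda>t. \<bar>u (t - x)\<bar> powr r)"
    by (intro set_integrable_continuous_Icc pc continuous_intros)
  ultimately show ?thesis unfolding sr Lp_norm_finite by simp
qed

lemma conj_exponent_ge_1: "1 \<le> s \<Longrightarrow> 1 \<le> conj_exponent s"
  by (cases rule: conj_exponent_cases) auto

text \<open>The kernel is a modulated step function plus an error. The first has an exactly solved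
  extremal problem, and Hoelder's inequality makes the contribution of the second of order 1/N for
  every \<phi> in the ball.\<close>

lemma U0_kern_int:
  assumes q: "0 < q" "q < 1" and p: "p \<ge> 1" and N: "N \<ge> 1" and s: "1 \<le> s"
  defines "s' \<equiv> conj_exponent s"
  defines "main \<equiv> Lp_norm s' cos / pi powr (1 + real_of_ereal (1 / s')) * K_const q p s'"
  defines "err \<equiv> 64 * (1 / (1 - q) ^ sigma_exp s' p) / real N"
  shows "\<phi> \<in> U0 s \<Longrightarrow> \<bar>kern_int q p N b \<phi> x\<bar> / pi \<le> main + err"
    and "\<epsilon> > 0 \<Longrightarrow> \<exists>\<phi>\<in>U0 s. kern_int q p N b \<phi> 0 / pi \<ge> main - err - \<epsilon>"
proof -
  have s': "1 \<le> s'" unfolding s'_def by (rule conj_exponent_ge_1[OF s])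
  define L where "L = (\<lambda>x. Lp_norm s' cos / (2 * pi) powr real_of_ereal (1 / s') * Lp_norm s' (\<lambda>t. cmod (kern q p (t - x))))"
  define \<delta> where "\<delta> = 128 / (real N * (1 - q) ^ sigma_exp s' p)"
  \<comment> \<open>The constant 64 is 128/2, from pi \<ge> 2.\<close>
  have \<delta>: "\<delta> / pi \<le> err"
  proof -
    have d0: "0 \<le> \<delta>" using q by (simp add: \<delta>_def)
    then have "\<delta> / pi \<le> \<delta> / 2" using pi_gt3 by (intro divide_left_mono) auto
    also have "\<dots> = err" by (simp add: \<delta>_def err_def mult_ac)
    finally show ?thesis .
  qed
  have L: "L x / pi = main" for x
  proof -
    have "Lp_norm s' (\<lambda>t. cmod (kern q p (t - x))) = Lp_norm s' (\<lambda>t. cmod (kern q p t))"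
      by (rule Lp_norm_shift) (auto intro!: continuous_on_norm kern_continuous q s' simp: kern_periodic)
    then have "L x / pi = Lp_norm s' cos / ((2 * pi) powr real_of_ereal (1 / s') * pi) * Lp_norm s' (\<lambda>t. cmod (kern q p t))"
      by (simp add: L_def)
    \<comment> \<open>The power of 2 is absorbed in \<open>K_const\<close>; the powers of pi combine
      to the denominator of the main term.\<close>
    also have "(2 * pi) powr real_of_ereal (1 / s') * pi = 2 powr real_of_ereal (1 / s') * pi powr (1 + real_of_ereal (1 / s'))"
      by (simp add: powr_mult powr_add)
    finally have eq: "L x / pi = Lp_norm s' cos / (2 powr real_of_ereal (1 / s') * pi powr (1 + real_of_ereal (1 / s'))) *
      Lp_norm s' (\<lambda>t. cmod (kern q p t))" .
    show ?thesis unfolding eq main_def K_const_def cmod_kern[OF q] powr_minus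
      by (simp add: divide_inverse mult_ac)
  qed
  have Gc: "continuous_on UNIV (\<lambda>t. kern q p (t - x))" for x by (rule kern_shift_continuous[OF q])
  have ex: "\<exists>T. (\<forall>k<N. T k \<in> {2 * pi * real k / real N..2 * pi * real (Suc k) / real N}) \<and>
    Lp_norm s' (\<lambda>t. Re (cis (real N * t + \<theta>) * kern q p (T (step_index N t) - x))) \<le> L x \<and>
    (\<forall>\<epsilon>>0. \<exists>\<phi>\<in>U0 s. (LINT t:{0..2 * pi}|lebesgue. \<phi> t * Re (cis (real N * t + \<theta>) * kern q p (T (step_index N t) - x))) \<ge> L x - \<epsilon>)" for x \<theta>
  proof -
    have Lx: "Lp_norm s' cos / (2 * pi) powr real_of_ereal (1 / s') * Lp_norm s' (\<lambda>t. cmod (kern q p (t - x))) = L x"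
      by (simp add: L_def)
    show ?thesis
    proof (rule step_extremal[OF s N Gc[of x] kern_shift_periodic, of \<theta>, folded s'_def, unfolded Lx], goal_cases)
      case (1 T)
      show ?case by (intro exI[of _ T] conjI allI impI 1)
    qed
  qed
  have split: "\<exists>e. \<bar>e\<bar> \<le> \<delta> \<and> kern_int q p N b \<phi> x =
     (LINT t:{0..2 * pi}|lebesgue. \<phi> t * Re (cis (real N * t + (b - real N * x)) * kern q p (T (step_index N t) - x))) + e \<and>
     \<bar>LINT t:{0..2 * pi}|lebesgue. \<phi> t * Re (cis (real N * t + (b - real N * x)) * kern q p (T (step_index N t) - x))\<bar> \<le>
       Lp_norm s' (\<lambda>t. Re (cis (real N * t + (b - real N * x)) * kern q p (T (step_index N t) - x)))"
    if \<phi>: "\<phi> \<in> U0 s" and T: "\<And>k. k < N \<Longrightarrow> T k \<in> {2 * pi * real k / real N..2 * pi * real (Suc k) / real N}" for \<phi> x T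
  proof -
    let ?\<theta> = "b - real N * x"
    let ?w = "\<lambda>t. Re (cis (real N * t + ?\<theta>) * kern q p (t - x))"
    let ?W = "\<lambda>t. Re (cis (real N * t + ?\<theta>) * kern q p (T (step_index N t) - x))"
    have V: "(\<lambda>t. ?w t - ?W t) \<in> borel_measurable lebesgue"
      "\<And>t. \<bar>?w t - ?W t\<bar> \<le> 4 * pi / (real N * (1 - q) ^ gamma_exp p)"
      "Lp_norm s' (\<lambda>t. ?w t - ?W t) \<le> \<delta>"
      unfolding \<delta>_def
      by (rule kern_step_error[OF q p N s' T, where \<theta> = ?\<theta> and x = x], assumption)+
    define B where "B = 2 / (1 - q) ^ (gamma_exp p - 1)"
    have Wm: "?W \<in> borel_measurable lebesgue"
      by (rule step_function_measurable[of "\<lambda>k u. Re (cis (u + ?\<theta>) * kern q p (T k - x))"]) (intro continuous_intros)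
    have Wb: "\<bar>?W t\<bar> \<le> B" for t
    proof -
      have "\<bar>?W t\<bar> \<le> cmod (cis (real N * t + ?\<theta>) * kern q p (T (step_index N t) - x))" by (rule abs_Re_le_cmod)
      also have "\<dots> \<le> B" using kern_bound[OF q p] by (simp add: norm_mult B_def)
      finally show ?thesis .
    qed
    note HW = Holder_U0[OF \<phi> s Wm Wb]
    note HV = Holder_U0[OF \<phi> s V(1,2)]
    have phase: "real N * (t - x) + b = real N * t + ?\<theta>" for t by (simp add: algebra_simps)
    have alg: "a * w = a * W + a * (w - W)" for a w W :: real by (simp add: algebra_simps)
    have "\<phi> t * Re (cis (real N * (t - x) + b) * kern q p (t - x)) = \<phi> t * ?W t + \<phi> t * (?w t - ?W t)" for t
      unfolding phase by (rule alg)
    then have "kern_int q p N b \<phi> x = (LINT t:{0..2 * pi}|lebesgue. \<phi> t * ?W t + \<phi> t * (?w t - ?W t))"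
      unfolding kern_int_def by (simp only:)
    also have "\<dots> = (LINT t:{0..2 * pi}|lebesgue. \<phi> t * ?W t) + (LINT t:{0..2 * pi}|lebesgue. \<phi> t * (?w t - ?W t))"
      by (intro set_integral_add HW(1) HV(1))
    finally have 1: "kern_int q p N b \<phi> x = (LINT t:{0..2 * pi}|lebesgue. \<phi> t * ?W t) + (LINT t:{0..2 * pi}|lebesgue. \<phi> t * (?w t - ?W t))" .
    have 2: "\<bar>LINT t:{0..2 * pi}|lebesgue. \<phi> t * (?w t - ?W t)\<bar> \<le> \<delta>"
      using HV(2) V(3) unfolding s'_def by linarith
    show ?thesis by (rule exI[of _ "LINT t:{0..2 * pi}|lebesgue. \<phi> t * (?w t - ?W t)"]) (intro conjI 2 1 HW(2)[folded s'_def])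
  qed
  show "\<bar>kern_int q p N b \<phi> x\<bar> / pi \<le> main + err" if \<phi>: "\<phi> \<in> U0 s"
  proof -
    obtain T where T: "\<And>k. k < N \<Longrightarrow> T k \<in> {2 * pi * real k / real N..2 * pi * real (Suc k) / real N}"
      "Lp_norm s' (\<lambda>t. Re (cis (real N * t + (b - real N * x)) * kern q p (T (step_index N t) - x))) \<le> L x"
      using ex by blast
    have "\<bar>kern_int q p N b \<phi> x\<bar> \<le> L x + \<delta>" using split[OF \<phi> T(1), of x] T(2) by force
    then have "\<bar>kern_int q p N b \<phi> x\<bar> / pi \<le> (L x + \<delta>) / pi" by (intro divide_right_mono) auto
    then show ?thesis using \<delta> by (simp add: add_divide_distrib L)
  qed
  show "\<exists>\<phi>\<in>U0 s. kern_int q p N b \<phi> 0 / pi \<ge> main - err - \<epsilon>" if \<epsilon>: "\<epsilon> > 0"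
  proof -
    obtain T where T: "\<And>k. k < N \<Longrightarrow> T k \<in> {2 * pi * real k / real N..2 * pi * real (Suc k) / real N}"
      and lo: "\<And>\<epsilon>. \<epsilon> > 0 \<Longrightarrow> \<exists>\<phi>\<in>U0 s. (LINT t:{0..2 * pi}|lebesgue. \<phi> t * Re (cis (real N * t + (b - real N * 0)) * kern q p (T (step_index N t) - 0))) \<ge> L 0 - \<epsilon>"
      using ex[of "b - real N * 0" 0] by blast
    have "pi * \<epsilon> > 0" using \<epsilon> by simp
    from lo[OF this] obtain \<phi> where \<phi>: "\<phi> \<in> U0 s"
      "(LINT t:{0..2 * pi}|lebesgue. \<phi> t * Re (cis (real N * t + (b - real N * 0)) * kern q p (T (step_index N t) - 0))) \<ge> L 0 - pi * \<epsilon>"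
      by blast
    have "L 0 - \<delta> - pi * \<epsilon> \<le> kern_int q p N b \<phi> 0" using split[OF \<phi>(1) T, of 0] \<phi>(2) by force
    then have "(L 0 - \<delta> - pi * \<epsilon>) / pi \<le> kern_int q p N b \<phi> 0 / pi" by (intro divide_right_mono) auto
    then have "main - err - \<epsilon> \<le> kern_int q p N b \<phi> 0 / pi" using \<delta> L[of 0] by (simp add: diff_divide_distrib)
    then show ?thesis using \<phi>(1) by blast
  qed
qed

lemma U0_phase_coeff_bound:
  assumes s: "1 \<le> s" and \<phi>: "\<phi> \<in> U0 s"
  shows "\<bar>phase_coeff k b \<phi> x\<bar> \<le> 2"
proof -
  let ?c = "\<lambda>t. cos (real k * (t - x) + b)"
  have m: "?c \<in> borel_measurable lebesgue" by (intro borel_measurable_lebesgue_continuous continuous_intros)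
  have "\<bar>LINT t:{0..2 * pi}|lebesgue. \<phi> t * ?c t\<bar> \<le> Lp_norm (conj_exponent s) ?c"
    by (rule Holder_U0(2)[OF \<phi> s m, of 1]) simp
  also have "\<dots> \<le> 2 * pi * 1" by (rule Lp_norm_bounded[OF m _ conj_exponent_ge_1[OF s]]) simp
  finally show ?thesis by (simp add: phase_coeff_def abs_mult field_simps)
qed

section \<open>Both asymptotic equalities\<close>

lemma approx_error_U0:
  assumes q: "0 < q" "q < 1" and m: "m \<ge> 1" and p: "1 \<le> p" "p \<le> n"
    and N_def: "N = n - p + 1" and N: "N \<ge> 1" "large_index q m N" and s: "1 \<le> s" and s': "s' = conj_exponent s"
  shows "\<exists>R. \<bar>R\<bar> \<le> 160 \<and> approx_error (C_class (psi_polyharmonic m q) \<beta> (U0 s)) n p =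
    ereal (q ^ N / real p * polyharmonic_factor m q N *
      (Lp_norm s' cos / pi powr (1 + real_of_ereal (1 / s')) * K_const q p s' +
       R / real N * (1 / (1 - q) ^ sigma_exp s' p + real m * q / (1 - q)\<^sup>2 * min (real p) (1 / (1 - q)))))"
proof -
  define X where "X = real m * q / (1 - q)\<^sup>2 * min (real p) (1 / (1 - q))"
  have Npos: "real N > 0" using N by simp
  have q1: "1 - q > 0" using q by simp
  have X0: "X \<ge> 0" unfolding X_def using q by simp
  show ?thesis
  proof (rule approx_error_reduction[OF q m p N_def N(2)])
    show "\<phi> \<in> Lp_space 1" if "\<phi> \<in> U0 s" for \<phi> using U0_cases(1)[OF that s] .
    show "\<bar>phase_coeff k (\<beta> * pi / 2) \<phi> x\<bar> \<le> 2" if "\<phi> \<in> U0 s" for \<phi> k x by (rule U0_phase_coeff_bound[OF s that])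
    show "\<bar>kern_int q p N (\<beta> * pi / 2) \<phi> x\<bar> / pi \<le> Lp_norm s' cos / pi powr (1 + real_of_ereal (1 / s')) * K_const q p s' +
        64 * (1 / (1 - q) ^ sigma_exp s' p) / real N" if "\<phi> \<in> U0 s" for \<phi> x
      unfolding s' by (rule U0_kern_int(1)[OF q p(1) N(1) s that])
    show "\<exists>\<phi>\<in>U0 s. fourier_a 0 \<phi> = 0 \<and> Lp_norm s' cos / pi powr (1 + real_of_ereal (1 / s')) * K_const q p s' -
        64 * (1 / (1 - q) ^ sigma_exp s' p) / real N - \<epsilon> \<le> kern_int q p N (\<beta> * pi / 2) \<phi> 0 / pi" if "\<epsilon> > 0" for \<epsilon>
      using U0_kern_int(2)[OF q p(1) N(1) s that, of "\<beta> * pi / 2"] U0_cases(2)[OF _ s] unfolding s' by blast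
    have "64 * (1 / (1 - q) ^ sigma_exp s' p) + 64 * X \<le> 160 * (1 / (1 - q) ^ sigma_exp s' p + X)"
      using X0 q1 by (simp add: distrib_left add_mono divide_right_mono)
    then have "(64 * (1 / (1 - q) ^ sigma_exp s' p) + 64 * X) / real N \<le> 160 * (1 / (1 - q) ^ sigma_exp s' p + X) / real N"
      using Npos by (intro divide_right_mono) auto
    then show "64 * (1 / (1 - q) ^ sigma_exp s' p) / real N + 32 * 2 * (real m * q / (1 - q)\<^sup>2 * min (real p) (1 / (1 - q))) / real N
      \<le> 160 * (1 / (1 - q) ^ sigma_exp s' p + real m * q / (1 - q)\<^sup>2 * min (real p) (1 / (1 - q))) / real N"
      unfolding X_def[symmetric] by (simp add: add_divide_distrib)
    show "0 < 1 / (1 - q) ^ sigma_exp s' p + real m * q / (1 - q)\<^sup>2 * min (real p) (1 / (1 - q))"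
      unfolding X_def[symmetric] using X0 q1 by (intro add_pos_nonneg) auto
  qed
qed

lemma approx_error_H_class:
  assumes q: "0 < q" "q < 1" and m: "m \<ge> 1" and p: "1 \<le> p" "p \<le> n"
    and N_def: "N = n - p + 1" and N: "N \<ge> 1" "large_index q m N" "6 / (1 - q) \<le> real N"
    and \<omega>: "modulus_of_continuity \<omega>" "concave_on {0..} \<omega>" and inf: "filterlim (\<lambda>t. \<omega> t / t) at_top (at_right 0)"
  shows "\<exists>R. \<bar>R\<bar> \<le> 160 \<and> approx_error (C_class (psi_polyharmonic m q) \<beta> (H_class \<omega>)) n p =
    ereal (q ^ N / real p * polyharmonic_factor m q N *
      (4 / pi\<^sup>2 * ((1 - q ^ (2 * p)) / (1 - q\<^sup>2)) * elliptic_K (q ^ p) *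
         (LINT t:{0..pi / 2}|lebesgue. \<omega> (2 * t / real N) * sin t) +
       R / real N * (\<omega> pi / (1 - q) ^ gamma_exp p + real m * q / (1 - q)\<^sup>2 * min (real p) (1 / (1 - q)) * \<omega> (1 / real N))))"
proof -
  define X where "X = real m * q / (1 - q)\<^sup>2 * min (real p) (1 / (1 - q))"
  have Npos: "real N > 0" using N by simp
  have q1: "1 - q > 0" using q by simp
  have X0: "X \<ge> 0" unfolding X_def using q by simp
  \<comment> \<open>Growth of \<omega>(t)/t at 0 excludes the zero modulus; the scale of the error
    term is then positive and \<open>R\<close> can be solved for.\<close>
  have \<omega>pi: "\<omega> pi > 0"
  proof -
    have "eventually (\<lambda>t. \<omega> t / t \<ge> 1) (at_right 0)" using inf by (simp add: filterlim_at_top)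
    moreover have "eventually (\<lambda>t::real. t \<in> {0<..<pi}) (at_right 0)" by (intro eventually_at_right_real) simp
    ultimately have "eventually (\<lambda>t. \<omega> t / t \<ge> 1 \<and> t \<in> {0<..<pi}) (at_right 0)" by (rule eventually_conj)
    then have "\<exists>t. \<omega> t / t \<ge> 1 \<and> t \<in> {0<..<pi}"
      using eventually_happens trivial_limit_at_right_real by blast
    then obtain t where t: "\<omega> t / t \<ge> 1" "t \<in> {0<..<pi}" by blast
    then have "0 < \<omega> t" by (auto simp: field_simps)
    also have "\<dots> \<le> \<omega> pi" using t by (intro modulus_of_continuityD(2)[OF \<omega>(1)]) auto
    finally show ?thesis .
  qed
  have \<omega>N: "0 \<le> \<omega> (1 / real N)" by (rule modulus_of_continuityD(4)[OF \<omega>(1)]) simp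
  show ?thesis
    unfolding modulus_mean_LINT[OF \<omega>(1) Npos]
  proof (rule approx_error_reduction[OF q m p N_def N(2)])
    show "\<phi> \<in> Lp_space 1" if "\<phi> \<in> H_class \<omega>" for \<phi>
      using C_space_subset_Lp_1 H_classD(1)[OF \<omega>(1) that] by blast
    show "\<bar>phase_coeff k (\<beta> * pi / 2) \<phi> x\<bar> \<le> 4 * \<omega> (1 / real N)" if "\<phi> \<in> H_class \<omega>" "N \<le> k" for \<phi> k x
      by (rule H_class_phase_coeff_bound[OF \<omega>(1) that(1) N(1) that(2)])
    show "\<bar>kern_int q p N (\<beta> * pi / 2) \<phi> x\<bar> / pi \<le>
        4 / pi\<^sup>2 * ((1 - q ^ (2 * p)) / (1 - q\<^sup>2)) * elliptic_K (q ^ p) * modulus_mean \<omega> (real N) +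
        160 * (\<omega> pi / (1 - q) ^ gamma_exp p) / real N" if "\<phi> \<in> H_class \<omega>" for \<phi> x
      by (rule H_class_kern_int(1)[OF q p(1) N(1,3) \<omega> that])
    show "\<exists>\<phi>\<in>H_class \<omega>. fourier_a 0 \<phi> = 0 \<and> 4 / pi\<^sup>2 * ((1 - q ^ (2 * p)) / (1 - q\<^sup>2)) * elliptic_K (q ^ p) * modulus_mean \<omega> (real N) -
        160 * (\<omega> pi / (1 - q) ^ gamma_exp p) / real N - \<epsilon> \<le> kern_int q p N (\<beta> * pi / 2) \<phi> 0 / pi" if "\<epsilon> > 0" for \<epsilon>
      using H_class_kern_int(2)[OF q p(1) N(1,3) \<omega>, of "\<beta> * pi / 2"] that by force
    have "160 * (\<omega> pi / (1 - q) ^ gamma_exp p) + 128 * (X * \<omega> (1 / real N)) \<le> 160 * (\<omega> pi / (1 - q) ^ gamma_exp p + X * \<omega> (1 / real N))"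
      using X0 \<omega>N by (simp add: distrib_left)
    then have "(160 * (\<omega> pi / (1 - q) ^ gamma_exp p) + 128 * (X * \<omega> (1 / real N))) / real N \<le> 160 * (\<omega> pi / (1 - q) ^ gamma_exp p + X * \<omega> (1 / real N)) / real N"
      using Npos by (intro divide_right_mono) auto
    then show "160 * (\<omega> pi / (1 - q) ^ gamma_exp p) / real N + 32 * (4 * \<omega> (1 / real N)) * (real m * q / (1 - q)\<^sup>2 * min (real p) (1 / (1 - q))) / real N
      \<le> 160 * (\<omega> pi / (1 - q) ^ gamma_exp p + real m * q / (1 - q)\<^sup>2 * min (real p) (1 / (1 - q)) * \<omega> (1 / real N)) / real N"
      unfolding X_def[symmetric] by (simp add: add_divide_distrib mult_ac)
    show "0 < \<omega> pi / (1 - q) ^ gamma_exp p + real m * q / (1 - q)\<^sup>2 * min (real p) (1 / (1 - q)) * \<omega> (1 / real N)"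
      unfolding X_def[symmetric] using X0 q1 \<omega>N \<omega>pi by (intro add_pos_nonneg) auto
  qed
qed

text \<open>The order of quantifiers expresses the uniformity: the constant precedes everything, the
  threshold sees only \<open>q\<close> and \<open>m\<close>, and all remaining parameters come after
  it.\<close>

theorem corollary5:
  shows "\<exists>K::real. \<forall>(q::real) (m::nat). 0 < q \<and> q < 1 \<and> 1 \<le> m \<longrightarrow>
    (\<exists>N::nat. \<forall>(n::nat) (p::nat) (\<beta>::real) (s::ereal) (s'::ereal) (\<omega>::real \<Rightarrow> real).
       1 \<le> p \<and> p \<le> n \<and> N \<le> n - p \<and>
       1 \<le> s \<and> s' = conj_exponent s \<and>
       modulus_of_continuity \<omega> \<and> concave_on {0..} \<omega> \<and>
       filterlim (\<lambda>t. \<omega> t / t) at_top (at_right 0) \<longrightarrow>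
       (\<exists>R::real. \<bar>R\<bar> \<le> K \<and>
          approx_error (C_class (psi_polyharmonic m q) \<beta> (U0 s)) n p =
            ereal (q ^ (n - p + 1) / real p * polyharmonic_factor m q (n - p + 1) *
              (Lp_norm s' cos / pi powr (1 + real_of_ereal (1 / s')) * K_const q p s' +
               R / real (n - p + 1) *
                 (1 / (1 - q) ^ sigma_exp s' p +
                  real m * q / (1 - q)\<^sup>2 * min (real p) (1 / (1 - q)))))) \<and>
       (\<exists>R::real. \<bar>R\<bar> \<le> K \<and>
          approx_error (C_class (psi_polyharmonic m q) \<beta> (H_class \<omega>)) n p =
            ereal (q ^ (n - p + 1) / real p * polyharmonic_factor m q (n - p + 1) *
              (4 / pi\<^sup>2 * ((1 - q ^ (2 * p)) / (1 - q\<^sup>2)) * elliptic_K (q ^ p) *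
                 (LINT t:{0..pi / 2}|lebesgue. \<omega> (2 * t / real (n - p + 1)) * sin t) +
               R / real (n - p + 1) *
                 (\<omega> pi / (1 - q) ^ gamma_exp p +
                  real m * q / (1 - q)\<^sup>2 * min (real p) (1 / (1 - q)) * \<omega> (1 / real (n - p + 1)))))))"
proof (intro exI[of _ "160 :: real"] allI impI, elim conjE, goal_cases)
  case (1 q m)
  note q = 1(1,2) and m = 1(3)
  obtain N0 where N0: "\<And>N. N \<ge> N0 \<Longrightarrow> large_index q m N" using ex_large_index[OF q] by blast
  \<comment> \<open>\<open>N0\<close> secures the geometric comparison of the coefficients,
    \<open>N1\<close> the monotone total phase.\<close>
  obtain N1 :: nat where N1: "6 / (1 - q) \<le> real N1" using real_arch_simple by blast
  have N: "n - p + 1 \<ge> 1" "large_index q m (n - p + 1)" "6 / (1 - q) \<le> real (n - p + 1)" if "max N0 N1 \<le> n - p" for n p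
    using that N0[of "n - p + 1"] N1 by auto
  show ?case
    by (intro exI[of _ "max N0 N1"] allI impI, elim conjE, intro conjI)
      (rule approx_error_U0[OF q m _ _ refl N(1,2)] approx_error_H_class[OF q m _ _ refl N]; assumption)+
qed

end
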